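(* Let $A=(A_{\alpha\beta}x_{\alpha\beta})$ be a $(2\times2)$-type generic partitioned matrix over a field $\mathbf{F}$ with associated bipartite graph $G=([\mu],[\nu];E)$. An edge subset $I\subseteq E$ is a matching if and only if $I$ satisfies (Deg), (Path), (Cycle), and (VL). In addition, for every matching $I$ it holds that $\operatorname{rank}A_I=r(I)$.
   Context: **Setting.** $\mathbf{F}$ is a field; $A_{\alpha\beta}\in\mathbf{F}^{2\times2}$ for $\alpha\in[\mu]=\{1,\dots,\mu\}$, $\beta\in[\nu]$; $x_{\alpha\beta}$ are distinct commuting indeterminates; $A$ is the $2\mu\times2\nu$ block matrix with $(\alpha,\beta)$-block $A_{\alpha\beta}x_{\alpha\beta}$, regarded over the rational function field $\mathbf{F}(x)$. $U_\alpha=\mathbf{F}^2$ and $V_\beta=\mathbf{F}^2$; $A_{\alpha\beta}$ is viewed as the bilinear form $A_{\alpha\beta}(u,v)=u^\top A_{\alpha\beta}v$ on $U_\alpha\times V_\beta$, with left and right kernels $\ker_{\rm L}(A_{\alpha\beta})\subseteq U_\alpha$, $\ker_{\rm R}(A_{\alpha\beta})\subseteq V_\beta$. $G=([\mu],[\nu];E)$ is the bipartite graph (color classes $[\mu]$ and $[\nu]$ considered disjoint) with $E=\{\alpha\beta\mid A_{\alpha\beta}\ne O\}$. For $I\subseteq E$, $A_I$ is obtained from $A$ by replacing every block $(\alpha,\beta)$ with $\alpha\beta\notin I$ by the zero block; $I$ also denotes the subgraph $([\mu],[\nu];I)$, and $\deg_I(\gamma)$ is the degree of node $\gamma$ in it.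 An edge $\alpha\beta\in E$ is rank-$k$ ($k=1,2$) if $\operatorname{rank}A_{\alpha\beta}=k$. An edge $\alpha\beta\in I$ is isolated if $\deg_I(\alpha)=\deg_I(\beta)=1$. **Matching.** $I\subseteq E$ is a matching if $\operatorname{rank}A_I>\operatorname{rank}A_{I\setminus\{\alpha\beta\}}$ for every $\alpha\beta\in I$. **Conditions.** (Deg): $\deg_I(\gamma)\le2$ for every node $\gamma$. If this holds, each connected component of $I$ is a path or a cycle and $I$ is 2-edge-colorable; fix a coloring with classes "$+$-edges" and "$-$-edges" such that any two edges of $I$ sharing a node are in different classes. An end edge of a path component $C$ is an edge $\alpha\beta\in C$ with $\deg_I(\alpha)=1$ or $\deg_I(\beta)=1$. (Path): for each path component of $I$ that is not a single isolated edge, both end edges are rank-1. (Cycle): each cycle component of $I$ has both a rank-1 $+$-edge and a rank-1 $-$-edge. (VL): $I$ has a valid labeling, i.e. an assignment to each node of two distinct 1-dimensional subspaces, $U_\alpha^+\neq U_\alpha^-$ of $U_\alpha$ for each $\alpha$ and $V_\beta^+\ne V_\beta^-$ of $V_\beta$ for each $\beta$, such that for each $\alpha\beta\in I$: $A_{\alpha\beta}(U_\alpha^+,V_\beta^-)=A_{\alpha\beta}(U_\alpha^-,V_\beta^+)=\{0\}$; and $(\ker_{\rm L}(A_{\alpha\beta}),\ker_{\rm R}(A_{\alpha\beta}))$ equals $(U_\alpha^+,V_\beta^+)$ if $\alpha\beta$ is a rank-1 $+$-edge and equals $(U_\alpha^-,V_\beta^-)$ if $\alpha\beta$ is a rank-1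 $-$-edge. **Function $r$.** $r(I):=|I|+{}$(the number of isolated rank-2 edges in $I$). *)

theory Defs
  imports
    "HOL-Analysis.Determinants"
    "HOL-Library.Poly_Mapping"
    "HOL-Library.Product_Lexorder"
    "HOL-Computational_Algebra.Fraction_Field"
begin

text \<open>
  The index sets \<open>[\<mu>]\<close> and \<open>[\<nu>]\<close> are the finite types \<open>'m\<close> and \<open>'n\<close>.
  The library shows that \<open>('v \<Rightarrow>\<^sub>0 nat) \<Rightarrow>\<^sub>0 'f\<close>, the ring of polynomials over \<open>'f\<close>
  in indeterminates indexed by \<open>'v\<close>, is an integral domain only for linearly ordered \<open>'v\<close>;
  this is the sole reason for the class \<open>linorder\<close> below and for the lexicographic
  order on pairs.
\<close>

type_synonym ('v, 'f) ratfun = "(('v \<Rightarrow>\<^sub>0 nat) \<Rightarrow>\<^sub>0 'f) fract"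

definition const_rf :: "'f::field \<Rightarrow> ('v::linorder, 'f) ratfun" where
  "const_rf a = Fract (Poly_Mapping.single 0 a) 1"

definition var_rf :: "'v \<Rightarrow> ('v::linorder, 'f::field) ratfun" where
  "var_rf v = Fract (Poly_Mapping.single (Poly_Mapping.single v 1) 1) 1"

text \<open>
  Row \<open>(\<alpha>, i)\<close> and column \<open>(\<beta>, j)\<close> are row \<open>i\<close> of block row \<open>\<alpha>\<close> and
  column \<open>j\<close> of block column \<open>\<beta>\<close>.
\<close>

definition generic_matrix ::
  "('m \<Rightarrow> 'n \<Rightarrow> 'f::field^2^2)
     \<Rightarrow> ('m::{finite,linorder} \<times> 'n::{finite,linorder}, 'f) ratfun ^ ('n \<times> 2) ^ ('m \<times> 2)" where
  "generic_matrix A =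
     (\<chi> p q. const_rf (A (fst p) (fst q) $ snd p $ snd q) * var_rf (fst p, fst q))"

definition restrict_blocks ::
  "('m \<times> 'n) set \<Rightarrow> 'k::zero ^ ('n::finite \<times> 2) ^ ('m::finite \<times> 2)
     \<Rightarrow> 'k ^ ('n \<times> 2) ^ ('m \<times> 2)" where
  "restrict_blocks I M = (\<chi> p q. if (fst p, fst q) \<in> I then M $ p $ q else 0)"

definition rank_on ::
  "('m::{finite,linorder} \<Rightarrow> 'n::{finite,linorder} \<Rightarrow> 'f::field^2^2) \<Rightarrow> ('m \<times> 'n) set \<Rightarrow> nat" where
  "rank_on A I = rank (restrict_blocks I (generic_matrix A))"

definition edges :: "('m \<Rightarrow> 'n \<Rightarrow> 'f::field^2^2) \<Rightarrow> ('m \<times> 'n) set" where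
  "edges A = {(\<alpha>, \<beta>). A \<alpha> \<beta> \<noteq> 0}"

definition is_matching ::
  "('m::{finite,linorder} \<Rightarrow> 'n::{finite,linorder} \<Rightarrow> 'f::field^2^2) \<Rightarrow> ('m \<times> 'n) set \<Rightarrow> bool" where
  "is_matching A I \<longleftrightarrow> I \<subseteq> edges A \<and> (\<forall>e\<in>I. rank_on A I > rank_on A (I - {e}))"


text \<open>
  Nodes have type \<open>'m + 'n\<close>, so that the two colour classes are disjoint.
  An edge \<open>(\<alpha>, \<beta>)\<close> joins \<open>Inl \<alpha>\<close> and \<open>Inr \<beta>\<close>.
\<close>

definition ends :: "'m \<times> 'n \<Rightarrow> ('m + 'n) set" where
  "ends e = {Inl (fst e), Inr (snd e)}"

definition deg :: "('m \<times> 'n) set \<Rightarrow> 'm + 'n \<Rightarrow> nat" where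
  "deg I \<gamma> = card {e \<in> I. \<gamma> \<in> ends e}"

definition rank_edge :: "('m \<Rightarrow> 'n \<Rightarrow> 'f::field^2^2) \<Rightarrow> nat \<Rightarrow> 'm \<times> 'n \<Rightarrow> bool" where
  "rank_edge A k e \<longleftrightarrow> rank (A (fst e) (snd e)) = k"

definition isolated :: "('m \<times> 'n) set \<Rightarrow> 'm \<times> 'n \<Rightarrow> bool" where
  "isolated I e \<longleftrightarrow> e \<in> I \<and> deg I (Inl (fst e)) = 1 \<and> deg I (Inr (snd e)) = 1"

definition adjacency :: "('m \<times> 'n) set \<Rightarrow> ('m + 'n) rel" where
  "adjacency I = {(\<gamma>, \<delta>). \<exists>e\<in>I. ends e = {\<gamma>, \<delta>}}"

text \<open>The node sets of the connected components; single nodes without edges are included.\<close>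

definition components :: "('m \<times> 'n) set \<Rightarrow> ('m + 'n) set set" where
  "components I = UNIV // (adjacency I)\<^sup>*"

definition component_edges :: "('m \<times> 'n) set \<Rightarrow> ('m + 'n) set \<Rightarrow> ('m \<times> 'n) set" where
  "component_edges I K = {e \<in> I. ends e \<subseteq> K}"

definition path_component :: "('m \<times> 'n) set \<Rightarrow> ('m + 'n) set \<Rightarrow> bool" where
  "path_component I K \<longleftrightarrow> K \<in> components I \<and>
     (\<exists>vs. vs \<noteq> [] \<and> distinct vs \<and> set vs = K \<and>
       ends ` component_edges I K = {{vs ! i, vs ! Suc i} | i. Suc i < length vs})"

definition cycle_component :: "('m \<times> 'n) set \<Rightarrow> ('m + 'n) set \<Rightarrow> bool" where
  "cycle_component I K \<longleftrightarrow> K \<in> components I \<and>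
     (\<exists>vs. length vs \<ge> 3 \<and> distinct vs \<and> set vs = K \<and>
       ends ` component_edges I K =
         {{vs ! i, vs ! (Suc i mod length vs)} | i. i < length vs})"

definition end_edge :: "('m \<times> 'n) set \<Rightarrow> ('m + 'n) set \<Rightarrow> 'm \<times> 'n \<Rightarrow> bool" where
  "end_edge I K e \<longleftrightarrow> e \<in> component_edges I K \<and>
     (deg I (Inl (fst e)) = 1 \<or> deg I (Inr (snd e)) = 1)"


datatype polarity = Plus | Minus

definition proper_coloring :: "('m \<times> 'n) set \<Rightarrow> ('m \<times> 'n \<Rightarrow> polarity) \<Rightarrow> bool" where
  "proper_coloring I c \<longleftrightarrow>
     (\<forall>e\<in>I. \<forall>f\<in>I. e \<noteq> f \<and> ends e \<inter> ends f \<noteq> {} \<longrightarrow> c e \<noteq> c f)"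

definition cond_Deg :: "('m \<times> 'n) set \<Rightarrow> bool" where
  "cond_Deg I \<longleftrightarrow> (\<forall>\<gamma>. deg I \<gamma> \<le> 2)"

definition cond_Path :: "('m \<Rightarrow> 'n \<Rightarrow> 'f::field^2^2) \<Rightarrow> ('m \<times> 'n) set \<Rightarrow> bool" where
  "cond_Path A I \<longleftrightarrow>
     (\<forall>K. path_component I K \<and> \<not> (\<exists>e. isolated I e \<and> component_edges I K = {e}) \<longrightarrow>
       (\<forall>e. end_edge I K e \<longrightarrow> rank_edge A 1 e))"

definition cond_Cycle ::
  "('m \<Rightarrow> 'n \<Rightarrow> 'f::field^2^2) \<Rightarrow> ('m \<times> 'n \<Rightarrow> polarity) \<Rightarrow> ('m \<times> 'n) set \<Rightarrow> bool" where
  "cond_Cycle A c I \<longleftrightarrow>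
     (\<forall>K. cycle_component I K \<longrightarrow>
       (\<forall>s. \<exists>e\<in>component_edges I K. c e = s \<and> rank_edge A 1 e))"

definition bil :: "'f::field^2^2 \<Rightarrow> 'f^2 \<Rightarrow> 'f^2 \<Rightarrow> 'f" where
  "bil B u v = scalar_product u (B *v v)"

definition ker_L :: "'f::field^2^2 \<Rightarrow> ('f^2) set" where
  "ker_L B = {u. \<forall>v. bil B u v = 0}"

definition ker_R :: "'f::field^2^2 \<Rightarrow> ('f^2) set" where
  "ker_R B = {v. \<forall>u. bil B u v = 0}"

definition bil_image :: "'f::field^2^2 \<Rightarrow> ('f^2) set \<Rightarrow> ('f^2) set \<Rightarrow> 'f set" where
  "bil_image B X Y = {bil B u v | u v. u \<in> X \<and> v \<in> Y}"

text \<open>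
  \<open>L (Inl \<alpha>) s\<close> and \<open>L (Inr \<beta>) s\<close> are the lines \<open>U\<^sub>\<alpha>\<^sup>s\<close> and \<open>V\<^sub>\<beta>\<^sup>s\<close>.
\<close>

definition valid_labeling ::
  "('m \<Rightarrow> 'n \<Rightarrow> 'f::field^2^2) \<Rightarrow> ('m \<times> 'n \<Rightarrow> polarity) \<Rightarrow> ('m \<times> 'n) set
     \<Rightarrow> ('m + 'n \<Rightarrow> polarity \<Rightarrow> ('f^2) set) \<Rightarrow> bool" where
  "valid_labeling A c I L \<longleftrightarrow>
     (\<forall>\<gamma>. (\<forall>s. vec.subspace (L \<gamma> s) \<and> vec.dim (L \<gamma> s) = 1) \<and> L \<gamma> Plus \<noteq> L \<gamma> Minus) \<and>
     (\<forall>(\<alpha>, \<beta>)\<in>I.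
        bil_image (A \<alpha> \<beta>) (L (Inl \<alpha>) Plus) (L (Inr \<beta>) Minus) = {0} \<and>
        bil_image (A \<alpha> \<beta>) (L (Inl \<alpha>) Minus) (L (Inr \<beta>) Plus) = {0} \<and>
        (rank_edge A 1 (\<alpha>, \<beta>) \<longrightarrow>
           (ker_L (A \<alpha> \<beta>), ker_R (A \<alpha> \<beta>))
             = (L (Inl \<alpha>) (c (\<alpha>, \<beta>)), L (Inr \<beta>) (c (\<alpha>, \<beta>)))))"

definition cond_VL ::
  "('m \<Rightarrow> 'n \<Rightarrow> 'f::field^2^2) \<Rightarrow> ('m \<times> 'n \<Rightarrow> polarity) \<Rightarrow> ('m \<times> 'n) set \<Rightarrow> bool" where
  "cond_VL A c I \<longleftrightarrow> (\<exists>L. valid_labeling A c I L)"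

definition r_val :: "('m \<Rightarrow> 'n \<Rightarrow> 'f::field^2^2) \<Rightarrow> ('m \<times> 'n) set \<Rightarrow> nat" where
  "r_val A I = card I + card {e. isolated I e \<and> rank_edge A 2 e}"

end

theory Submission
  imports Defs
begin

text \<open>
  A nonzero minor of \<open>A\<^sub>I\<close> has a monomial with nonzero coefficient, and the blocks occurring in this
  monomial already carry the rank of \<open>A\<^sub>I\<close>. Hence a matching \<open>I\<close> admits a transversal that uses each
  of its blocks; as every node offers only two rows or columns, this gives (Deg). Eliminating a
  rank-2 edge at a leaf, or the rank-2 edges of one color on a closed set of nodes, would make other
  edges superfluous, which gives (Path) and (Cycle). The kernels of the rank-1 edges, transported along
  rank-2 edges, determine the labeling; if the two lines at some node coincided, the transversal would
  need more edges than there are.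

  Conversely, bases adapted to a valid labeling make all blocks diagonal, so that \<open>A\<^sub>I\<close> splits into two
  generic matrices with one entry per block. Their ranks are matching numbers of subgraphs of \<open>I\<close>,
  and explicit matchings and vertex covers evaluate them for \<open>I\<close> and bound them for \<open>I - {e}\<close>.
\<close>

section \<open>Rank and minors over a field\<close>

text \<open>The obstacle is that the four entries of a block share one indeterminate: distinct terms
  of a minor can have the same monomial and cancel, so entrywise matching theory does not apply to
  A_I directly. Two facts survive. The coefficient of a monomial is unchanged by deleting blocks
  that the monomial does not mention; this drives the necessity part and makes the rank monotone in
  the set of blocks. And a minor with at most one row per block row and one column per block column
  has no cancellation; lower bounds come from such minors, upper bounds from covers by rows and
  columns. Diagonalizing matters because each diagonal part has one entry per block, so that
  matchings and covers meet there. An isolated rank-2 edge takes part in the matchings of both parts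
  and every other edge in exactly one, which is the origin of r. (Path) provides the neighbors that
  let few nodes cover the remaining rank-2 edges, and (Cycle) prevents a closed alternating chain of
  rank-2 edges from compensating for a deleted edge.\<close>

lemma det_nonzero_iff_left_kernel:
  fixes B :: "'a::field^'n^'n"
  shows "det B \<noteq> 0 \<longleftrightarrow> (\<forall>y. (\<forall>j. (\<Sum>i\<in>UNIV. y $ i * B $ i $ j) = 0) \<longrightarrow> y = 0)"
proof -
  have lin: "Vector_Spaces.linear (*s) (*s) ((*v) (transpose B))" by simp
  have "det B \<noteq> 0 \<longleftrightarrow> det (matrix ((*v) (transpose B))) \<noteq> 0" by simp
  also have "\<dots> \<longleftrightarrow> inj ((*v) (transpose B))" using det_nz_iff_inj_gen[OF lin] .
  also have "\<dots> \<longleftrightarrow> (\<forall>y. transpose B *v y = 0 \<longrightarrow> y = 0)"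
    using vec.linear_inj_iff_eq_0[OF lin] by simp
  also have "\<dots> \<longleftrightarrow> (\<forall>y. (\<forall>j. (\<Sum>i\<in>UNIV. y $ i * B $ i $ j) = 0) \<longrightarrow> y = 0)"
    by (simp add: vec_eq_iff matrix_vector_mult_def transpose_def mult.commute)
  finally show ?thesis .
qed

section \<open>Rank bounds from covers, direct sums and products\<close>

lemma rank_add_le: "rank (M + N) \<le> rank M + rank N" for M N :: "'a::field^'n^'m"
proof -
  obtain B where B: "B \<subseteq> rows M" "rows M \<subseteq> vec.span B" "card B = vec.dim (rows M)" "vec.independent B"
    using vec.basis_exists by metis
  obtain C where C: "C \<subseteq> rows N" "rows N \<subseteq> vec.span C" "card C = vec.dim (rows N)" "vec.independent C"
    using vec.basis_exists by metis
  have fin: "finite B" "finite C" using B(4) C(4) vec.finiteI_independent by auto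
  have "rows (M + N) \<subseteq> vec.span (B \<union> C)"
  proof
    fix v assume "v \<in> rows (M + N)"
    then obtain i where "v = row i M + row i N" by (auto simp: rows_def row_def vec_eq_iff)
    moreover have "row i M \<in> vec.span (B \<union> C)"
      using B(2) vec.span_mono[of B "B \<union> C"] by (auto simp: rows_def)
    moreover have "row i N \<in> vec.span (B \<union> C)"
      using C(2) vec.span_mono[of C "B \<union> C"] by (auto simp: rows_def)
    ultimately show "v \<in> vec.span (B \<union> C)" by (simp add: vec.span_add)
  qed
  then have "vec.dim (rows (M + N)) \<le> card (B \<union> C)" using fin by (intro vec.dim_le_card) auto
  also have "\<dots> \<le> card B + card C" by (rule card_Un_le)
  finally show ?thesis using B(3) C(3) by (simp add: row_rank_def_gen)
qed

lemma vec_eq_sum_axis: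
  fixes v :: "'a::field^'n"
  assumes "\<And>j. j \<notin> S \<Longrightarrow> v $ j = 0"
  shows "v = (\<Sum>j\<in>S. v $ j *s axis j 1)"
proof -
  have "(\<Sum>j\<in>S. v $ j *s axis j 1) $ k = (\<Sum>j\<in>S. if j = k then v $ j else 0)" for k
    unfolding sum_component by (intro sum.cong) (auto simp: axis_def)
  then show ?thesis using assms by (auto simp: vec_eq_iff)
qed

lemma rank_le_cols:
  fixes M :: "'a::field^'n^'m"
  assumes "\<And>p q. M $ p $ q \<noteq> 0 \<Longrightarrow> q \<in> S"
  shows "rank M \<le> card S"
proof -
  have "rows M \<subseteq> vec.span ((\<lambda>j. axis j 1) ` S)"
  proof
    fix v assume "v \<in> rows M"
    then obtain i where v: "v = row i M" by (auto simp: rows_def)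
    have "v = (\<Sum>j\<in>S. v $ j *s axis j 1)"
      using assms[of i] by (intro vec_eq_sum_axis) (auto simp: v row_def)
    also have "\<dots> \<in> vec.span ((\<lambda>j. axis j 1) ` S)"
      by (intro vec.span_sum vec.span_scale vec.span_base) auto
    finally show "v \<in> vec.span ((\<lambda>j. axis j 1) ` S)" .
  qed
  then have "vec.dim (rows M) \<le> card ((\<lambda>j. axis j (1::'a)) ` S)" by (intro vec.dim_le_card) auto
  also have "\<dots> \<le> card S" by (simp add: card_image_le)
  finally show ?thesis by (simp add: row_rank_def_gen)
qed

lemma rank_le_rows:
  fixes M :: "'a::field^'n^'m"
  assumes "\<And>p q. M $ p $ q \<noteq> 0 \<Longrightarrow> p \<in> S"
  shows "rank M \<le> card S"
proof -
  have "rows M \<subseteq> vec.span ((\<lambda>i. row i M) ` S)"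
  proof
    fix v assume "v \<in> rows M"
    then obtain i where v: "v = row i M" by (auto simp: rows_def)
    show "v \<in> vec.span ((\<lambda>i. row i M) ` S)"
    proof (cases "i \<in> S")
      case True then show ?thesis by (auto simp: v intro: vec.span_base)
    next
      case False
      then have "v = 0" using assms by (auto simp: v row_def vec_eq_iff)
      then show ?thesis by (simp add: vec.span_zero)
    qed
  qed
  then have "vec.dim (rows M) \<le> card ((\<lambda>i. row i M) ` S)" by (intro vec.dim_le_card) auto
  also have "\<dots> \<le> card S" by (simp add: card_image_le)
  finally show ?thesis by (simp add: row_rank_def_gen)
qed

text \<open>The easy half of Koenig's theorem: the rows in \<open>S\<close> and the remaining
  entries, which lie in the columns \<open>T\<close>, are bounded separately.\<close>

lemma rank_le_cover:
  fixes M :: "'a::field^'n^'m"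
  assumes "\<And>p q. M $ p $ q \<noteq> 0 \<Longrightarrow> p \<in> S \<or> q \<in> T"
  shows "rank M \<le> card S + card T"
proof -
  define M1 where "M1 = (\<chi> p q. if p \<in> S then M $ p $ q else 0)"
  define M2 where "M2 = (\<chi> p q. if p \<in> S then 0 else M $ p $ q)"
  have "M = M1 + M2" by (auto simp: M1_def M2_def vec_eq_iff)
  moreover have "rank M1 \<le> card S" by (rule rank_le_rows) (auto simp: M1_def split: if_splits)
  moreover have "rank M2 \<le> card T"
    using assms by (intro rank_le_cols) (auto simp: M2_def split: if_splits)
  ultimately show ?thesis using rank_add_le[of M1 M2] by (metis add_mono order_trans)
qed

text \<open>The two row spaces are supported on complementary columns and meet only in 0. As the row
  supports are disjoint too, each row of a summand is zero or a row of the sum.\<close>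

lemma rank_direct_sum_ge:
  fixes M N :: "'a::field^'n^'m"
  assumes M: "\<And>p q. M $ p $ q \<noteq> 0 \<Longrightarrow> p \<in> P \<and> q \<in> Q"
    and N: "\<And>p q. N $ p $ q \<noteq> 0 \<Longrightarrow> p \<notin> P \<and> q \<notin> Q"
  shows "rank M + rank N \<le> rank (M + N)"
proof -
  let ?S = "vec.span (rows M)" and ?T = "vec.span (rows N)"
  have Z: "?S \<subseteq> {v. \<forall>q. q \<notin> Q \<longrightarrow> v $ q = 0}"
  proof (rule vec.span_minimal)
    show "rows M \<subseteq> {v. \<forall>q. q \<notin> Q \<longrightarrow> v $ q = 0}" using M by (auto simp: rows_def row_def) 
    show "vec.subspace {v::'a^'n. \<forall>q. q \<notin> Q \<longrightarrow> v $ q = 0}" by (auto simp: vec.subspace_def)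
  qed
  have Z': "?T \<subseteq> {v. \<forall>q. q \<in> Q \<longrightarrow> v $ q = 0}"
  proof (rule vec.span_minimal)
    show "rows N \<subseteq> {v. \<forall>q. q \<in> Q \<longrightarrow> v $ q = 0}" using N by (auto simp: rows_def row_def) 
    show "vec.subspace {v::'a^'n. \<forall>q. q \<in> Q \<longrightarrow> v $ q = 0}" by (auto simp: vec.subspace_def)
  qed
  have "x = 0" if "x \<in> ?S" "x \<in> ?T" for x
  proof -
    have "x $ q = 0" for q using that Z Z' by (cases "q \<in> Q") auto
    then show ?thesis by (simp add: vec_eq_iff)
  qed
  then have "?S \<inter> ?T = {0}" by (auto simp: vec.span_zero)
  then have "vec.dim {x + y | x y. x \<in> ?S \<and> y \<in> ?T} = rank M + rank N"
    using vec.dim_sums_Int[of ?S ?T] by (simp add: row_rank_def_gen)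
  moreover have "{x + y | x y. x \<in> ?S \<and> y \<in> ?T} \<subseteq> vec.span (rows (M + N))"
  proof -
    have "row p M \<in> vec.span (rows (M + N))" for p
    proof (cases "p \<in> P")
      case True
      then have "row p M = row p (M + N)" using N by (auto simp: row_def vec_eq_iff)
      then show ?thesis by (auto simp: rows_def intro: vec.span_base)
    next
      case False
      then have "row p M = 0" using M by (auto simp: row_def vec_eq_iff)
      then show ?thesis by (simp add: vec.span_zero)
    qed
    then have *: "?S \<subseteq> vec.span (rows (M + N))" by (intro vec.span_minimal) (auto simp: rows_def)
    have "row p N \<in> vec.span (rows (M + N))" for p
    proof (cases "p \<in> P")
      case False
      then have "row p N = row p (M + N)" using M by (auto simp: row_def vec_eq_iff)
      then show ?thesis by (auto simp: rows_def intro: vec.span_base)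
    next
      case True
      then have "row p N = 0" using N by (auto simp: row_def vec_eq_iff)
      then show ?thesis by (simp add: vec.span_zero)
    qed
    then have "?T \<subseteq> vec.span (rows (M + N))" by (intro vec.span_minimal) (auto simp: rows_def)
    with * show ?thesis by (auto intro: vec.span_add)
  qed
  ultimately show ?thesis
    using vec.dim_subset[of "{x + y | x y. x \<in> ?S \<and> y \<in> ?T}" "vec.span (rows (M + N))"]
    by (simp add: row_rank_def_gen)
qed

lemma rank_matrix_mult_le_right:
  fixes B :: "'a::field^'n^'m" and A :: "'a^'m^'k"
  shows "rank (A ** B) \<le> rank B"
proof -
  have "row i (A ** B) \<in> vec.span (rows B)" for i
  proof -
    have "row i (A ** B) = (\<Sum>k\<in>UNIV. A $ i $ k *s row k B)"
      by (simp add: vec_eq_iff row_def matrix_matrix_mult_def)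
    also have "\<dots> \<in> vec.span (rows B)"
      by (intro vec.span_sum vec.span_scale vec.span_base) (auto simp: rows_def)
    finally show ?thesis .
  qed
  then have "rows (A ** B) \<subseteq> vec.span (rows B)" by (auto simp: rows_def)
  then have "vec.dim (rows (A ** B)) \<le> vec.dim (vec.span (rows B))" by (rule vec.dim_subset)
  then show ?thesis by (simp add: row_rank_def_gen)
qed

lemma rank_matrix_mult_le_left:
  fixes B :: "'a::field^'n^'m" and A :: "'a^'m^'k"
  shows "rank (A ** B) \<le> rank A"
proof -
  have "rows (A ** B) = (\<lambda>v. v v* B) ` rows A"
    by (auto simp: rows_def row_def matrix_matrix_mult_def vector_matrix_mult_def vec_eq_iff mult.commute)
  moreover have "Vector_Spaces.linear (*s) (*s) (\<lambda>v. v v* B)"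
    by (simp flip: transpose_matrix_vector)
  ultimately show ?thesis by (simp add: row_rank_def_gen vec.dim_image_le)
qed

text \<open>
  Minors are padded by an identity block to square matrices over the type of row indices.
\<close>

definition minor_mat :: "('m \<Rightarrow> 'n \<Rightarrow> 'a) \<Rightarrow> 'm set \<Rightarrow> ('m \<Rightarrow> 'n) \<Rightarrow> 'a::zero_neq_one^'m^'m" where
  "minor_mat M R \<sigma> = (\<chi> i j. if i \<in> R \<and> j \<in> R then M i (\<sigma> j) else if i = j then 1 else 0)"

text \<open>Outside \<open>R\<close> the padded matrix returns \<open>y\<close> itself, so a left
  kernel vector vanishes there and amounts to a dependency among the rows in \<open>R\<close> on the
  chosen columns.\<close>

lemma minor_mat_left_mult:
  fixes M :: "'m::finite \<Rightarrow> 'n \<Rightarrow> 'a::field"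
  shows "(\<Sum>i\<in>UNIV. y $ i * minor_mat M R \<sigma> $ i $ j)
    = (if j \<in> R then \<Sum>i\<in>R. y $ i * M i (\<sigma> j) else y $ j)"
proof (cases "j \<in> R")
  case True
  have "(\<Sum>i\<in>UNIV. y $ i * minor_mat M R \<sigma> $ i $ j) = (\<Sum>i\<in>UNIV. if i \<in> R then y $ i * M i (\<sigma> j) else 0)"
    using True by (intro sum.cong) (auto simp: minor_mat_def)
  then show ?thesis using True by (simp flip: sum.inter_filter)
next
  case False
  have "(\<Sum>i\<in>UNIV. y $ i * minor_mat M R \<sigma> $ i $ j) = (\<Sum>i\<in>UNIV. if i = j then y $ i else 0)"
    using False by (intro sum.cong) (auto simp: minor_mat_def)
  then show ?thesis using False by simp
qed

lemma rank_ge_minor: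
  fixes M :: "'a::field^'n^'m"
  assumes "det (minor_mat (\<lambda>p q. M $ p $ q) R \<sigma>) \<noteq> 0"
  shows "card R \<le> rank M"
proof -
  have ker: "y = 0" if "\<forall>q. (\<Sum>i\<in>R. y $ i * M $ i $ q) = 0" "\<forall>i. i \<notin> R \<longrightarrow> y $ i = 0" for y
    using assms[unfolded det_nonzero_iff_left_kernel minor_mat_left_mult] that by auto
  \<comment> \<open>Independence is a property of the set of rows, so equal rows with different
    indices are excluded first; the difference of two unit vectors is the dependency they would
    cause.\<close>
  have inj: "inj_on (\<lambda>i. row i M) R"
  proof (rule inj_onI)
    fix i j assume ij: "i \<in> R" "j \<in> R" "row i M = row j M"
    show "i = j"
    proof (rule ccontr)
      assume ne: "i \<noteq> j"
      have "(\<Sum>k\<in>R. (axis i 1 - axis j 1) $ k * M $ k $ q) = 0" for q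
      proof -
        have "(\<Sum>k\<in>R. (axis i 1 - axis j 1) $ k * M $ k $ q)
          = (\<Sum>k\<in>R. (if k = i then M $ k $ q else 0) - (if k = j then M $ k $ q else 0))"
          using ne by (intro sum.cong) (auto simp: axis_def)
        also have "\<dots> = M $ i $ q - M $ j $ q" using ij by (simp add: sum_subtractf)
        also have "\<dots> = 0" using ij(3) by (auto simp: row_def vec_eq_iff)
        finally show ?thesis .
      qed
      then have "axis i (1::'a) - axis j 1 = 0" by (intro ker) (use ij in \<open>auto simp: axis_def\<close>)
      then have "(axis i (1::'a) - axis j 1) $ i = 0" by simp
      then show False using ne by (simp add: axis_def)
    qed
  qed
  have indep: "vec.independent ((\<lambda>i. row i M) ` R)"
  proof (rule vec.independent_if_scalars_zero)
    show "finite ((\<lambda>i. row i M) ` R)" by simp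
  next
    fix f x assume s: "(\<Sum>x\<in>(\<lambda>i. row i M) ` R. f x *s x) = 0" and x: "x \<in> (\<lambda>i. row i M) ` R"
    define y where "y = (\<chi> i. if i \<in> R then f (row i M) else 0)"
    have "(\<Sum>i\<in>R. f (row i M) *s row i M) = 0" using s by (simp add: sum.reindex[OF inj])
    then have "(\<Sum>i\<in>R. f (row i M) *s row i M) $ q = 0" for q by simp
    then have "y = 0" by (intro ker) (auto simp: y_def row_def cong: sum.cong)
    then have "f (row i M) = 0" if "i \<in> R" for i
      using that by (metis (mono_tags, lifting) y_def vec_lambda_beta zero_index)
    then show "f x = 0" using x by auto
  qed
  have "card R = card ((\<lambda>i. row i M) ` R)" using inj by (simp add: card_image)
  also have "\<dots> \<le> vec.dim (rows M)"
    using indep by (intro vec.independent_card_le_dim) (auto simp: rows_def)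
  finally show ?thesis by (simp add: row_rank_def_gen)
qed

text \<open>
  A basis of the row space is completed to a basis by unit vectors; the columns of the minor are
  those whose unit vectors are not used.
\<close>

lemma nonzero_minor_exists:
  fixes M :: "'a::field^'n^'m"
  obtains R \<sigma> where "inj_on \<sigma> R" "card R = rank M" "det (minor_mat (\<lambda>p q. M $ p $ q) R \<sigma>) \<noteq> 0"
proof -
  obtain B where B: "B \<subseteq> rows M" "vec.independent B" "card B = vec.dim (rows M)"
    using vec.basis_exists by metis
  have "\<forall>b\<in>B. \<exists>i. b = row i M" using B(1) by (auto simp: rows_def)
  then obtain \<rho> where \<rho>: "\<And>b. b \<in> B \<Longrightarrow> b = row (\<rho> b) M" by metis
  define R where "R = \<rho> ` B"
  have inj\<rho>: "inj_on \<rho> B" by (rule inj_onI) (metis \<rho>)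
  have finB: "finite B" using B(2) vec.finiteI_independent by auto
  have cardR: "card R = rank M" using inj\<rho> B(3) by (simp add: R_def card_image row_rank_def_gen)
  have "B \<subseteq> B \<union> cart_basis" by simp
  then obtain B' where B': "B \<subseteq> B'" "B' \<subseteq> B \<union> cart_basis" "vec.independent B'" "B \<union> cart_basis \<subseteq> vec.span B'"
    using vec.maximal_independent_subset_extend[OF _ B(2)] by metis
  have "vec.span (cart_basis :: ('a^'n) set) \<subseteq> vec.span B'"
    using B'(4) by (intro vec.span_minimal) auto
  then have spB': "vec.span B' = UNIV" by auto
  have finB': "finite B'" using B'(3) vec.finiteI_independent by auto
  have cardB': "card B' = CARD('n)"
    using vec.dim_span_eq_card_independent[OF B'(3)] spB' by (metis vec_dim_card)
  define C' where "C' = {j. axis j 1 \<in> B' - B}"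
  have ax: "(\<lambda>j. axis j (1::'a)) ` C' = B' - B" using B'(2) by (auto simp: C'_def cart_basis_def)
  have "card C' = card (B' - B)" unfolding ax[symmetric]
    by (rule card_image[symmetric]) (auto simp: inj_on_def axis_eq_axis)
  also have "\<dots> = CARD('n) - card B" using B'(1) finB by (simp add: card_Diff_subset cardB')
  finally have "card (- C') = CARD('n) - (CARD('n) - card B)" by (simp add: Compl_eq_Diff_UNIV card_Diff_subset)
  moreover have "card B \<le> CARD('n)" using B'(1) finB' cardB' by (metis card_mono)
  ultimately have "card (- C') = card R" using cardR B(3) by (simp add: row_rank_def_gen)
  then obtain \<sigma> where \<sigma>: "bij_betw \<sigma> R (- C')"
    by (metis finite_class.finite_code finite_same_card_bij)
  have "y = 0" if y: "\<forall>j. (if j \<in> R then \<Sum>i\<in>R. y $ i * M $ i $ \<sigma> j else y $ j) = 0" for y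
  proof -
    \<comment> \<open>A left kernel vector gives a \<open>v\<close> in the span of \<open>B\<close>
      that vanishes on all columns outside \<open>C'\<close>, hence lies in the span of the added
      unit vectors; independence of \<open>B'\<close> then kills all coefficients.\<close>
    define v where "v = (\<Sum>b\<in>B. y $ \<rho> b *s b)"
    have v: "v $ q = (\<Sum>i\<in>R. y $ i * M $ i $ q)" for q
    proof -
      have "b $ q = M $ \<rho> b $ q" if "b \<in> B" for b
        using \<rho>[OF that] by (simp add: row_def vec_eq_iff)
      then show ?thesis by (simp add: v_def R_def sum.reindex[OF inj\<rho>] cong: sum.cong)
    qed
    have "v $ q = 0" if "q \<notin> C'" for q
    proof -
      have "q \<in> \<sigma> ` R" using \<sigma> that by (simp add: bij_betw_def)
      then obtain j where "j \<in> R" "q = \<sigma> j" by blast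
      then show ?thesis using y[rule_format, of j] v by simp
    qed
    then have "v = (\<Sum>j\<in>C'. v $ j *s axis j 1)" by (intro vec_eq_sum_axis) auto
    moreover have "(\<Sum>j\<in>C'. v $ j *s axis j 1) \<in> vec.span (B' - B)"
      unfolding ax[symmetric] by (intro vec.span_sum vec.span_scale vec.span_base) auto
    ultimately have vs: "v \<in> vec.span (B' - B)" by metis
    have r: "y $ \<rho> b = 0" if b: "b \<in> B" for b
    proof (rule ccontr)
      assume nz: "y $ \<rho> b \<noteq> 0"
      have "v = y $ \<rho> b *s b + (\<Sum>b\<in>B - {b}. y $ \<rho> b *s b)"
        using finB b by (simp add: v_def sum.remove)
      then have "y $ \<rho> b *s b = v - (\<Sum>b\<in>B - {b}. y $ \<rho> b *s b)" by (simp add: algebra_simps)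
      moreover have "v \<in> vec.span (B' - {b})" using vs b vec.span_mono[of "B' - B" "B' - {b}"] by auto
      moreover have "(\<Sum>b\<in>B - {b}. y $ \<rho> b *s b) \<in> vec.span (B' - {b})"
        using B'(1) by (intro vec.span_sum vec.span_scale vec.span_base) auto
      ultimately have "y $ \<rho> b *s b \<in> vec.span (B' - {b})" by (simp add: vec.span_diff)
      then have "inverse (y $ \<rho> b) *s (y $ \<rho> b *s b) \<in> vec.span (B' - {b})" by (rule vec.span_scale)
      then have "b \<in> vec.span (B' - {b})" using nz by simp
      then show False using B'(1,3) b unfolding vec.dependent_def by auto
    qed
    have "y $ i = 0" for i
    proof (cases "i \<in> R")
      case True then show ?thesis using r by (auto simp: R_def)
    next
      case False then show ?thesis using y[rule_format, of i] by simp
    qed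
    then show "y = 0" by (simp add: vec_eq_iff)
  qed
  then have "det (minor_mat (\<lambda>p q. M $ p $ q) R \<sigma>) \<noteq> 0"
    unfolding det_nonzero_iff_left_kernel minor_mat_left_mult by blast
  then show ?thesis using that \<sigma> cardR by (auto simp: bij_betw_def)
qed

section \<open>Generic matrices and transversals\<close>

text \<open>The coefficients form an arbitrary function, not a family of blocks, so that
  restrictions to blocks and to single positions within blocks are again of this form.\<close>

definition gmat ::
  "('m::{finite,linorder} \<times> 2 \<Rightarrow> 'n::{finite,linorder} \<times> 2 \<Rightarrow> 'f::field)
     \<Rightarrow> ('m \<times> 'n, 'f) ratfun ^ ('n \<times> 2) ^ ('m \<times> 2)" where
  "gmat c = (\<chi> p q. const_rf (c p q) * var_rf (fst p, fst q))"

definition keep_blocks ::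
  "('m \<times> 'n) set \<Rightarrow> ('m \<times> 2 \<Rightarrow> 'n \<times> 2 \<Rightarrow> 'f::zero) \<Rightarrow> 'm \<times> 2 \<Rightarrow> 'n \<times> 2 \<Rightarrow> 'f" where
  "keep_blocks J c p q = (if (fst p, fst q) \<in> J then c p q else 0)"

definition entry :: "('m \<Rightarrow> 'n \<Rightarrow> 'f^2^2) \<Rightarrow> 'm \<times> 2 \<Rightarrow> 'n \<times> 2 \<Rightarrow> 'f" where
  "entry A p q = A (fst p) (fst q) $ snd p $ snd q"

text \<open>The entries in the polynomial ring: coefficients of a determinant can be read off there,
  but not in the fraction field.\<close>

definition poly_entry ::
  "('m::{finite,linorder} \<times> 2 \<Rightarrow> 'n::{finite,linorder} \<times> 2 \<Rightarrow> 'f::field) \<Rightarrow> 'm \<times> 2 \<Rightarrow> 'n \<times> 2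
     \<Rightarrow> ('m \<times> 'n \<Rightarrow>\<^sub>0 nat) \<Rightarrow>\<^sub>0 'f" where
  "poly_entry c p q = Poly_Mapping.single (Poly_Mapping.single (fst p, fst q) 1) (c p q)"

lemma const_rf_0 [simp]: "const_rf 0 = 0"
  by (simp add: const_rf_def Zero_fract_def)

lemma const_rf_add: "const_rf (a + b) = const_rf a + const_rf b"
  by (simp add: const_rf_def single_add)

lemma const_rf_mult: "const_rf (a * b) = const_rf a * const_rf b"
  by (simp add: const_rf_def mult_single)

lemma rank_on_gmat: "rank_on A J = rank (gmat (keep_blocks J (entry A)))"
proof -
  have "restrict_blocks J (generic_matrix A) = gmat (keep_blocks J (entry A))"
    by (auto simp: restrict_blocks_def generic_matrix_def gmat_def keep_blocks_def entry_def vec_eq_iff)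
  then show ?thesis by (simp add: rank_on_def)
qed

lemma gmat_add: "gmat (\<lambda>p q. c p q + d p q) = gmat c + gmat d"
  by (simp add: gmat_def vec_eq_iff const_rf_add algebra_simps)

lemma gmat_nonzeroD: "gmat c $ p $ q \<noteq> 0 \<Longrightarrow> c p q \<noteq> 0"
  by (auto simp: gmat_def)

lemma gmat_entry: "gmat c $ p $ q = Fract (poly_entry c p q) 1"
  by (simp add: gmat_def poly_entry_def const_rf_def var_rf_def mult_single)

section \<open>Minors of generic matrices as polynomials, and their Leibniz terms\<close>

lemma det_map_Fract:
  fixes B :: "'a::idom^'n^'n"
  shows "det (\<chi> i j. Fract (B $ i $ j) 1) = Fract (det B) 1"
proof -
  have sum: "(\<Sum>x\<in>S. Fract (f x) 1) = Fract (\<Sum>x\<in>S. f x) 1" for f :: "'b \<Rightarrow> 'a" and S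
    by (induction S rule: infinite_finite_induct) (auto simp: Zero_fract_def)
  have prod: "(\<Prod>x\<in>S. Fract (f x) 1) = Fract (\<Prod>x\<in>S. f x) 1" for f :: "'b \<Rightarrow> 'a" and S
    by (induction S rule: infinite_finite_induct) (auto simp: One_fract_def)
  have one: "Fract (1::'a) 1 = 1" by (simp add: One_fract_def)
  have sgn: "of_int (sign p) = Fract (of_int (sign p) :: 'a) 1" for p :: "'n \<Rightarrow> 'n"
    by (auto simp: sign_def one minus_fract[symmetric])
  show ?thesis by (simp add: det_def prod sgn sum)
qed

lemma det_minor_gmat:
  "det (minor_mat (\<lambda>p q. gmat c $ p $ q) R \<sigma>) \<noteq> 0 \<longleftrightarrow> det (minor_mat (poly_entry c) R \<sigma>) \<noteq> 0"
proof -
  have "minor_mat (\<lambda>p q. gmat c $ p $ q) R \<sigma> = (\<chi> i j. Fract (minor_mat (poly_entry c) R \<sigma> $ i $ j) 1)"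
    by (auto simp: minor_mat_def vec_eq_iff gmat_entry Zero_fract_def One_fract_def)
  then show ?thesis by (simp add: det_map_Fract Zero_fract_def eq_fract)
qed

text \<open>All four entries of a block contribute the same variable, so different permutations can
  share a monomial and their \<open>term_coeff\<close> values may cancel. Hence the lemmas speak of
  full coefficients of the determinant.\<close>

definition term_monomial :: "('m \<times> 2) set \<Rightarrow> ('m \<times> 2 \<Rightarrow> 'n \<times> 2) \<Rightarrow> ('m \<times> 2 \<Rightarrow> 'm \<times> 2) \<Rightarrow> 'm::finite \<times> 'n \<Rightarrow>\<^sub>0 nat" where
  "term_monomial R \<sigma> \<pi> = (\<Sum>i\<in>R. Poly_Mapping.single (fst i, fst (\<sigma> (\<pi> i))) 1)"

definition term_coeff ::
  "('m::finite \<times> 2 \<Rightarrow> 'n \<times> 2 \<Rightarrow> 'f::comm_ring_1) \<Rightarrow> ('m \<times> 2) set \<Rightarrow> ('m \<times> 2 \<Rightarrow> 'n \<times> 2) \<Rightarrow> ('m \<times> 2 \<Rightarrow> 'm \<times> 2) \<Rightarrow> 'f" where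
  "term_coeff c R \<sigma> \<pi> = of_int (sign \<pi>) * (\<Prod>i\<in>R. c i (\<sigma> (\<pi> i)))"

lemma prod_single:
  "(\<Prod>i\<in>S. Poly_Mapping.single (k i) (d i)) = Poly_Mapping.single (\<Sum>i\<in>S. k i) (\<Prod>i\<in>S. d i)"
  for k :: "'i \<Rightarrow> 'a::comm_monoid_add" and d :: "'i \<Rightarrow> 'b::comm_semiring_1"
  by (induction S rule: infinite_finite_induct) (auto simp: mult_single single_one)

lemma lookup_of_int_mult:
  "Poly_Mapping.lookup (of_int k * P) m = of_int k * Poly_Mapping.lookup P m" for P :: "'a::comm_monoid_add \<Rightarrow>\<^sub>0 'b::comm_ring_1"
proof -
  have nat: "Poly_Mapping.lookup (of_nat n * P) m = of_nat n * Poly_Mapping.lookup P m" for n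
    by (induction n) (auto simp: algebra_simps lookup_add)
  show ?thesis
  proof (cases "k \<ge> 0")
    case True then show ?thesis using nat[of "nat k"] by simp
  next
    case False
    then have "of_int k * P = - (of_nat (nat (- k)) * P)" by simp
    then show ?thesis using nat[of "nat (- k)"] False by simp
  qed
qed

lemma lookup_det_minor:
  fixes c :: "'m::{finite,linorder} \<times> 2 \<Rightarrow> 'n::{finite,linorder} \<times> 2 \<Rightarrow> 'f::field"
  shows "Poly_Mapping.lookup (det (minor_mat (poly_entry c) R \<sigma>)) m
    = (\<Sum>\<pi> | \<pi> permutes R. if term_monomial R \<sigma> \<pi> = m then term_coeff c R \<sigma> \<pi> else 0)"
proof -
  let ?B = "minor_mat (poly_entry c) R \<sigma>"
  have "det ?B = (\<Sum>\<pi> | \<pi> permutes UNIV. of_int (sign \<pi>) * (\<Prod>i\<in>UNIV. ?B $ i $ \<pi> i))"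
    by (simp add: det_def)
  also have "\<dots> = (\<Sum>\<pi> | \<pi> permutes R. of_int (sign \<pi>) * (\<Prod>i\<in>UNIV. ?B $ i $ \<pi> i))"
  proof (rule sum.mono_neutral_right)
    show "{\<pi>. \<pi> permutes R} \<subseteq> {\<pi>. \<pi> permutes UNIV}" by (auto intro: permutes_subset)
    show "\<forall>\<pi>\<in>{\<pi>. \<pi> permutes UNIV} - {\<pi>. \<pi> permutes R}. of_int (sign \<pi>) * (\<Prod>i\<in>UNIV. ?B $ i $ \<pi> i) = 0"
    proof
      fix \<pi> assume \<pi>: "\<pi> \<in> {\<pi>. \<pi> permutes UNIV} - {\<pi>. \<pi> permutes R}"
      then have "\<exists>i. i \<notin> R \<and> \<pi> i \<noteq> i" unfolding permutes_def by blast
      then obtain i where "i \<notin> R" "\<pi> i \<noteq> i" by blast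
      then have "?B $ i $ \<pi> i = 0" by (simp add: minor_mat_def)
      then have "(\<Prod>i\<in>UNIV. ?B $ i $ \<pi> i) = 0" by (intro prod_zero bexI[of _ i]) auto
      then show "of_int (sign \<pi>) * (\<Prod>i\<in>UNIV. ?B $ i $ \<pi> i) = 0" by simp
    qed
  qed simp
  also have "\<dots> = (\<Sum>\<pi> | \<pi> permutes R. of_int (sign \<pi>) *
      Poly_Mapping.single (term_monomial R \<sigma> \<pi>) (\<Prod>i\<in>R. c i (\<sigma> (\<pi> i))))"
  proof (rule sum.cong)
    fix \<pi> assume "\<pi> \<in> {\<pi>. \<pi> permutes R}"
    then have \<pi>: "\<pi> permutes R" by simp
    have "(\<Prod>i\<in>UNIV. ?B $ i $ \<pi> i) = (\<Prod>i\<in>R. ?B $ i $ \<pi> i)"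
      using permutes_not_in[OF \<pi>] by (intro prod.mono_neutral_right) (auto simp: minor_mat_def)
    also have "\<dots> = (\<Prod>i\<in>R. poly_entry c i (\<sigma> (\<pi> i)))"
      using permutes_in_image[OF \<pi>] by (intro prod.cong) (auto simp: minor_mat_def)
    also have "\<dots> = Poly_Mapping.single (term_monomial R \<sigma> \<pi>) (\<Prod>i\<in>R. c i (\<sigma> (\<pi> i)))"
      by (simp add: poly_entry_def prod_single term_monomial_def)
    finally show "of_int (sign \<pi>) * (\<Prod>i\<in>UNIV. ?B $ i $ \<pi> i)
      = of_int (sign \<pi>) * Poly_Mapping.single (term_monomial R \<sigma> \<pi>) (\<Prod>i\<in>R. c i (\<sigma> (\<pi> i)))" by simp
  qed simp
  finally show ?thesis
    by (auto simp: lookup_sum lookup_of_int_mult lookup_single when_def term_coeff_def intro!: sum.cong)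
qed

text \<open>Exponents are sums of ones over the naturals, so no variable that occurs can drop
  out.\<close>

lemma keys_term_monomial: "Poly_Mapping.keys (term_monomial R \<sigma> \<pi>) = (\<lambda>i. (fst i, fst (\<sigma> (\<pi> i)))) ` R"
proof -
  have "Poly_Mapping.lookup (term_monomial R \<sigma> \<pi>) e = (\<Sum>i\<in>R. if (fst i, fst (\<sigma> (\<pi> i))) = e then 1 else 0)" for e
    unfolding term_monomial_def lookup_sum by (intro sum.cong) (auto simp: lookup_single when_def)
  then have "Poly_Mapping.lookup (term_monomial R \<sigma> \<pi>) e = 0 \<longleftrightarrow> (\<forall>i\<in>R. (fst i, fst (\<sigma> (\<pi> i))) \<noteq> e)" for e by auto
  then show ?thesis by (intro set_eqI) (simp only: in_keys_iff image_iff, metis)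
qed

text \<open>Terms with monomial \<open>m\<close> only use blocks of \<open>J\<close>, where nothing
  was changed; a term using another block has a different monomial on both sides.\<close>

lemma lookup_det_minor_keep_blocks:
  fixes c :: "'m::{finite,linorder} \<times> 2 \<Rightarrow> 'n::{finite,linorder} \<times> 2 \<Rightarrow> 'f::field"
  assumes "Poly_Mapping.keys m \<subseteq> J"
  shows "Poly_Mapping.lookup (det (minor_mat (poly_entry (keep_blocks J c)) R \<sigma>)) m = Poly_Mapping.lookup (det (minor_mat (poly_entry c) R \<sigma>)) m"
  unfolding lookup_det_minor
proof (rule sum.cong)
  fix \<pi> assume "\<pi> \<in> {\<pi>. \<pi> permutes R}"
  show "(if term_monomial R \<sigma> \<pi> = m then term_coeff (keep_blocks J c) R \<sigma> \<pi> else 0) = (if term_monomial R \<sigma> \<pi> = m then term_coeff c R \<sigma> \<pi> else 0)"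
  proof (cases "term_monomial R \<sigma> \<pi> = m")
    case True
    then have "\<forall>i\<in>R. (fst i, fst (\<sigma> (\<pi> i))) \<in> J" using assms keys_term_monomial[of R \<sigma> \<pi>] by auto
    then have "term_coeff (keep_blocks J c) R \<sigma> \<pi> = term_coeff c R \<sigma> \<pi>" by (simp add: term_coeff_def keep_blocks_def)
    then show ?thesis by simp
  qed simp
qed simp

text \<open>\<open>\<tau>\<close> records the columns met by one term of a maximal nonzero minor.
  The last clause is the essential one: it turns the blocks used into a certificate for the rank of
  every edge set containing them.\<close>

definition transversal ::
  "('m::{finite,linorder} \<times> 2 \<Rightarrow> 'n::{finite,linorder} \<times> 2 \<Rightarrow> 'f::field) \<Rightarrow> ('m \<times> 'n) set
     \<Rightarrow> ('m \<times> 2) set \<Rightarrow> ('m \<times> 2 \<Rightarrow> 'n \<times> 2) \<Rightarrow> bool" where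
  "transversal c J R \<tau> \<longleftrightarrow> inj_on \<tau> R \<and> card R = rank (gmat (keep_blocks J c)) \<and>
    (\<forall>p\<in>R. c p (\<tau> p) \<noteq> 0 \<and> (fst p, fst (\<tau> p)) \<in> J) \<and>
    (\<forall>J'. (\<lambda>p. (fst p, fst (\<tau> p))) ` R \<subseteq> J' \<longrightarrow> card R \<le> rank (gmat (keep_blocks J' c)))"

text \<open>
  The blocks used by a term of a nonzero minor already carry the full rank: the coefficient of its
  monomial does not involve any other block.
\<close>

lemma rank_gmat_transversal:
  fixes c :: "'m::{finite,linorder} \<times> 2 \<Rightarrow> 'n::{finite,linorder} \<times> 2 \<Rightarrow> 'f::field"
  shows "\<exists>R \<tau>. transversal c J R \<tau>"
proof -
  obtain R \<sigma> where R: "inj_on \<sigma> R" "card R = rank (gmat (keep_blocks J c))"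
    "det (minor_mat (\<lambda>p q. gmat (keep_blocks J c) $ p $ q) R \<sigma>) \<noteq> 0"
    using nonzero_minor_exists by blast
  then have "det (minor_mat (poly_entry (keep_blocks J c)) R \<sigma>) \<noteq> 0" by (simp add: det_minor_gmat)
  then obtain m where m: "Poly_Mapping.lookup (det (minor_mat (poly_entry (keep_blocks J c)) R \<sigma>)) m \<noteq> 0"
    by (metis lookup_zero poly_mapping_eqI)
  then obtain \<pi> where \<pi>: "\<pi> permutes R" "term_monomial R \<sigma> \<pi> = m" "term_coeff (keep_blocks J c) R \<sigma> \<pi> \<noteq> 0"
    unfolding lookup_det_minor by (auto elim!: sum.not_neutral_contains_not_neutral split: if_splits)
  define \<tau> where "\<tau> = (\<lambda>p. \<sigma> (\<pi> p))"
  have nz: "keep_blocks J c p (\<tau> p) \<noteq> 0" if "p \<in> R" for p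
    using \<pi>(3) that by (auto simp: term_coeff_def \<tau>_def)
  have keys: "Poly_Mapping.keys m = (\<lambda>p. (fst p, fst (\<tau> p))) ` R"
    using keys_term_monomial[of R \<sigma> \<pi>] \<pi>(2) by (simp add: \<tau>_def)
  have inJ: "c p (\<tau> p) \<noteq> 0 \<and> (fst p, fst (\<tau> p)) \<in> J" if "p \<in> R" for p
    using nz[OF that] by (auto simp: keep_blocks_def split: if_splits)
  have "inj_on \<tau> R"
    using comp_inj_on[of \<pi> R \<sigma>] R(1) \<pi>(1)
    by (simp add: \<tau>_def comp_def permutes_image permutes_inj_on)
  moreover have "card R \<le> rank (gmat (keep_blocks J' c))" if J': "(\<lambda>p. (fst p, fst (\<tau> p))) ` R \<subseteq> J'" for J'
  proof -
    have "Poly_Mapping.keys m \<subseteq> J" using inJ keys by auto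
    moreover have "Poly_Mapping.keys m \<subseteq> J'" using J' keys by auto
    ultimately have "Poly_Mapping.lookup (det (minor_mat (poly_entry (keep_blocks J' c)) R \<sigma>)) m \<noteq> 0"
      using m by (simp add: lookup_det_minor_keep_blocks)
    then have "det (minor_mat (poly_entry (keep_blocks J' c)) R \<sigma>) \<noteq> 0" by auto
    then show ?thesis by (intro rank_ge_minor) (simp add: det_minor_gmat)
  qed
  ultimately have "transversal c J R \<tau>" using R(2) inJ unfolding transversal_def by simp
  then show ?thesis by blast
qed

text \<open>Setting entries of a fixed matrix to zero can raise its rank. For generic blocks it
  cannot, as a transversal of the smaller set remains a certificate in the larger one.\<close>

lemma rank_gmat_mono:
  assumes "J \<subseteq> J'"
  shows "rank (gmat (keep_blocks J c)) \<le> rank (gmat (keep_blocks J' c))"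
proof -
  obtain R \<tau> where R: "transversal c J R \<tau>" using rank_gmat_transversal by blast
  then have "(\<lambda>p. (fst p, fst (\<tau> p))) ` R \<subseteq> J'" using assms by (auto simp: transversal_def)
  then have "card R \<le> rank (gmat (keep_blocks J' c))" using R unfolding transversal_def by blast
  moreover have "card R = rank (gmat (keep_blocks J c))" using R by (simp add: transversal_def)
  ultimately show ?thesis by linarith
qed

text \<open>With at most one row in each block row and one column in each block column, the monomial
  of the identity belongs to no other permutation, so its term cannot be canceled.\<close>

lemma rank_gmat_ge:
  fixes c :: "'m::{finite,linorder} \<times> 2 \<Rightarrow> 'n::{finite,linorder} \<times> 2 \<Rightarrow> 'f::field"
  assumes "inj_on fst R" "inj_on (\<lambda>p. fst (\<tau> p)) R" "\<And>p. p \<in> R \<Longrightarrow> c p (\<tau> p) \<noteq> 0"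
  shows "card R \<le> rank (gmat c)"
proof (rule rank_ge_minor)
  have "\<pi> = id" if \<pi>: "\<pi> permutes R" "term_monomial R \<tau> \<pi> = term_monomial R \<tau> id" for \<pi>
  proof
    fix p
    show "\<pi> p = id p"
    proof (cases "p \<in> R")
      case True
      have "(\<lambda>i. (fst i, fst (\<tau> (\<pi> i)))) ` R = (\<lambda>i. (fst i, fst (\<tau> i))) ` R"
        using keys_term_monomial[of R \<tau> \<pi>] keys_term_monomial[of R \<tau> id] \<pi>(2) by simp
      then have "(fst p, fst (\<tau> (\<pi> p))) \<in> (\<lambda>i. (fst i, fst (\<tau> i))) ` R" using True by blast
      then obtain p' where p': "p' \<in> R" "fst p = fst p'" "fst (\<tau> (\<pi> p)) = fst (\<tau> p')" by auto
      then have "p' = p" using assms(1) True by (auto dest: inj_onD)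
      moreover have "\<pi> p \<in> R" using True \<pi>(1) by (simp add: permutes_in_image)
      ultimately show ?thesis using p' assms(2) True by (auto dest: inj_onD)
    next
      case False
      then show ?thesis using \<pi>(1) by (simp add: permutes_not_in)
    qed
  qed
  then have "(\<Sum>\<pi> | \<pi> permutes R. if term_monomial R \<tau> \<pi> = term_monomial R \<tau> id then term_coeff c R \<tau> \<pi> else 0)
    = (\<Sum>\<pi> | \<pi> permutes R. if \<pi> = id then term_coeff c R \<tau> \<pi> else 0)"
    by (intro sum.cong) auto
  also have "\<dots> = term_coeff c R \<tau> id" by (simp add: finite_permutations permutes_id)
  also have "\<dots> \<noteq> 0" using assms(3) by (simp add: term_coeff_def sign_id)
  finally have "Poly_Mapping.lookup (det (minor_mat (poly_entry c) R \<tau>)) (term_monomial R \<tau> id) \<noteq> 0"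
    by (simp add: lookup_det_minor)
  then have "det (minor_mat (poly_entry c) R \<tau>) \<noteq> 0" by auto
  then show "det (minor_mat (\<lambda>p q. gmat c $ p $ q) R \<tau>) \<noteq> 0" by (simp add: det_minor_gmat)
qed

section \<open>Block-diagonal changes of basis\<close>

lemma sum_pair_2:
  fixes f :: "'m::finite \<times> 2 \<Rightarrow> 'a::comm_monoid_add"
  shows "(\<Sum>p\<in>UNIV. if fst p = a then f p else 0) = (\<Sum>i\<in>UNIV. f (a, i))"
proof -
  have "(\<Sum>p\<in>UNIV. if fst p = a then f p else 0) = (\<Sum>p\<in>{a} \<times> UNIV. f p)"
    by (rule sum.mono_neutral_cong_right) auto
  also have "\<dots> = (\<Sum>i\<in>UNIV. f (a, i))"
    using sum.cartesian_product[of "\<lambda>x i. f (x, i)" UNIV "{a}"] by (simp add: case_prod_unfold)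
  finally show ?thesis .
qed

lemma sum_2_mult_distrib:
  fixes p a b :: "2 \<Rightarrow> 'a::comm_ring_1"
  shows "(\<Sum>j\<in>UNIV. (\<Sum>i\<in>UNIV. p i * (m i j * x)) * b j)
    = (p 1 * m 1 1 * b 1 + p 2 * m 2 1 * b 1 + p 1 * m 1 2 * b 2 + p 2 * m 2 2 * b 2) * x"
  by (simp add: UNIV_2 algebra_simps)

text \<open>The indeterminate of a block acts there as a scalar and commutes with constant matrices
  on block rows and block columns; multiplying by the block-diagonal \<open>PP\<close> and
  \<open>QQ\<close> cannot raise the rank.\<close>

lemma rank_on_basis_change_le:
  fixes A :: "'m::{finite,linorder} \<Rightarrow> 'n::{finite,linorder} \<Rightarrow> 'f::field^2^2"
  shows "rank_on (\<lambda>\<alpha> \<beta>. P \<alpha> ** A \<alpha> \<beta> ** Q \<beta>) J \<le> rank_on A J"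
proof -
  let ?A' = "\<lambda>\<alpha> \<beta>. P \<alpha> ** A \<alpha> \<beta> ** Q \<beta>"
  define M where "M = gmat (keep_blocks J (entry A))"
  define PP :: "('m \<times> 'n, 'f) ratfun ^ ('m \<times> 2) ^ ('m \<times> 2)" where
    "PP = (\<chi> p p'. if fst p' = fst p then const_rf (P (fst p) $ snd p $ snd p') else 0)"
  define QQ :: "('m \<times> 'n, 'f) ratfun ^ ('n \<times> 2) ^ ('n \<times> 2)" where
    "QQ = (\<chi> q' q. if fst q' = fst q then const_rf (Q (fst q) $ snd q' $ snd q) else 0)"
  have if_mult: "(if b then x else 0) * y = (if b then x * y else 0)"
    "y * (if b then x else 0) = (if b then y * x else 0)" for b and x y :: "('m \<times> 'n, 'f) ratfun"
    by auto
  have "gmat (keep_blocks J (entry ?A')) $ p $ q = (PP ** M ** QQ) $ p $ q" for p q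
  proof -
    have "(PP ** M ** QQ) $ p $ q
      = (\<Sum>j\<in>UNIV. (\<Sum>i\<in>UNIV. const_rf (P (fst p) $ snd p $ i) * M $ (fst p, i) $ (fst q, j))
          * const_rf (Q (fst q) $ j $ snd q))"
      by (simp add: matrix_matrix_mult_def PP_def QQ_def if_mult sum_pair_2)
    also have "\<dots> = gmat (keep_blocks J (entry ?A')) $ p $ q"
    proof (cases "(fst p, fst q) \<in> J")
      case True
      then have "gmat (keep_blocks J (entry ?A')) $ p $ q
        = (const_rf (P (fst p) $ snd p $ 1) * const_rf (A (fst p) (fst q) $ 1 $ 1) * const_rf (Q (fst q) $ 1 $ snd q)
         + const_rf (P (fst p) $ snd p $ 2) * const_rf (A (fst p) (fst q) $ 2 $ 1) * const_rf (Q (fst q) $ 1 $ snd q)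
         + const_rf (P (fst p) $ snd p $ 1) * const_rf (A (fst p) (fst q) $ 1 $ 2) * const_rf (Q (fst q) $ 2 $ snd q)
         + const_rf (P (fst p) $ snd p $ 2) * const_rf (A (fst p) (fst q) $ 2 $ 2) * const_rf (Q (fst q) $ 2 $ snd q))
         * var_rf (fst p, fst q)"
        by (simp add: gmat_def keep_blocks_def entry_def matrix_matrix_mult_def UNIV_2 const_rf_add
            const_rf_mult distrib_right add.assoc cong del: if_weak_cong)
      moreover have "M $ (fst p, i) $ (fst q, j) = const_rf (A (fst p) (fst q) $ i $ j) * var_rf (fst p, fst q)" for i j
        using True by (simp add: M_def gmat_def keep_blocks_def entry_def)
      ultimately show ?thesis by (simp add: sum_2_mult_distrib)
    next
      case False
      then show ?thesis by (simp add: M_def gmat_def keep_blocks_def)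
    qed
    finally show ?thesis by simp
  qed
  then have "gmat (keep_blocks J (entry ?A')) = PP ** M ** QQ" by (simp add: vec_eq_iff)
  then have "rank (gmat (keep_blocks J (entry ?A'))) = rank (PP ** M ** QQ)" by (rule arg_cong)
  also have "\<dots> \<le> rank M"
    by (rule order_trans[OF rank_matrix_mult_le_left rank_matrix_mult_le_right])
  finally have "rank (gmat (keep_blocks J (entry ?A'))) \<le> rank M" .
  then show ?thesis by (simp add: rank_on_gmat M_def)
qed

lemma rank_on_basis_change:
  fixes A :: "'m::{finite,linorder} \<Rightarrow> 'n::{finite,linorder} \<Rightarrow> 'f::field^2^2"
  assumes "\<And>\<alpha>. invertible (P \<alpha>)" "\<And>\<beta>. invertible (Q \<beta>)"
  shows "rank_on (\<lambda>\<alpha> \<beta>. P \<alpha> ** A \<alpha> \<beta> ** Q \<beta>) J = rank_on A J"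
proof (rule antisym[OF rank_on_basis_change_le])
  obtain P' where P': "\<And>\<alpha>. P' \<alpha> ** P \<alpha> = mat 1" using assms(1) unfolding invertible_def by metis
  obtain Q' where Q': "\<And>\<beta>. Q \<beta> ** Q' \<beta> = mat 1" using assms(2) unfolding invertible_def by metis
  have "P' \<alpha> ** (P \<alpha> ** A \<alpha> \<beta> ** Q \<beta>) ** Q' \<beta> = A \<alpha> \<beta>" for \<alpha> \<beta>
  proof -
    have "P' \<alpha> ** (P \<alpha> ** A \<alpha> \<beta> ** Q \<beta>) ** Q' \<beta> = (P' \<alpha> ** P \<alpha>) ** A \<alpha> \<beta> ** (Q \<beta> ** Q' \<beta>)"
      by (simp only: matrix_mul_assoc)
    then show ?thesis by (simp add: P' Q')
  qed
  then show "rank_on A J \<le> rank_on (\<lambda>\<alpha> \<beta>. P \<alpha> ** A \<alpha> \<beta> ** Q \<beta>) J"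
    using rank_on_basis_change_le[of P' "\<lambda>\<alpha> \<beta>. P \<alpha> ** A \<alpha> \<beta> ** Q \<beta>" Q' J] by simp
qed

section \<open>Bilinear forms on the plane\<close>

lemma bil_expand:
  "bil B u v = u $ 1 * (B $ 1 $ 1 * v $ 1 + B $ 1 $ 2 * v $ 2) + u $ 2 * (B $ 2 $ 1 * v $ 1 + B $ 2 $ 2 * v $ 2)"
  by (simp add: bil_def scalar_product_def matrix_vector_mult_def UNIV_2)

lemma vec2_eq_iff: "u = v \<longleftrightarrow> u $ 1 = v $ 1 \<and> u $ 2 = v $ 2" for u v :: "'a^2"
  by (simp add: vec_eq_iff forall_2)

definition indep2 :: "'f::field^2 \<Rightarrow> 'f^2 \<Rightarrow> bool" where
  "indep2 u v \<longleftrightarrow> u $ 1 * v $ 2 \<noteq> u $ 2 * v $ 1"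

definition line :: "'f::field^2 \<Rightarrow> ('f^2) set" where
  "line u = range (\<lambda>a. a *s u)"

definition is_line :: "('f::field^2) set \<Rightarrow> bool" where
  "is_line X \<longleftrightarrow> (\<exists>u. u \<noteq> 0 \<and> X = line u)"

lemma is_line_iff: "is_line X \<longleftrightarrow> vec.subspace X \<and> vec.dim X = 1"
proof
  assume "is_line X"
  then obtain u where u: "u \<noteq> 0" "X = line u" by (auto simp: is_line_def)
  then have X: "X = vec.span {u}" by (simp add: line_def vec.span_singleton)
  moreover have "vec.independent {u}" using u by simp
  ultimately show "vec.subspace X \<and> vec.dim X = 1"
    using vec.dim_span_eq_card_independent[of "{u}"] by simp
next
  assume X: "vec.subspace X \<and> vec.dim X = 1"
  obtain B where B: "B \<subseteq> X" "vec.independent B" "X \<subseteq> vec.span B" "card B = vec.dim X"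
    using vec.basis_exists by metis
  then obtain u where u: "B = {u}" using X by (metis card_1_singletonE)
  moreover have "u \<noteq> 0" using B(2) u vec.dependent_zero by blast
  moreover have "vec.span B \<subseteq> X" using B(1) X by (simp add: vec.span_minimal)
  ultimately have "X = line u" using B(3) by (auto simp: line_def vec.span_singleton)
  then show "is_line X" using \<open>u \<noteq> 0\<close> by (auto simp: is_line_def)
qed

lemma zero_in_line [simp]: "0 \<in> line u"
  unfolding line_def by (rule range_eqI[of _ _ 0]) simp

lemma self_in_line [simp]: "u \<in> line u"
  unfolding line_def by (rule range_eqI[of _ _ 1]) simp

lemma indep2_sym: "indep2 u v \<Longrightarrow> indep2 v u"
  by (auto simp: indep2_def mult.commute)

lemma line_mono:
  assumes "v \<in> line u" shows "line v \<subseteq> line u"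
  using assms by (auto simp: line_def)

lemma not_indep2_imp:
  assumes "u \<noteq> 0" "\<not> indep2 u v" shows "v \<in> line u"
proof (cases "u $ 1 = 0")
  case True
  then have u2: "u $ 2 \<noteq> 0" using assms(1) by (auto simp: vec2_eq_iff)
  then have "v = (v $ 2 / u $ 2) *s u" using assms(2) True by (auto simp: vec2_eq_iff indep2_def)
  then show ?thesis unfolding line_def by (rule range_eqI)
next
  case False
  then have "v = (v $ 1 / u $ 1) *s u"
    using assms(2) by (auto simp: vec2_eq_iff indep2_def field_simps)
  then show ?thesis unfolding line_def by (rule range_eqI)
qed

lemma line_neq_iff_indep2:
  assumes "u \<noteq> 0" "v \<noteq> 0" shows "line u \<noteq> line v \<longleftrightarrow> indep2 u v"
proof
  assume "line u \<noteq> line v"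
  then show "indep2 u v"
    using not_indep2_imp[OF assms(1), of v] not_indep2_imp[OF assms(2), of u] line_mono indep2_sym
    by blast
next
  assume i: "indep2 u v"
  show "line u \<noteq> line v"
  proof
    assume "line u = line v"
    then have "v \<in> line u" by simp
    then show False using i by (auto simp: line_def indep2_def mult.commute)
  qed
qed

lemma ex_indep2: "u \<noteq> 0 \<Longrightarrow> \<exists>v. indep2 u v"
proof -
  assume u: "u \<noteq> 0"
  have "indep2 u (vector [0, 1]) \<or> indep2 u (vector [1, 0])"
    using u by (auto simp: indep2_def vec2_eq_iff)
  then show ?thesis by blast
qed

text \<open>Kernels of rank-1 forms and annihilators of lines under rank-2 forms are both cut out by
  one nonzero linear equation.\<close>

lemma annihilator_is_line:
  fixes a b :: "'f::field"
  assumes "a \<noteq> 0 \<or> b \<noteq> 0"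
  shows "is_line {v::'f^2. a * v $ 1 + b * v $ 2 = 0}"
proof -
  define w :: "'f^2" where "w = vector [- b, a]"
  have w: "w $ 1 = - b" "w $ 2 = a" by (simp_all add: w_def)
  have w0: "w \<noteq> 0" using assms w by (auto simp: vec2_eq_iff)
  have "v \<in> line w" if "a * v $ 1 + b * v $ 2 = 0" for v
  proof (rule not_indep2_imp[OF w0])
    show "\<not> indep2 w v" using that w by (simp add: indep2_def) (metis add.commute eq_neg_iff_add_eq_0)
  qed
  moreover have "a * v $ 1 + b * v $ 2 = 0" if "v \<in> line w" for v
    using that w by (auto simp: line_def)
  ultimately have "{v. a * v $ 1 + b * v $ 2 = 0} = line w" by blast
  then show ?thesis using w0 by (auto simp: is_line_def)
qed

lemma line_subset_eq:
  assumes "is_line X" "is_line Y" "X \<subseteq> Y" shows "X = Y"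
proof -
  obtain u v where u: "u \<noteq> 0" "X = line u" "v \<noteq> 0" "Y = line v"
    using assms by (auto simp: is_line_def)
  have "\<not> indep2 u v"
    using assms(3) u self_in_line[of u] by (auto simp: line_def indep2_def mult.commute)
  then show ?thesis using line_neq_iff_indep2 u by blast
qed

lemma rank2_iff: "rank B = 2 \<longleftrightarrow> det B \<noteq> 0" for B :: "'f::field^2^2"
proof
  assume r: "rank B = 2"
  obtain R \<sigma> where R: "inj_on \<sigma> R" "card R = rank B" "det (minor_mat (\<lambda>p q. B $ p $ q) R \<sigma>) \<noteq> 0"
    using nonzero_minor_exists[of B] by blast
  have "R = UNIV" using R(2) r by (intro card_subset_eq) auto
  then have "\<sigma> 1 \<noteq> \<sigma> 2" and "B $ 1 $ \<sigma> 1 * B $ 2 $ \<sigma> 2 \<noteq> B $ 1 $ \<sigma> 2 * B $ 2 $ \<sigma> 1"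
    using R(1,3) by (auto simp: det_2 minor_mat_def inj_on_def)
  moreover have "\<sigma> 1 = 1 \<or> \<sigma> 1 = 2" "\<sigma> 2 = 1 \<or> \<sigma> 2 = 2" using exhaust_2 by auto
  ultimately show "det B \<noteq> 0" by (auto simp: det_2)
next
  assume "det B \<noteq> 0"
  moreover have "minor_mat (\<lambda>p q. B $ p $ q) UNIV id = B" by (simp add: minor_mat_def vec_eq_iff)
  ultimately have "card (UNIV :: 2 set) \<le> rank B" using rank_ge_minor[of B UNIV id] by simp
  moreover have "rank B \<le> card (UNIV :: 2 set)" by (rule rank_le_rows) simp
  ultimately show "rank B = 2" by simp
qed

lemma rank1_iff: "rank B = 1 \<longleftrightarrow> det B = 0 \<and> B \<noteq> 0" for B :: "'f::field^2^2"
proof -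
  have "rank B \<le> card (UNIV :: 2 set)" by (rule rank_le_rows) simp
  then have le: "rank B \<le> 2" by simp
  have "rank B = 0 \<longleftrightarrow> rows B \<subseteq> {0}" by (simp add: row_rank_def_gen vec.dim_eq_0)
  also have "\<dots> \<longleftrightarrow> (\<forall>i. row i B = 0)" by (auto simp: rows_def)
  also have "\<dots> \<longleftrightarrow> B = 0" by (simp add: row_def vec_eq_iff)
  finally have z: "rank B = 0 \<longleftrightarrow> B = 0" .
  have "rank B = 1 \<longleftrightarrow> rank B \<noteq> 2 \<and> rank B \<noteq> 0" using le by arith
  then show ?thesis using rank2_iff[of B] z by simp
qed

lemma edge_rank_cases:
  assumes "e \<in> edges A" shows "rank_edge A 1 e \<or> rank_edge A 2 e"
  using assms unfolding rank_edge_def rank1_iff rank2_iff by (auto simp: edges_def)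

lemma rank_edge_exclusive: "rank_edge A 1 e \<Longrightarrow> \<not> rank_edge A 2 e"
  by (simp add: rank_edge_def)

text \<open>Only the color class of \<open>\<gamma>\<close> is inspected, so the value is an end of
  \<open>e\<close> in any case; it is the opposite end under
  \<open>\<gamma> \<in> ends e\<close>.\<close>

definition other :: "'m \<times> 'n \<Rightarrow> 'm + 'n \<Rightarrow> 'm + 'n" where
  "other e \<gamma> = (case \<gamma> of Inl _ \<Rightarrow> Inr (snd e) | Inr _ \<Rightarrow> Inl (fst e))"

text \<open>The bilinear form of the edge \<open>e\<close>, with the argument at its end \<open>\<gamma>\<close> in first position.\<close>

definition form_at :: "('m \<Rightarrow> 'n \<Rightarrow> 'f::field^2^2) \<Rightarrow> 'm \<times> 'n \<Rightarrow> 'm + 'n \<Rightarrow> 'f^2 \<Rightarrow> 'f^2 \<Rightarrow> 'f" where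
  "form_at A e \<gamma> u v = (case \<gamma> of Inl _ \<Rightarrow> bil (A (fst e) (snd e)) u v | Inr _ \<Rightarrow> bil (A (fst e) (snd e)) v u)"

text \<open>\<open>X\<close> lives at the end \<open>\<gamma>\<close> and the result at
  \<open>other e \<gamma>\<close>: this is how a line is transported across an edge.\<close>

definition perp :: "('m \<Rightarrow> 'n \<Rightarrow> 'f::field^2^2) \<Rightarrow> 'm \<times> 'n \<Rightarrow> 'm + 'n \<Rightarrow> ('f^2) set \<Rightarrow> ('f^2) set" where
  "perp A e \<gamma> X = {v. \<forall>u\<in>X. form_at A e \<gamma> u v = 0}"

definition kern :: "('m \<Rightarrow> 'n \<Rightarrow> 'f::field^2^2) \<Rightarrow> 'm \<times> 'n \<Rightarrow> 'm + 'n \<Rightarrow> ('f^2) set" where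
  "kern A e \<gamma> = {u. \<forall>v. form_at A e \<gamma> u v = 0}"

lemma kern_eq_ker: "kern A e (Inl \<alpha>) = ker_L (A (fst e) (snd e))" "kern A e (Inr \<beta>) = ker_R (A (fst e) (snd e))"
  by (auto simp: kern_def form_at_def ker_L_def ker_R_def)

lemma other_simps [simp]: "other e (Inl \<alpha>) = Inr (snd e)" "other e (Inr \<beta>) = Inl (fst e)"
  by (simp_all add: other_def)

lemma in_ends_iff [simp]: "Inl \<alpha> \<in> ends e \<longleftrightarrow> fst e = \<alpha>" "Inr \<beta> \<in> ends e \<longleftrightarrow> snd e = \<beta>"
  by (auto simp: ends_def)

lemma other_in_ends [simp]: "other e \<gamma> \<in> ends e"
  by (cases \<gamma>) auto

lemma other_other [simp]: "\<gamma> \<in> ends e \<Longrightarrow> other e (other e \<gamma>) = \<gamma>"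
  by (cases \<gamma>) auto

lemma ends_eq: "\<gamma> \<in> ends e \<Longrightarrow> ends e = {\<gamma>, other e \<gamma>}"
  by (cases \<gamma>) (auto simp: ends_def)

lemma other_neq [simp]: "other e \<gamma> \<noteq> \<gamma>"
  by (cases \<gamma>) auto

lemma ends_inject: "ends e = ends f \<Longrightarrow> e = f"
  by (cases e, cases f) (auto simp: ends_def doubleton_eq_iff)

lemma form_at_other [simp]: "form_at A e (other e \<gamma>) v u = form_at A e \<gamma> u v"
  by (cases \<gamma>) (auto simp: form_at_def)

lemma form_at_scale [simp]:
  "form_at A e \<gamma> (a *s u) v = a * form_at A e \<gamma> u v" "form_at A e \<gamma> u (a *s v) = a * form_at A e \<gamma> u v"
  by (cases \<gamma>; simp add: form_at_def bil_expand algebra_simps)+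

text \<open>Seen from the other end the coefficient matrix is transposed, which changes neither its
  determinant nor whether it is zero; thus both ends are treated at once.\<close>

lemma form_at_coords:
  obtains a b c d where "\<And>u v. form_at A e \<gamma> u v = u $ 1 * (a * v $ 1 + b * v $ 2) + u $ 2 * (c * v $ 1 + d * v $ 2)"
    "det (A (fst e) (snd e)) = a * d - b * c" "A (fst e) (snd e) \<noteq> 0 \<longleftrightarrow> a \<noteq> 0 \<or> b \<noteq> 0 \<or> c \<noteq> 0 \<or> d \<noteq> 0"
proof (cases \<gamma>)
  case (Inl x)
  let ?B = "A (fst e) (snd e)"
  show ?thesis
    by (rule that[of "?B $ 1 $ 1" "?B $ 1 $ 2" "?B $ 2 $ 1" "?B $ 2 $ 2"])
      (auto simp: form_at_def bil_expand Inl det_2 vec_eq_iff forall_2)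
next
  case (Inr x)
  let ?B = "A (fst e) (snd e)"
  show ?thesis
    by (rule that[of "?B $ 1 $ 1" "?B $ 2 $ 1" "?B $ 1 $ 2" "?B $ 2 $ 2"])
      (auto simp: form_at_def bil_expand Inr det_2 vec_eq_iff forall_2 algebra_simps)
qed

lemma perp_line: "perp A e \<gamma> (line u) = {v. form_at A e \<gamma> u v = 0}"
proof -
  have "form_at A e \<gamma> u v = 0" if "\<forall>u'\<in>line u. form_at A e \<gamma> u' v = 0" for v
    using that self_in_line by blast
  then show ?thesis by (auto simp: perp_def line_def)
qed

lemma is_line_perp:
  assumes "rank_edge A 2 e" "is_line X"
  shows "is_line (perp A e \<gamma> X)"
proof -
  obtain u where u: "u \<noteq> 0" "X = line u" using assms by (auto simp: is_line_def)
  obtain a b c d where f: "\<And>u v. form_at A e \<gamma> u v = u $ 1 * (a * v $ 1 + b * v $ 2) + u $ 2 * (c * v $ 1 + d * v $ 2)"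
    "det (A (fst e) (snd e)) = a * d - b * c"
    using form_at_coords[of A e \<gamma>] by metis
  have det: "a * d - b * c \<noteq> 0" using assms f(2) by (simp add: rank_edge_def rank2_iff)
  define p where "p = u $ 1 * a + u $ 2 * c"
  define q where "q = u $ 1 * b + u $ 2 * d"
  \<comment> \<open>Cramer's rule recovers \<open>u\<close> times the determinant from
    \<open>p\<close> and \<open>q\<close>, so these cannot both vanish.\<close>
  have "d * p - c * q = u $ 1 * (a * d - b * c)" "a * q - b * p = u $ 2 * (a * d - b * c)"
    by (simp_all add: p_def q_def algebra_simps)
  then have "p \<noteq> 0 \<or> q \<noteq> 0" using u(1) det by (auto simp: vec2_eq_iff)
  moreover have "perp A e \<gamma> X = {v. p * v $ 1 + q * v $ 2 = 0}"
    by (auto simp: u(2) perp_line f(1) p_def q_def algebra_simps)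
  ultimately show ?thesis using annihilator_is_line[of p q] by simp
qed

lemma perp_perp:
  assumes "rank_edge A 2 e" "is_line X" "\<gamma> \<in> ends e"
  shows "perp A e (other e \<gamma>) (perp A e \<gamma> X) = X"
proof -
  have "X \<subseteq> perp A e (other e \<gamma>) (perp A e \<gamma> X)" by (auto simp: perp_def)
  moreover have "is_line (perp A e (other e \<gamma>) (perp A e \<gamma> X))" using assms by (intro is_line_perp)
  ultimately show ?thesis using line_subset_eq assms(2) by metis
qed

lemma is_line_kern:
  assumes "rank_edge A 1 e"
  shows "is_line (kern A e \<gamma>)"
proof -
  obtain a b c d where f: "\<And>u v. form_at A e \<gamma> u v = u $ 1 * (a * v $ 1 + b * v $ 2) + u $ 2 * (c * v $ 1 + d * v $ 2)"
    "det (A (fst e) (snd e)) = a * d - b * c"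
    "A (fst e) (snd e) \<noteq> 0 \<longleftrightarrow> a \<noteq> 0 \<or> b \<noteq> 0 \<or> c \<noteq> 0 \<or> d \<noteq> 0"
    using form_at_coords[of A e \<gamma>] by metis
  have det: "a * d = b * c" and nz: "a \<noteq> 0 \<or> b \<noteq> 0 \<or> c \<noteq> 0 \<or> d \<noteq> 0"
    using assms f(2,3) unfolding rank_edge_def rank1_iff by auto
  have kern: "kern A e \<gamma> = {u. a * u $ 1 + c * u $ 2 = 0 \<and> b * u $ 1 + d * u $ 2 = 0}"
  proof -
    have "(\<forall>v. form_at A e \<gamma> u v = 0) \<longleftrightarrow> a * u $ 1 + c * u $ 2 = 0 \<and> b * u $ 1 + d * u $ 2 = 0" for u
    proof
      assume h: "\<forall>v. form_at A e \<gamma> u v = 0"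
      show "a * u $ 1 + c * u $ 2 = 0 \<and> b * u $ 1 + d * u $ 2 = 0"
        using h[rule_format, of "vector [1, 0]"] h[rule_format, of "vector [0, 1]"]
        by (simp add: f(1) mult.commute)
    next
      assume h: "a * u $ 1 + c * u $ 2 = 0 \<and> b * u $ 1 + d * u $ 2 = 0"
      have "form_at A e \<gamma> u v = (a * u $ 1 + c * u $ 2) * v $ 1 + (b * u $ 1 + d * u $ 2) * v $ 2" for v
        by (simp add: f(1) algebra_simps)
      then show "\<forall>v. form_at A e \<gamma> u v = 0" using h by simp
    qed
    then show ?thesis by (simp add: kern_def)
  qed
  show ?thesis
  \<comment> \<open>The vanishing determinant makes the two equations of the kernel proportional; a
    nonzero one implies the other.\<close>
  proof (cases "a \<noteq> 0 \<or> c \<noteq> 0")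
    case True
    have "b * x + d * y = 0" if "a * x + c * y = 0" for x y
    proof -
      have "a * (b * x + d * y) = b * (a * x + c * y)" "c * (b * x + d * y) = d * (a * x + c * y)"
        using det by (simp_all add: algebra_simps)
      then show ?thesis using True that by auto
    qed
    then have "kern A e \<gamma> = {u. a * u $ 1 + c * u $ 2 = 0}" using kern by auto
    then show ?thesis using annihilator_is_line[of a c] True by simp
  next
    case False
    then have "kern A e \<gamma> = {u. b * u $ 1 + d * u $ 2 = 0}" using kern by auto
    then show ?thesis using annihilator_is_line[of b d] False nz by simp
  qed
qed

section \<open>Change of bases and elimination\<close>

definition in_basis ::
  "('m + 'n \<Rightarrow> 2 \<Rightarrow> 'f^2) \<Rightarrow> ('m \<Rightarrow> 'n \<Rightarrow> 'f::field^2^2) \<Rightarrow> 'm \<Rightarrow> 'n \<Rightarrow> 'f^2^2" where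
  "in_basis b A \<alpha> \<beta> = (\<chi> i j. bil (A \<alpha> \<beta>) (b (Inl \<alpha>) i) (b (Inr \<beta>) j))"

lemma rank_on_in_basis:
  fixes A :: "'m::{finite,linorder} \<Rightarrow> 'n::{finite,linorder} \<Rightarrow> 'f::field^2^2"
  assumes "\<And>\<gamma>. indep2 (b \<gamma> 1) (b \<gamma> 2)"
  shows "rank_on (in_basis b A) J = rank_on A J"
proof -
  define P :: "'m \<Rightarrow> 'f^2^2" where "P = (\<lambda>\<alpha>. \<chi> i k. b (Inl \<alpha>) i $ k)"
  define Q :: "'n \<Rightarrow> 'f^2^2" where "Q = (\<lambda>\<beta>. \<chi> k j. b (Inr \<beta>) j $ k)"
  have "in_basis b A \<alpha> \<beta> = P \<alpha> ** A \<alpha> \<beta> ** Q \<beta>" for \<alpha> \<beta>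
    by (simp add: in_basis_def P_def Q_def matrix_matrix_mult_def vec_eq_iff bil_expand UNIV_2 algebra_simps)
  then have "in_basis b A = (\<lambda>\<alpha> \<beta>. P \<alpha> ** A \<alpha> \<beta> ** Q \<beta>)" by (intro ext)
  moreover have "invertible (P \<alpha>)" "invertible (Q \<beta>)" for \<alpha> \<beta>
    using assms[of "Inl \<alpha>"] assms[of "Inr \<beta>"]
    by (auto simp: invertible_det_nz det_2 P_def Q_def indep2_def mult.commute)
  ultimately show ?thesis using rank_on_basis_change[of P Q A J] by simp
qed

lemma rank_gmat_ge_edges:
  fixes c :: "'m::{finite,linorder} \<times> 2 \<Rightarrow> 'n::{finite,linorder} \<times> 2 \<Rightarrow> 'f::field"
  assumes "inj_on fst F" "inj_on snd F" "\<And>e. e \<in> F \<Longrightarrow> c (fst e, k) (snd e, k) \<noteq> 0"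
  shows "card F \<le> rank (gmat c)"
proof -
  define h where "h = the_inv_into F fst"
  have h: "h (fst e) = e" if "e \<in> F" for e using that assms(1) by (simp add: h_def the_inv_into_f_f)
  define R where "R = (\<lambda>e. (fst e, k)) ` F"
  define \<tau> where "\<tau> = (\<lambda>p::'m \<times> 2. (snd (h (fst p)), k))"
  have "card R \<le> rank (gmat c)"
  proof (rule rank_gmat_ge[where \<tau> = \<tau>])
    show "inj_on fst R" by (auto simp: R_def inj_on_def)
    show "inj_on (\<lambda>p. fst (\<tau> p)) R" using assms(2) h by (auto simp: R_def \<tau>_def inj_on_def)
    show "c p (\<tau> p) \<noteq> 0" if "p \<in> R" for p using that assms(3) h by (auto simp: R_def \<tau>_def)
  qed
  moreover have "card R = card F"
    unfolding R_def using assms(1) by (intro card_image) (auto simp: inj_on_def)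
  ultimately show ?thesis by simp
qed

text \<open>
  Over disjoint edges of rank 2 the blocks can be normalized to the identity, so that the two
  diagonal positions of the blocks decouple.
\<close>

lemma rank_on_disjoint_rank2:
  fixes A :: "'m::{finite,linorder} \<Rightarrow> 'n::{finite,linorder} \<Rightarrow> 'f::field^2^2"
  assumes "inj_on fst F" "inj_on snd F" "\<And>e. e \<in> F \<Longrightarrow> rank_edge A 2 e"
  shows "2 * card F \<le> rank_on A F"
proof -
  define h where "h = the_inv_into F fst"
  have h: "h (fst e) = e" if "e \<in> F" for e using that assms(1) by (simp add: h_def the_inv_into_f_f)
  have "\<exists>B. e \<in> F \<longrightarrow> invertible B \<and> B ** A (fst e) (snd e) = mat 1" for e
  proof (cases "e \<in> F")
    case True
    then have "invertible (A (fst e) (snd e))"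
      using assms(3) by (simp add: rank_edge_def rank2_iff invertible_det_nz)
    then obtain B where "A (fst e) (snd e) ** B = mat 1" "B ** A (fst e) (snd e) = mat 1"
      unfolding invertible_def by blast
    then show ?thesis unfolding invertible_def by blast
  qed simp
  then obtain B where B: "\<And>e. e \<in> F \<Longrightarrow> invertible (B e) \<and> B e ** A (fst e) (snd e) = mat 1" by metis
  \<comment> \<open>Each block row meeting \<open>F\<close> belongs to exactly one edge of
    \<open>F\<close>, whose block is inverted there; the column bases stay fixed.\<close>
  define P where "P = (\<lambda>\<alpha>. if \<alpha> \<in> fst ` F then B (h \<alpha>) else mat 1)"
  have inv: "invertible (P \<alpha>)" for \<alpha>
    using B h invertible_def[of "mat 1 :: 'f^2^2"] by (auto simp: P_def)
  define A' where "A' = (\<lambda>\<alpha> \<beta>. P \<alpha> ** A \<alpha> \<beta> ** mat 1)"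
  have A': "A' (fst e) (snd e) = mat 1" if "e \<in> F" for e
    using that B h by (simp add: A'_def P_def)
  \<comment> \<open>After the normalization only the diagonal positions survive, and each of the two
    carries one entry per block.\<close>
  define c where "c = (\<lambda>k p q. if snd p = k \<and> snd q = k then keep_blocks F (entry A') p q else 0)"
  have "card F \<le> rank (gmat (c k))" for k
    using assms(1,2) by (rule rank_gmat_ge_edges[where k = k]) (simp add: c_def keep_blocks_def entry_def A' mat_def)
  from this[of 1] this[of 2] have "2 * card F \<le> rank (gmat (c 1)) + rank (gmat (c 2))" by simp
  also have "\<dots> \<le> rank (gmat (c 1) + gmat (c 2))"
    by (rule rank_direct_sum_ge[where P = "{p. snd p = 1}" and Q = "{q. snd q = 1}"])
      (auto dest!: gmat_nonzeroD simp: c_def split: if_splits)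
  also have "gmat (c 1) + gmat (c 2) = gmat (keep_blocks F (entry A'))"
  proof -
    have "c 1 p q + c 2 p q = keep_blocks F (entry A') p q" for p q
      using exhaust_2[of "snd p"] exhaust_2[of "snd q"] A'[of "(fst p, fst q)"]
      by (auto simp: c_def keep_blocks_def entry_def mat_def)
    then show ?thesis unfolding gmat_add[symmetric] by simp
  qed
  also have "rank (gmat (keep_blocks F (entry A'))) = rank_on A' F" by (simp add: rank_on_gmat)
  also have "\<dots> = rank_on A F" unfolding A'_def
    by (rule rank_on_basis_change[OF inv]) (auto simp: invertible_def)
  finally show ?thesis .
qed

lemma gmat_keep_blocksD:
  assumes "gmat (keep_blocks J c) $ p $ q \<noteq> 0"
  shows "\<exists>e. e \<in> J \<and> fst p = fst e \<and> fst q = snd e"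
proof -
  have "(fst p, fst q) \<in> J" using gmat_nonzeroD[OF assms] by (simp add: keep_blocks_def split: if_splits)
  then show ?thesis by (intro exI[of _ "(fst p, fst q)"]) simp
qed

lemma rank_on_mono: "J \<subseteq> J' \<Longrightarrow> rank_on A J \<le> rank_on A J'"
  by (simp add: rank_on_gmat rank_gmat_mono)

lemma rank_on_Un_disjoint_nodes_ge:
  assumes "fst ` F \<inter> fst ` Y = {}" "snd ` F \<inter> snd ` Y = {}"
  shows "rank_on A F + rank_on A Y \<le> rank_on A (F \<union> Y)"
proof -
  have "rank (gmat (keep_blocks F (entry A))) + rank (gmat (keep_blocks Y (entry A)))
    \<le> rank (gmat (keep_blocks F (entry A)) + gmat (keep_blocks Y (entry A)))"
  proof (rule rank_direct_sum_ge[where P = "{p. fst p \<in> fst ` F}" and Q = "{q. fst q \<in> snd ` F}"])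
    fix p q assume "gmat (keep_blocks F (entry A)) $ p $ q \<noteq> 0"
    then obtain e where "e \<in> F" "fst p = fst e" "fst q = snd e" using gmat_keep_blocksD by metis
    then show "p \<in> {p. fst p \<in> fst ` F} \<and> q \<in> {q. fst q \<in> snd ` F}" by simp
  next
    fix p q assume "gmat (keep_blocks Y (entry A)) $ p $ q \<noteq> 0"
    then obtain e where e: "e \<in> Y" "fst p = fst e" "fst q = snd e" using gmat_keep_blocksD by metis
    then have "fst e \<in> fst ` Y" "snd e \<in> snd ` Y" by simp_all
    then show "p \<notin> {p. fst p \<in> fst ` F} \<and> q \<notin> {q. fst q \<in> snd ` F}"
      using assms by (simp only: mem_Collect_eq e(2,3)) blast
  qed
  also have "gmat (keep_blocks F (entry A)) + gmat (keep_blocks Y (entry A)) = gmat (keep_blocks (F \<union> Y) (entry A))"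
  proof -
    have "keep_blocks F (entry A) p q + keep_blocks Y (entry A) p q = keep_blocks (F \<union> Y) (entry A) p q" for p q
      using assms by (force simp: keep_blocks_def)
    then show ?thesis unfolding gmat_add[symmetric] by simp
  qed
  finally show ?thesis by (simp add: rank_on_gmat)
qed

lemma card_slots: "card {p :: 'a::finite \<times> 2. fst p \<in> S} = 2 * card S"
proof -
  have "{p :: 'a \<times> 2. fst p \<in> S} = S \<times> UNIV" by auto
  then show ?thesis by (simp add: card_cartesian_product)
qed

text \<open>A node carries two rows or two columns, hence counts twice in a cover.\<close>

lemma rank_on_le_cover:
  assumes "X \<union> Y = I" "\<And>e. e \<in> X \<Longrightarrow> fst e \<in> S \<or> snd e \<in> T"
  shows "rank_on A I \<le> 2 * card S + 2 * card T + rank_on A Y"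
proof -
  have "keep_blocks I (entry A) p q = keep_blocks (X - Y) (entry A) p q + keep_blocks Y (entry A) p q" for p q
    using assms(1) by (auto simp: keep_blocks_def)
  then have "keep_blocks I (entry A) = (\<lambda>p q. keep_blocks (X - Y) (entry A) p q + keep_blocks Y (entry A) p q)"
    by (intro ext)
  then have "gmat (keep_blocks I (entry A)) = gmat (keep_blocks (X - Y) (entry A)) + gmat (keep_blocks Y (entry A))"
    by (simp only: gmat_add)
  then have "rank_on A I \<le> rank (gmat (keep_blocks (X - Y) (entry A))) + rank_on A Y"
    using rank_add_le by (simp add: rank_on_gmat)
  moreover have "rank (gmat (keep_blocks (X - Y) (entry A))) \<le> card {p :: 'a \<times> 2. fst p \<in> S} + card {q :: 'b \<times> 2. fst q \<in> T}"
  proof (rule rank_le_cover)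
    fix p q assume "gmat (keep_blocks (X - Y) (entry A)) $ p $ q \<noteq> 0"
    then obtain e where "e \<in> X - Y" "fst p = fst e" "fst q = snd e" using gmat_keep_blocksD by metis
    then show "p \<in> {p. fst p \<in> S} \<or> q \<in> {q. fst q \<in> T}" using assms(2) by simp
  qed
  ultimately show ?thesis by (simp add: card_slots)
qed

text \<open>The rank condition of \<open>is_matching\<close>, separated from the inclusion in
  \<open>edges A\<close>.\<close>

definition tight :: "('m::{finite,linorder} \<Rightarrow> 'n::{finite,linorder} \<Rightarrow> 'f::field^2^2) \<Rightarrow> ('m \<times> 'n) set \<Rightarrow> bool" where
  "tight A I \<longleftrightarrow> (\<forall>e\<in>I. rank_on A (I - {e}) < rank_on A I)"

text \<open>Disjoint rank-2 edges \<open>F\<close> already achieve rank \<open>2 * card F\<close>.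
  If \<open>card F\<close> nodes cover all edges meeting \<open>F\<close>, these edges together
  achieve no more, so any of them outside \<open>F\<close> could be deleted without loss of
  rank.\<close>

lemma tight_absorb:
  fixes A :: "'m::{finite,linorder} \<Rightarrow> 'n::{finite,linorder} \<Rightarrow> 'f::field^2^2"
  assumes "tight A I" "F \<subseteq> I" "inj_on fst F" "inj_on snd F" "\<And>e. e \<in> F \<Longrightarrow> rank_edge A 2 e"
    and cover: "\<And>f. f \<in> I \<Longrightarrow> fst f \<in> fst ` F \<or> snd f \<in> snd ` F \<Longrightarrow> fst f \<in> S \<or> snd f \<in> T"
    and le: "card S + card T \<le> card F"
    and f: "f \<in> I" "fst f \<in> fst ` F \<or> snd f \<in> snd ` F"
  shows "f \<in> F"
proof (rule ccontr)
  assume "f \<notin> F"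
  define X where "X = {f \<in> I. fst f \<in> fst ` F \<or> snd f \<in> snd ` F}"
  define Y where "Y = I - X"
  have "rank_on A I \<le> 2 * card S + 2 * card T + rank_on A Y"
    using cover by (intro rank_on_le_cover[where X = X]) (auto simp: X_def Y_def)
  also have "\<dots> \<le> rank_on A F + rank_on A Y"
    using rank_on_disjoint_rank2[of F A] assms le by simp
  also have "\<dots> \<le> rank_on A (F \<union> Y)"
  proof (rule rank_on_Un_disjoint_nodes_ge)
    have *: "fst g \<notin> fst ` F" "snd g \<notin> snd ` F" if "g \<in> Y" for g using that by (simp_all add: X_def Y_def)
    show "fst ` F \<inter> fst ` Y = {}" using *(1) by (intro equals0I) (erule IntE, erule imageE[of _ fst Y], simp)
    show "snd ` F \<inter> snd ` Y = {}" using *(2) by (intro equals0I) (erule IntE, erule imageE[of _ snd Y], simp)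
  qed
  also have "\<dots> \<le> rank_on A (I - {f})"
    using \<open>f \<notin> F\<close> f \<open>F \<subseteq> I\<close> by (intro rank_on_mono) (auto simp: X_def Y_def)
  finally show False using assms(1) f by (auto simp: tight_def)
qed

lemma tight_transversal_blocks:
  assumes "tight A I" "transversal (entry A) I R \<tau>"
  shows "(\<lambda>p. (fst p, fst (\<tau> p))) ` R = I"
proof (rule ccontr)
  assume ne: "(\<lambda>p. (fst p, fst (\<tau> p))) ` R \<noteq> I"
  moreover have sub: "(\<lambda>p. (fst p, fst (\<tau> p))) ` R \<subseteq> I" using assms(2) by (auto simp: transversal_def)
  ultimately obtain e where e: "e \<in> I" "e \<notin> (\<lambda>p. (fst p, fst (\<tau> p))) ` R" by blast
  then have "(\<lambda>p. (fst p, fst (\<tau> p))) ` R \<subseteq> I - {e}" using sub by blast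
  then have "card R \<le> rank_on A (I - {e})"
    using assms(2) unfolding transversal_def rank_on_gmat by blast
  moreover have "card R = rank_on A I" using assms(2) by (simp add: transversal_def rank_on_gmat)
  ultimately show False using assms(1) e(1) by (auto simp: tight_def)
qed

lemma tight_Deg: 
  fixes A :: "'m::{finite,linorder} \<Rightarrow> 'n::{finite,linorder} \<Rightarrow> 'f::field^2^2"
  assumes "tight A I" shows "cond_Deg I"
proof -
  obtain R \<tau> where R: "transversal (entry A) I R \<tau>" using rank_gmat_transversal by blast
  note blocks = tight_transversal_blocks[OF assms R]
  have inj: "inj_on \<tau> R" using R by (simp add: transversal_def)
  have "deg I \<gamma> \<le> 2" for \<gamma>
  proof (cases \<gamma>)
    case (Inl \<alpha>)
    have "{e \<in> I. \<gamma> \<in> ends e} = (\<lambda>p. (fst p, fst (\<tau> p))) ` {p \<in> R. fst p = \<alpha>}"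
      unfolding blocks[symmetric] by (auto simp: Inl)
    then have "deg I \<gamma> \<le> card {p \<in> R. fst p = \<alpha>}" by (simp add: deg_def card_image_le)
    also have "\<dots> \<le> card {p :: 'm \<times> 2. fst p \<in> {\<alpha>}}" by (intro card_mono) auto
    finally show ?thesis by (simp only: card_slots) simp
  next
    case (Inr \<beta>)
    have "{e \<in> I. \<gamma> \<in> ends e} = (\<lambda>p. (fst p, fst (\<tau> p))) ` {p \<in> R. fst (\<tau> p) = \<beta>}"
      unfolding blocks[symmetric] by (auto simp: Inr)
    then have "deg I \<gamma> \<le> card {p \<in> R. fst (\<tau> p) = \<beta>}" by (simp add: deg_def card_image_le)
    also have "\<dots> = card (\<tau> ` {p \<in> R. fst (\<tau> p) = \<beta>})"
      using inj by (intro card_image[symmetric]) (auto simp: inj_on_def)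
    also have "\<dots> \<le> card {p :: 'n \<times> 2. fst p \<in> {\<beta>}}" by (intro card_mono) auto
    finally show ?thesis by (simp only: card_slots) simp
  qed
  then show ?thesis by (simp add: cond_Deg_def)
qed

section \<open>Necessity of the degree, path and cycle conditions\<close>

fun opp :: "polarity \<Rightarrow> polarity" where
  "opp Plus = Minus"
| "opp Minus = Plus"

lemma opp_opp [simp]: "opp (opp s) = s"
  by (cases s) auto

lemma opp_neq [simp]: "opp s \<noteq> s" "s \<noteq> opp s"
  by (cases s; simp)+

lemma neq_iff_opp: "s \<noteq> t \<longleftrightarrow> s = opp t"
  by (cases s; cases t) auto

lemma opp_inject [simp]: "opp s = opp t \<longleftrightarrow> s = t"
  by (cases s; cases t) auto

lemma deg_third_edge:
  fixes I :: "('m::finite \<times> 'n::finite) set"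
  assumes "cond_Deg I" "e \<in> I" "f \<in> I" "g \<in> I" "\<gamma> \<in> ends e" "\<gamma> \<in> ends f" "\<gamma> \<in> ends g" "e \<noteq> f"
  shows "g = e \<or> g = f"
proof (rule ccontr)
  assume "\<not> (g = e \<or> g = f)"
  then have "card {e, f, g} = 3" using assms(8) by auto
  moreover have "card {e, f, g} \<le> deg I \<gamma>" unfolding deg_def using assms by (intro card_mono) auto
  ultimately show False using assms(1) unfolding cond_Deg_def by (metis not_less_eq_eq numeral_2_eq_2 numeral_3_eq_3 order_trans)
qed

lemma deg_1_unique:
  assumes "deg I \<gamma> = 1" "e \<in> I" "f \<in> I" "\<gamma> \<in> ends e" "\<gamma> \<in> ends f"
  shows "e = f"
proof -
  obtain g where "{e \<in> I. \<gamma> \<in> ends e} = {g}" using assms(1) unfolding deg_def by (rule card_1_singletonE)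
  then have "e \<in> {g}" "f \<in> {g}" using assms(2-) by blast+
  then show ?thesis by simp
qed

lemma deg_eq_1I:
  assumes "e \<in> I" "\<gamma> \<in> ends e" "\<And>f. f \<in> I \<Longrightarrow> \<gamma> \<in> ends f \<Longrightarrow> f = e"
  shows "deg I \<gamma> = 1"
proof -
  have "{e \<in> I. \<gamma> \<in> ends e} = {e}" using assms by blast
  then show ?thesis by (simp add: deg_def)
qed

lemma isolated_iff:
  "isolated I e \<longleftrightarrow> e \<in> I \<and> (\<forall>f\<in>I. \<forall>\<gamma>\<in>ends e. \<gamma> \<in> ends f \<longrightarrow> f = e)"
proof
  assume "isolated I e"
  then have "e \<in> I" "deg I (Inl (fst e)) = 1" "deg I (Inr (snd e)) = 1" by (auto simp: isolated_def)
  then show "e \<in> I \<and> (\<forall>f\<in>I. \<forall>\<gamma>\<in>ends e. \<gamma> \<in> ends f \<longrightarrow> f = e)"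
    using deg_1_unique[of I _ _ e] by (auto simp: ends_def)
next
  assume h: "e \<in> I \<and> (\<forall>f\<in>I. \<forall>\<gamma>\<in>ends e. \<gamma> \<in> ends f \<longrightarrow> f = e)"
  have "deg I (Inl (fst e)) = 1" by (rule deg_eq_1I[of e]) (use h in \<open>auto simp: ends_def\<close>)
  moreover have "deg I (Inr (snd e)) = 1" by (rule deg_eq_1I[of e]) (use h in \<open>auto simp: ends_def\<close>)
  ultimately show "isolated I e" using h by (simp add: isolated_def)
qed

lemma color_unique:
  assumes "proper_coloring I c" "e \<in> I" "f \<in> I" "\<gamma> \<in> ends e" "\<gamma> \<in> ends f" "c e = c f"
  shows "e = f"
  using assms unfolding proper_coloring_def by blast

text \<open>All edges that meet \<open>e\<close> pass through its end opposite to the leaf, so this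
  single node is a cover and \<open>{e}\<close> absorbs them. The cases differ only in the color
  class of the covering node.\<close>

lemma tight_leaf:
  fixes A :: "'m::{finite,linorder} \<Rightarrow> 'n::{finite,linorder} \<Rightarrow> 'f::field^2^2"
  assumes "tight A I" "e \<in> I" "rank_edge A 2 e" "\<gamma> \<in> ends e" "deg I \<gamma> = 1"
  shows "isolated I e"
proof -
  have "f = e" if f: "f \<in> I" "\<delta> \<in> ends e" "\<delta> \<in> ends f" for f \<delta>
  proof -
    have touch: "fst f \<in> fst ` {e} \<or> snd f \<in> snd ` {e}" using f by (auto simp: ends_def)
    have "f \<in> {e}"
    proof (cases \<gamma>)
      case (Inl \<alpha>)
      have c: "snd g = snd e" if "g \<in> I" "fst g \<in> fst ` {e} \<or> snd g \<in> snd ` {e}" for g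
        using that deg_1_unique[OF assms(5), of g e] assms(2,4) Inl by auto
      show "f \<in> {e}"
      proof (rule tight_absorb[OF assms(1), where S = "{}" and T = "{snd e}"])
        show "{e} \<subseteq> I" using assms(2) by simp
        show "rank_edge A 2 g" if "g \<in> {e}" for g using that assms(3) by simp
        show "fst g \<in> {} \<or> snd g \<in> {snd e}" if "g \<in> I" "fst g \<in> fst ` {e} \<or> snd g \<in> snd ` {e}" for g
          using c[OF that] by simp
        show "f \<in> I" by fact
        show "fst f \<in> fst ` {e} \<or> snd f \<in> snd ` {e}" by fact
      qed simp_all
    next
      case (Inr \<beta>)
      have c: "fst g = fst e" if "g \<in> I" "fst g \<in> fst ` {e} \<or> snd g \<in> snd ` {e}" for g
        using that deg_1_unique[OF assms(5), of g e] assms(2,4) Inr by auto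
      show "f \<in> {e}"
      proof (rule tight_absorb[OF assms(1), where S = "{fst e}" and T = "{}"])
        show "{e} \<subseteq> I" using assms(2) by simp
        show "rank_edge A 2 g" if "g \<in> {e}" for g using that assms(3) by simp
        show "fst g \<in> {fst e} \<or> snd g \<in> {}" if "g \<in> I" "fst g \<in> fst ` {e} \<or> snd g \<in> snd ` {e}" for g
          using c[OF that] by simp
        show "f \<in> I" by fact
        show "fst f \<in> fst ` {e} \<or> snd f \<in> snd ` {e}" by fact
      qed simp_all
    qed
    then show ?thesis by simp
  qed
  then show ?thesis using assms(2) by (auto simp: isolated_iff)
qed

lemma tight_rank2_other_edge:
  fixes A :: "'m::{finite,linorder} \<Rightarrow> 'n::{finite,linorder} \<Rightarrow> 'f::field^2^2"
  assumes "tight A I" "e \<in> I" "rank_edge A 2 e" "\<not> isolated I e" "\<gamma> \<in> ends e"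
  shows "\<exists>f\<in>I. f \<noteq> e \<and> \<gamma> \<in> ends f"
proof (rule ccontr)
  assume "\<not> ?thesis"
  then have "deg I \<gamma> = 1" using assms by (intro deg_eq_1I[of e]) auto
  then show False using tight_leaf assms by blast
qed

text \<open>The rank-2 edges of color \<open>s\<close> match the nodes of \<open>K\<close>
  perfectly, and their left ends cover every edge meeting them. With one covering node per matching
  edge, \<open>tight_absorb\<close> excludes the other color on \<open>K\<close>.\<close>

lemma tight_closed_rank2:
  fixes A :: "'m::{finite,linorder} \<Rightarrow> 'n::{finite,linorder} \<Rightarrow> 'f::field^2^2"
  assumes tight: "tight A I" and c: "proper_coloring I c"
    and s: "\<And>\<gamma>. \<gamma> \<in> K \<Longrightarrow> \<exists>e\<in>I. \<gamma> \<in> ends e \<and> c e = s \<and> rank_edge A 2 e"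
    and closed: "\<And>e \<gamma>. e \<in> I \<Longrightarrow> \<gamma> \<in> ends e \<Longrightarrow> \<gamma> \<in> K \<Longrightarrow> ends e \<subseteq> K"
    and e: "e \<in> I" "\<gamma> \<in> ends e" "\<gamma> \<in> K"
  shows "c e = s"
proof -
  define F where "F = {e \<in> I. c e = s \<and> ends e \<subseteq> K}"
  have F_node: "\<exists>f\<in>F. \<delta> \<in> ends f" if "\<delta> \<in> K" for \<delta>
  proof -
    obtain f where f: "f \<in> I" "\<delta> \<in> ends f" "c f = s" using s[OF \<open>\<delta> \<in> K\<close>] by blast
    then have "ends f \<subseteq> K" using closed that by blast
    then show ?thesis using f by (intro bexI[of _ f]) (simp_all add: F_def)
  qed
  have rank2: "rank_edge A 2 f" if f: "f \<in> F" for f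
  proof -
    have "Inl (fst f) \<in> K" using f by (auto simp: F_def ends_def)
    then obtain g where g: "g \<in> I" "Inl (fst f) \<in> ends g" "c g = s" "rank_edge A 2 g" using s by blast
    then have "g = f" using f color_unique[OF c, of g f "Inl (fst f)"] by (auto simp: F_def)
    then show ?thesis using g by simp
  qed
  have in_K: "Inl (fst g) \<in> K" if g: "g \<in> I" "fst g \<in> fst ` F \<or> snd g \<in> snd ` F" for g
  proof -
    have "\<exists>\<delta>\<in>K. \<delta> \<in> ends g"
      using g(2)
    proof
      assume "fst g \<in> fst ` F"
      then obtain f where "f \<in> F" "fst g = fst f" by auto
      then have "Inl (fst g) \<in> K" by (auto simp: F_def ends_def)
      then show ?thesis by (intro bexI[of _ "Inl (fst g)"]) auto
    next
      assume "snd g \<in> snd ` F"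
      then obtain f where "f \<in> F" "snd g = snd f" by auto
      then have "Inr (snd g) \<in> K" by (auto simp: F_def ends_def)
      then show ?thesis by (intro bexI[of _ "Inr (snd g)"]) auto
    qed
    then have "ends g \<subseteq> K" using closed g(1) by blast
    then show ?thesis by (simp add: ends_def)
  qed
  have inj: "inj_on fst F" "inj_on snd F"
  proof -
    show "inj_on fst F"
    proof (rule inj_onI)
      fix f g assume "f \<in> F" "g \<in> F" "fst f = fst g"
      then show "f = g" using color_unique[OF c, of f g "Inl (fst f)"] by (simp add: F_def)
    qed
    show "inj_on snd F"
    proof (rule inj_onI)
      fix f g assume "f \<in> F" "g \<in> F" "snd f = snd g"
      then show "f = g" using color_unique[OF c, of f g "Inr (snd f)"] by (simp add: F_def)
    qed
  qed
  have "ends e \<subseteq> K" using closed e by blast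
  then have "Inl (fst e) \<in> K" by (simp add: ends_def)
  then obtain f where "f \<in> F" "Inl (fst e) \<in> ends f" using F_node by blast
  then have touch: "fst e \<in> fst ` F" by (metis image_eqI in_ends_iff(1))
  have "e \<in> F"
  proof (rule tight_absorb[OF tight, where S = "fst ` F" and T = "{}"])
    fix g assume "g \<in> I" "fst g \<in> fst ` F \<or> snd g \<in> snd ` F"
    then obtain f where "f \<in> F" "Inl (fst g) \<in> ends f" using F_node in_K by blast
    then have "fst g \<in> fst ` F" by (metis image_eqI in_ends_iff(1))
    then show "fst g \<in> fst ` F \<or> snd g \<in> {}" by simp
  next
    show "card (fst ` F) + card ({} :: 'n set) \<le> card F" by (simp add: card_image_le)
  qed (use touch rank2 inj e in \<open>auto simp: F_def\<close>)
  then show ?thesis by (simp add: F_def)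
qed

section \<open>Components as closed sets of nodes, and the first necessary conditions\<close>

lemma adjacency_iff: "(\<gamma>, \<delta>) \<in> adjacency I \<longleftrightarrow> (\<exists>e\<in>I. \<gamma> \<in> ends e \<and> \<delta> = other e \<gamma>)"
proof
  assume "(\<gamma>, \<delta>) \<in> adjacency I"
  then obtain e where "e \<in> I" "ends e = {\<gamma>, \<delta>}" by (auto simp: adjacency_def)
  then show "\<exists>e\<in>I. \<gamma> \<in> ends e \<and> \<delta> = other e \<gamma>"
    using ends_eq[of \<gamma> e] other_neq[of e \<gamma>] by (intro bexI[of _ e]) (auto simp: doubleton_eq_iff)
next
  assume "\<exists>e\<in>I. \<gamma> \<in> ends e \<and> \<delta> = other e \<gamma>"
  then obtain e where "e \<in> I" "\<gamma> \<in> ends e" "\<delta> = other e \<gamma>" by blast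
  then have "e \<in> I" "ends e = {\<gamma>, \<delta>}" using ends_eq by blast+
  then show "(\<gamma>, \<delta>) \<in> adjacency I" unfolding adjacency_def by blast
qed

lemma sym_adjacency: "sym (adjacency I)"
  by (auto simp: adjacency_def sym_def insert_commute)

lemma component_eq:
  assumes "K \<in> components I" "\<gamma> \<in> K"
  shows "K = (adjacency I)\<^sup>* `` {\<gamma>}"
proof -
  have eq: "equiv UNIV ((adjacency I)\<^sup>*)"
    by (simp add: equiv_def refl_rtrancl sym_rtrancl[OF sym_adjacency] trans_rtrancl)
  obtain x where x: "K = (adjacency I)\<^sup>* `` {x}" using assms(1) by (auto simp: components_def elim: quotientE)
  then have "(x, \<gamma>) \<in> (adjacency I)\<^sup>*" using assms(2) by simp
  then show ?thesis using x equiv_class_eq[OF eq] by blast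
qed

lemma component_subset:
  assumes "\<gamma> \<in> S" "\<And>e \<delta>. e \<in> I \<Longrightarrow> \<delta> \<in> ends e \<Longrightarrow> \<delta> \<in> S \<Longrightarrow> other e \<delta> \<in> S"
  shows "(adjacency I)\<^sup>* `` {\<gamma>} \<subseteq> S"
proof -
  have "\<delta> \<in> S" if "(\<gamma>, \<delta>) \<in> (adjacency I)\<^sup>*" for \<delta>
    using that by (induction rule: rtrancl_induct) (use assms in \<open>auto simp: adjacency_iff\<close>)
  then show ?thesis by blast
qed

lemma component_closed:
  assumes "K \<in> components I" "e \<in> I" "\<gamma> \<in> ends e" "\<gamma> \<in> K"
  shows "ends e \<subseteq> K"
proof -
  have "(\<gamma>, other e \<gamma>) \<in> adjacency I" using assms by (auto simp: adjacency_iff)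
  then have "other e \<gamma> \<in> K" using component_eq[OF assms(1,4)] by blast
  then show ?thesis using ends_eq[OF assms(3)] assms(4) by simp
qed

lemma component_of_isolated:
  assumes "K \<in> components I" "isolated I e" "e \<in> component_edges I K"
  shows "component_edges I K = {e}"
proof -
  have e: "e \<in> I" "ends e \<subseteq> K" using assms(3) by (auto simp: component_edges_def)
  have "Inl (fst e) \<in> K" using e(2) by (simp add: ends_def)
  then have "K = (adjacency I)\<^sup>* `` {Inl (fst e)}" using component_eq[OF assms(1)] by blast
  also have "\<dots> \<subseteq> ends e"
  proof (rule component_subset)
    fix f \<delta> assume "f \<in> I" "\<delta> \<in> ends f" "\<delta> \<in> ends e"
    then have "f = e" using assms(2) by (auto simp: isolated_iff)
    then show "other f \<delta> \<in> ends e" by simp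
  qed simp
  finally have K: "K \<subseteq> ends e" .
  have "f = e" if "f \<in> component_edges I K" for f
  proof -
    have "f \<in> I" "Inl (fst f) \<in> ends e" using that K by (auto simp: component_edges_def ends_def)
    moreover have "Inl (fst f) \<in> ends f" by simp
    ultimately show ?thesis using assms(2) unfolding isolated_iff by blast
  qed
  then show ?thesis using assms(3) by blast
qed

lemma tight_Path:
  fixes A :: "'m::{finite,linorder} \<Rightarrow> 'n::{finite,linorder} \<Rightarrow> 'f::field^2^2"
  assumes "I \<subseteq> edges A" "tight A I"
  shows "cond_Path A I"
  unfolding cond_Path_def
proof (intro allI impI)
  fix K e
  assume K: "path_component I K \<and> \<not> (\<exists>e. isolated I e \<and> component_edges I K = {e})"
    and e: "end_edge I K e"
  have eI: "e \<in> I" "e \<in> component_edges I K" using e by (auto simp: end_edge_def component_edges_def)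
  have "K \<in> components I" using K by (simp add: path_component_def)
  then have "\<not> isolated I e" using K component_of_isolated[OF _ _ eI(2)] by blast
  moreover obtain \<gamma> where "\<gamma> \<in> ends e" "deg I \<gamma> = 1"
    using e unfolding end_edge_def by (metis in_ends_iff)
  ultimately have "\<not> rank_edge A 2 e" using tight_leaf assms(2) eI(1) by blast
  then show "rank_edge A 1 e" using edge_rank_cases assms(1) eI(1) by blast
qed

lemma cycle_component_two_edges:
  assumes "cycle_component I K" "\<gamma> \<in> K"
  shows "\<exists>e\<in>component_edges I K. \<exists>f\<in>component_edges I K. e \<noteq> f \<and> \<gamma> \<in> ends e \<and> \<gamma> \<in> ends f"
proof -
  obtain vs where vs: "length vs \<ge> 3" "distinct vs" "set vs = K"
    "ends ` component_edges I K = {{vs ! i, vs ! (Suc i mod length vs)} | i. i < length vs}"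
    using assms(1) by (auto simp: cycle_component_def)
  let ?n = "length vs"
  obtain i where i: "i < ?n" "\<gamma> = vs ! i" using assms(2) vs(3) by (metis in_set_conv_nth)
  \<comment> \<open>The cyclic predecessor of \<open>i\<close>; as the cycle has at least three
    nodes, it differs from the successor.\<close>
  define j where "j = (if i = 0 then ?n - 1 else i - 1)"
  have j: "j < ?n" "Suc j mod ?n = i" "j \<noteq> i" "j \<noteq> Suc i mod ?n"
    using i vs(1) by (auto simp: j_def mod_Suc)
  have "{vs ! i, vs ! (Suc i mod ?n)} \<in> ends ` component_edges I K" using i(1) vs(4) by blast
  then obtain e where e: "e \<in> component_edges I K" "ends e = {vs ! i, vs ! (Suc i mod ?n)}" by auto
  have "{vs ! j, vs ! (Suc j mod ?n)} \<in> ends ` component_edges I K" using j(1) vs(4) by blast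
  then obtain f where f: "f \<in> component_edges I K" "ends f = {vs ! j, vs ! i}" using j(2) by auto
  have "Suc i mod ?n < ?n" using vs(1) by (intro mod_less_divisor) linarith
  then have "vs ! j \<notin> ends e"
    using j(1,3,4) i(1) nth_eq_iff_index_eq[OF vs(2) j(1)] by (simp add: e(2))
  then have "e \<noteq> f" using f(2) by auto
  then show ?thesis using e f i(2) by blast
qed

text \<open>Without a rank-1 edge of color \<open>s\<close> the rank-2 edges of color
  \<open>s\<close> reach every node of the cycle, and \<open>tight_closed_rank2\<close> leaves no
  room for the other color, which every node also carries.\<close>

lemma tight_Cycle:
  fixes A :: "'m::{finite,linorder} \<Rightarrow> 'n::{finite,linorder} \<Rightarrow> 'f::field^2^2"
  assumes "I \<subseteq> edges A" "tight A I" "proper_coloring I c"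
  shows "cond_Cycle A c I"
  unfolding cond_Cycle_def
proof (intro allI impI, rule ccontr)
  fix K s
  assume K: "cycle_component I K" and no: "\<not> (\<exists>e\<in>component_edges I K. c e = s \<and> rank_edge A 1 e)"
  have Kc: "K \<in> components I" using K by (simp add: cycle_component_def)
  have both: "\<exists>e\<in>component_edges I K. \<gamma> \<in> ends e \<and> c e = t" if \<gamma>: "\<gamma> \<in> K" for \<gamma> t
  proof -
    obtain e f where ef: "e \<in> component_edges I K" "f \<in> component_edges I K" "e \<noteq> f" "\<gamma> \<in> ends e" "\<gamma> \<in> ends f"
      using cycle_component_two_edges[OF K \<gamma>] by blast
    then have "c e \<noteq> c f"
      using color_unique[OF assms(3), of e f \<gamma>] by (auto simp: component_edges_def)
    then have "c e = t \<or> c f = t" by (cases "c e"; cases "c f"; cases t) auto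
    then show ?thesis using ef by blast
  qed
  have "K \<noteq> {}" using K by (auto simp: cycle_component_def)
  then obtain \<gamma> where \<gamma>: "\<gamma> \<in> K" by blast
  obtain e where e: "e \<in> component_edges I K" "\<gamma> \<in> ends e" "c e = opp s" using both[OF \<gamma>] by blast
  have "c e = s"
  proof (rule tight_closed_rank2[OF assms(2,3), of K])
    fix \<delta> assume "\<delta> \<in> K"
    then obtain f where f: "f \<in> component_edges I K" "\<delta> \<in> ends f" "c f = s" using both by blast
    moreover have "f \<in> I" using f by (simp add: component_edges_def)
    moreover have "rank_edge A 2 f" using edge_rank_cases[of f A] no f assms(1) \<open>f \<in> I\<close> by blast
    ultimately show "\<exists>e\<in>I. \<delta> \<in> ends e \<and> c e = s \<and> rank_edge A 2 e" by blast
  next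
    fix f \<delta> assume "f \<in> I" "\<delta> \<in> ends f" "\<delta> \<in> K"
    then show "ends f \<subseteq> K" using component_closed[OF Kc] by blast
  next
    show "e \<in> I" using e by (simp add: component_edges_def)
  qed (fact e \<gamma>)+
  then show False using e by simp
qed

section \<open>Necessity of a valid labeling\<close>

text \<open>
  \<open>forced A c I \<gamma> s X\<close>: the line of sign \<open>s\<close> at \<open>\<gamma>\<close> must be \<open>X\<close> in every valid labeling, because
  \<open>X\<close> is the kernel of the \<open>s\<close>-edge at \<open>\<gamma>\<close> or is transported along that edge.
\<close>

inductive forced ::
  "('m \<Rightarrow> 'n \<Rightarrow> 'f::field^2^2) \<Rightarrow> ('m \<times> 'n \<Rightarrow> polarity) \<Rightarrow> ('m \<times> 'n) set
     \<Rightarrow> 'm + 'n \<Rightarrow> polarity \<Rightarrow> ('f^2) set \<Rightarrow> bool"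
  for A c I where
  kernel: "e \<in> I \<Longrightarrow> rank_edge A 1 e \<Longrightarrow> \<gamma> \<in> ends e \<Longrightarrow> forced A c I \<gamma> (c e) (kern A e \<gamma>)"
| transport: "e \<in> I \<Longrightarrow> rank_edge A 2 e \<Longrightarrow> \<gamma> \<in> ends e \<Longrightarrow> forced A c I (other e \<gamma>) (opp (c e)) X
    \<Longrightarrow> forced A c I \<gamma> (c e) (perp A e (other e \<gamma>) X)"

lemma forced_is_line: "forced A c I \<gamma> s X \<Longrightarrow> is_line X"
  by (induction rule: forced.induct) (auto intro: is_line_kern is_line_perp)

section \<open>Uniqueness and existence of forced lines\<close>

lemma forced_rank1:
  assumes "proper_coloring I c" "forced A c I \<gamma> (c e) X" "e \<in> I" "\<gamma> \<in> ends e" "rank_edge A 1 e"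
  shows "X = kern A e \<gamma>"
  using assms(2)
proof cases
  case (kernel f)
  then have "f = e" using color_unique[OF assms(1)] assms by metis
  then show ?thesis using kernel by simp
next
  case (transport f Y)
  then have "f = e" using color_unique[OF assms(1)] assms by metis
  then show ?thesis using transport assms(5) rank_edge_exclusive by blast
qed

lemma forced_rank2:
  assumes "proper_coloring I c" "forced A c I \<gamma> (c e) X" "e \<in> I" "\<gamma> \<in> ends e" "rank_edge A 2 e"
  obtains Y where "forced A c I (other e \<gamma>) (opp (c e)) Y" "X = perp A e (other e \<gamma>) Y"
  using assms(2)
proof cases
  case (kernel f)
  then have "f = e" using color_unique[OF assms(1)] assms by metis
  then show ?thesis using kernel assms(5) rank_edge_exclusive by blast
next
  case (transport f Y)
  then have "f = e" using color_unique[OF assms(1)] assms by metis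
  then show ?thesis using that transport by blast
qed

lemma forced_edge: "forced A c I \<gamma> s X \<Longrightarrow> \<exists>e\<in>I. \<gamma> \<in> ends e \<and> c e = s"
  by (auto elim: forced.cases)

text \<open>A node has at most one edge of each color, so the last step of a derivation is
  determined, and induction follows it back to a kernel.\<close>

lemma forced_unique:
  assumes "proper_coloring I c" "forced A c I \<gamma> s X" "forced A c I \<gamma> s Y"
  shows "X = Y"
  using assms(2,3)
proof (induction arbitrary: Y rule: forced.induct)
  case (kernel e \<gamma>)
  then show ?case using forced_rank1[OF assms(1)] by metis
next
  case (transport e \<gamma> X)
  then show ?case using forced_rank2[OF assms(1) transport.prems transport.hyps(1,3,2)] by metis
qed

text \<open>An unforced sign at a node sits on a rank-2 edge, and the opposite sign at its other end
  is unforced as well. Following these edges permutes the finite set of unforced pairs, so a closed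
  set of nodes arises that carries rank-2 edges of both colors, which
  \<open>tight_closed_rank2\<close> excludes.\<close>

lemma forced_exists:
  fixes A :: "'m::{finite,linorder} \<Rightarrow> 'n::{finite,linorder} \<Rightarrow> 'f::field^2^2"
  assumes sub: "I \<subseteq> edges A" and tight: "tight A I" and c: "proper_coloring I c"
    and e0: "e0 \<in> I" "\<gamma>0 \<in> ends e0" "\<not> (isolated I e0 \<and> rank_edge A 2 e0)"
  shows "\<exists>X. forced A c I \<gamma>0 (c e0) X"
proof (rule ccontr)
  assume unf0: "\<nexists>X. forced A c I \<gamma>0 (c e0) X"
  define V where "V = {(\<gamma>, t). (\<exists>e\<in>I. \<gamma> \<in> ends e \<and> c e = t \<and> \<not> isolated I e) \<and> (\<nexists>X. forced A c I \<gamma> t X)}"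
  have V_edge: "\<exists>e. e \<in> I \<and> fst v \<in> ends e \<and> c e = snd v \<and> \<not> isolated I e \<and> rank_edge A 2 e"
    if v: "v \<in> V" for v
  proof -
    obtain e where e: "e \<in> I" "fst v \<in> ends e" "c e = snd v" "\<not> isolated I e" "\<nexists>X. forced A c I (fst v) (snd v) X"
      using v unfolding V_def case_prod_unfold mem_Collect_eq by blast
    then have "\<not> rank_edge A 1 e" using forced.kernel[of e I A "fst v" c] by auto
    then have "rank_edge A 2 e" using edge_rank_cases sub e(1) by blast
    then show ?thesis using e by blast
  qed
  then obtain ed where ed: "\<And>v. v \<in> V \<Longrightarrow> ed v \<in> I \<and> fst v \<in> ends (ed v) \<and> c (ed v) = snd v \<and>
    \<not> isolated I (ed v) \<and> rank_edge A 2 (ed v)" by metis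
  define nxt where "nxt = (\<lambda>v. (other (ed v) (fst v), opp (snd v)))"
  have nxt_V: "nxt v \<in> V" if v: "v \<in> V" for v
  proof -
    note e = ed[OF v]
    have "\<nexists>X. forced A c I (other (ed v) (fst v)) (opp (snd v)) X"
    proof
      assume "\<exists>X. forced A c I (other (ed v) (fst v)) (opp (snd v)) X"
      then obtain X where "forced A c I (other (ed v) (fst v)) (opp (c (ed v))) X" using e by auto
      then have "forced A c I (fst v) (c (ed v)) (perp A (ed v) (other (ed v) (fst v)) X)"
        using e forced.transport by blast
      then show False using v e by (auto simp: V_def)
    qed
    moreover obtain f where f: "f \<in> I" "f \<noteq> ed v" "other (ed v) (fst v) \<in> ends f"
      using tight_rank2_other_edge[OF tight, of "ed v" "other (ed v) (fst v)"] e by auto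
    moreover have "c f = opp (snd v)"
      using color_unique[OF c, of f "ed v" "other (ed v) (fst v)"] f e neq_iff_opp[of "c f" "snd v"] by auto
    moreover have "\<not> isolated I f"
    proof
      assume "isolated I f"
      then have "ed v = f" using f(3) e unfolding isolated_iff by (metis other_in_ends)
      then show False using f(2) by simp
    qed
    ultimately show ?thesis by (auto simp: V_def nxt_def)
  qed
  have "inj_on nxt V"
  proof (rule inj_onI)
    fix v w assume vw: "v \<in> V" "w \<in> V" "nxt v = nxt w"
    then have eq: "snd v = snd w" "other (ed v) (fst v) = other (ed w) (fst w)" by (auto simp: nxt_def)
    have "ed v = ed w"
      using color_unique[OF c, of "ed v" "ed w" "other (ed v) (fst v)"] ed vw(1,2) eq
      by (metis other_in_ends)
    then have "fst v = fst w" using eq(2) ed vw(1,2) other_other by metis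
    then show "v = w" using eq(1) by (simp add: prod_eq_iff)
  qed
  moreover have "finite V"
  proof (rule finite_subset)
    show "V \<subseteq> UNIV \<times> {Plus, Minus}" using polarity.exhaust by auto
  qed simp
  \<comment> \<open>Injectivity on a finite set gives surjectivity: every unforced pair is also
    entered by an edge.\<close>
  ultimately have onto: "nxt ` V = V" using nxt_V endo_inj_surj[of V nxt] by blast
  \<comment> \<open>Each step changes both the color class and the sign, so along the walk the sign
    is a function of the class; \<open>s\<close> normalizes it to \<open>c e0\<close> at
    \<open>\<gamma>0\<close>.\<close>
  define s where "s = (case \<gamma>0 of Inl _ \<Rightarrow> c e0 | Inr _ \<Rightarrow> opp (c e0))"
  define pol where "pol = (\<lambda>\<gamma>::'m + 'n. case \<gamma> of Inl _ \<Rightarrow> s | Inr _ \<Rightarrow> opp s)"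
  define K where "K = {\<gamma>. (\<gamma>, pol \<gamma>) \<in> V}"
  have pol_other: "pol (other e \<gamma>) = opp (pol \<gamma>)" for e :: "'m \<times> 'n" and \<gamma>
    by (cases \<gamma>) (auto simp: pol_def)
  have pol0: "pol \<gamma>0 = c e0" by (cases \<gamma>0) (auto simp: pol_def s_def)
  have "\<not> isolated I e0"
  proof
    assume i: "isolated I e0"
    then have "rank_edge A 1 e0" using e0 edge_rank_cases sub by blast
    then show False using unf0 forced.kernel e0 by blast
  qed
  then have K0: "\<gamma>0 \<in> K" using e0 unf0 by (auto simp: K_def V_def pol0)
  have out: "\<exists>e\<in>I. \<gamma> \<in> ends e \<and> c e = pol \<gamma> \<and> rank_edge A 2 e \<and> ends e \<subseteq> K" if \<gamma>: "\<gamma> \<in> K" for \<gamma>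
  proof -
    have v: "(\<gamma>, pol \<gamma>) \<in> V" using \<gamma> by (simp add: K_def)
    note e = ed[OF v]
    have "other (ed (\<gamma>, pol \<gamma>)) \<gamma> \<in> K" using nxt_V[OF v] by (simp add: nxt_def K_def pol_other)
    then have "ends (ed (\<gamma>, pol \<gamma>)) \<subseteq> K" using \<gamma> e ends_eq[of \<gamma> "ed (\<gamma>, pol \<gamma>)"] by simp
    then show ?thesis using e by auto
  qed
  \<comment> \<open>The edge by which the pair at \<open>\<gamma>\<close> is entered has the color
    opposite to \<open>pol \<gamma>\<close>, the leaving edge has the color
    \<open>pol \<gamma>\<close>.\<close>
  have inc: "\<exists>e\<in>I. \<gamma> \<in> ends e \<and> c e = opp (pol \<gamma>) \<and> rank_edge A 2 e \<and> ends e \<subseteq> K" if \<gamma>: "\<gamma> \<in> K" for \<gamma>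
  proof -
    have "(\<gamma>, pol \<gamma>) \<in> nxt ` V" using \<gamma> onto by (simp add: K_def)
    then obtain w where w: "w \<in> V" "other (ed w) (fst w) = \<gamma>" "opp (snd w) = pol \<gamma>" by (auto simp: nxt_def)
    note e = ed[OF w(1)]
    have "pol (fst w) = snd w" using w(2,3) pol_other[of "ed w" "fst w"] by simp
    then have "fst w \<in> K" using w(1) by (simp add: K_def)
    then have "ends (ed w) \<subseteq> K" using \<gamma> e w(2) ends_eq[of "fst w" "ed w"] by simp
    moreover have "\<gamma> \<in> ends (ed w)" using w(2) other_in_ends by metis
    moreover have "c (ed w) = opp (pol \<gamma>)" using e w(3) by (metis opp_opp)
    ultimately show ?thesis using e by blast
  qed
  have both: "\<exists>e\<in>I. \<gamma> \<in> ends e \<and> c e = t \<and> rank_edge A 2 e \<and> ends e \<subseteq> K" if "\<gamma> \<in> K" for \<gamma> t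
    using out[OF that] inc[OF that] neq_iff_opp[of t "pol \<gamma>"] by metis
  \<comment> \<open>Rank-2 edges of both colors occur at every node of \<open>K\<close>, so the
    choice of \<open>Plus\<close> is arbitrary.\<close>
  have all_s: "c e = Plus" if "e \<in> I" "\<gamma>0 \<in> ends e" for e
  proof (rule tight_closed_rank2[OF tight c, of K])
    show "\<exists>e\<in>I. \<gamma> \<in> ends e \<and> c e = Plus \<and> rank_edge A 2 e" if "\<gamma> \<in> K" for \<gamma>
      using both[OF that, of Plus] by blast
    fix f \<gamma> assume f: "f \<in> I" "\<gamma> \<in> ends f" "\<gamma> \<in> K"
    obtain g where g: "g \<in> I" "\<gamma> \<in> ends g" "c g = c f" "ends g \<subseteq> K" using both[OF f(3)] by blast
    then have "g = f" using color_unique[OF c] f by metis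
    then show "ends f \<subseteq> K" using g by simp
  qed (use that K0 in auto)
  obtain e where "e \<in> I" "\<gamma>0 \<in> ends e" "c e = Minus" using both[OF K0] by blast
  then show False using all_s by fastforce
qed

text \<open>
  If both lines at a node are forced and equal, then in suitable bases a position of every such node
  is annihilated along all edges; a transversal using every edge has to use each of these
  positions, which takes more edges than are available.
\<close>

lemma forced_distinct:
  fixes A :: "'m::{finite,linorder} \<Rightarrow> 'n::{finite,linorder} \<Rightarrow> 'f::field^2^2"
  assumes sub: "I \<subseteq> edges A" and tight: "tight A I" and c: "proper_coloring I c"
    and X0: "forced A c I \<gamma>0 Plus X0" "forced A c I \<gamma>0 Minus X0"
  shows False
proof -
  have Deg: "cond_Deg I" using tight by (rule tight_Deg)
  \<comment> \<open>All nodes with coinciding forced lines are considered at once, because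
    coincidence spreads along rank-2 edges.\<close>
  define G where "G = {\<gamma>. \<exists>X. forced A c I \<gamma> Plus X \<and> forced A c I \<gamma> Minus X}"
  have "\<exists>X. \<gamma> \<in> G \<longrightarrow> forced A c I \<gamma> Plus X \<and> forced A c I \<gamma> Minus X" for \<gamma> by (auto simp: G_def)
  then obtain X where "\<And>\<gamma>. \<gamma> \<in> G \<Longrightarrow> forced A c I \<gamma> Plus (X \<gamma>) \<and> forced A c I \<gamma> Minus (X \<gamma>)" by metis
  then have X: "forced A c I \<gamma> s (X \<gamma>)" if "\<gamma> \<in> G" for \<gamma> s using that by (cases s) auto
  have X_line: "is_line (X \<gamma>)" if "\<gamma> \<in> G" for \<gamma> using X[OF that] forced_is_line by blast
  have closed: "other e \<gamma> \<in> G \<and> X \<gamma> = perp A e (other e \<gamma>) (X (other e \<gamma>))"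
    if e: "e \<in> I" "\<gamma> \<in> ends e" "rank_edge A 2 e" and \<gamma>: "\<gamma> \<in> G" for e \<gamma>
  proof -
    let ?\<delta> = "other e \<gamma>"
    obtain Y where Y: "forced A c I ?\<delta> (opp (c e)) Y" "X \<gamma> = perp A e ?\<delta> Y"
      using forced_rank2[OF c X[OF \<gamma>] e(1,2,3)] by blast
    \<comment> \<open>The same line is forced at \<open>\<gamma>\<close> with the other sign as
      well, so it can be sent back over \<open>e\<close>, where \<open>perp_perp\<close> returns
      \<open>Y\<close>.\<close>
    have "forced A c I (other e ?\<delta>) (opp (c e)) (X \<gamma>)" using X[OF \<gamma>] e by simp
    then have "forced A c I ?\<delta> (c e) (perp A e (other e ?\<delta>) (X \<gamma>))"
      using e(1,3) other_in_ends by (intro forced.transport)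
    moreover have "perp A e (other e ?\<delta>) (X \<gamma>) = Y"
      unfolding Y(2) using forced_is_line[OF Y(1)] e(3) by (intro perp_perp) auto
    ultimately have Y': "forced A c I ?\<delta> (c e) Y" by simp
    have Ys: "forced A c I ?\<delta> s Y" for s using Y(1) Y' by (cases "s = c e") (auto simp: neq_iff_opp)
    then have "?\<delta> \<in> G" by (auto simp: G_def)
    moreover have "X ?\<delta> = Y" using forced_unique[OF c X[OF calculation] Ys[of Plus]] .
    ultimately show ?thesis using Y(2) by simp
  qed
  have two: "\<exists>e f. e \<in> I \<and> f \<in> I \<and> e \<noteq> f \<and> \<gamma> \<in> ends e \<and> \<gamma> \<in> ends f" if \<gamma>: "\<gamma> \<in> G" for \<gamma>
  proof -
    obtain e f where "e \<in> I" "\<gamma> \<in> ends e" "c e = Plus" "f \<in> I" "\<gamma> \<in> ends f" "c f = Minus"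
      using X[OF \<gamma>] forced_edge by metis
    then show ?thesis by (metis polarity.distinct(1))
  qed
  have "\<exists>u v. indep2 u v \<and> (\<gamma> \<in> G \<longrightarrow> u \<in> X \<gamma>)" for \<gamma>
  proof (cases "\<gamma> \<in> G")
    case True
    then obtain u where "u \<noteq> 0" "X \<gamma> = line u" using X_line by (auto simp: is_line_def)
    then show ?thesis using ex_indep2[of u] self_in_line by metis
  next
    case False
    have "indep2 (vector [1, 0] :: 'f^2) (vector [0, 1])" by (simp add: indep2_def)
    then show ?thesis using False by blast
  qed
  then obtain b1 b2 where b12: "\<And>\<gamma>. indep2 (b1 \<gamma>) (b2 \<gamma>)" "\<And>\<gamma>. \<gamma> \<in> G \<Longrightarrow> b1 \<gamma> \<in> X \<gamma>" by metis
  \<comment> \<open>At nodes of \<open>G\<close> position 1 stands for the common forced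
    line.\<close>
  define b where "b = (\<lambda>\<gamma> (i::2). if i = 1 then b1 \<gamma> else b2 \<gamma>)"
  define A' where "A' = in_basis b A"
  have rank: "rank_on A' J = rank_on A J" for J
    unfolding A'_def by (rule rank_on_in_basis) (simp add: b_def b12)
  have "tight A' I" using tight by (simp add: tight_def rank)
  moreover obtain R \<tau> where R: "transversal (entry A') I R \<tau>" using rank_gmat_transversal by blast
  ultimately have blocks: "(\<lambda>p. (fst p, fst (\<tau> p))) ` R = I" using tight_transversal_blocks by blast
  define ed where "ed = (\<lambda>p. (fst p, fst (\<tau> p)))"
  \<comment> \<open>The row or column position that the transversal entry \<open>p\<close> occupies
    at the end \<open>\<gamma>\<close> of its block.\<close>
  define slot where "slot = (\<lambda>p (\<gamma>::'m + 'n). case \<gamma> of Inl _ \<Rightarrow> snd p | Inr _ \<Rightarrow> snd (\<tau> p))"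
  have ed_I: "ed ` R = I" using blocks by (simp add: ed_def)
  have slot_inj: "p = q" if "p \<in> R" "q \<in> R" "\<gamma> \<in> ends (ed p)" "\<gamma> \<in> ends (ed q)" "slot p \<gamma> = slot q \<gamma>" for p q \<gamma>
  proof (cases \<gamma>)
    case (Inl \<alpha>)
    then show ?thesis using that by (auto simp: ed_def slot_def prod_eq_iff)
  next
    case (Inr \<beta>)
    then have "\<tau> p = \<tau> q" using that by (auto simp: ed_def slot_def prod_eq_iff)
    moreover have "inj_on \<tau> R" using R by (simp add: transversal_def)
    ultimately show ?thesis using that by (auto dest: inj_onD)
  qed
  have nz: "form_at A (ed p) \<gamma> (b \<gamma> (slot p \<gamma>)) (b (other (ed p) \<gamma>) (slot p (other (ed p) \<gamma>))) \<noteq> 0"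
    if "p \<in> R" "\<gamma> \<in> ends (ed p)" for p \<gamma>
  proof -
    have "entry A' p (\<tau> p) \<noteq> 0" using R that(1) by (simp add: transversal_def)
    then show ?thesis using that(2)
      by (cases \<gamma>) (auto simp: ed_def slot_def entry_def A'_def in_basis_def form_at_def)
  qed
  have slot_cases: "slot p \<gamma> = 1 \<or> slot p \<gamma> = 2" for p \<gamma> using exhaust_2 by blast
  \<comment> \<open>A node of \<open>G\<close> has two slots and a second edge occupying one of
    them, so an edge at it is used by only one entry.\<close>
  have ed_inj: "p = q" if pq: "p \<in> R" "q \<in> R" "\<gamma> \<in> G" "\<gamma> \<in> ends (ed p)" "ed p = ed q" for p q \<gamma>
  proof -
    obtain f where f: "f \<in> I" "f \<noteq> ed p" "\<gamma> \<in> ends f" using two[OF pq(3)] by metis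
    then obtain r where r: "r \<in> R" "ed r = f" using ed_I by blast
    have "slot r \<gamma> \<noteq> slot p \<gamma>" "slot r \<gamma> \<noteq> slot q \<gamma>"
      using slot_inj[of r p \<gamma>] slot_inj[of r q \<gamma>] pq r f by auto
    then have "slot p \<gamma> = slot q \<gamma>" using slot_cases[of p \<gamma>] slot_cases[of q \<gamma>] slot_cases[of r \<gamma>] by auto
    then show ?thesis using slot_inj pq by metis
  qed
  \<comment> \<open>Entries from two different edges fill both slots at the node, so slot 1 is
    used.\<close>
  have "\<exists>p. \<gamma> \<in> G \<longrightarrow> p \<in> R \<and> \<gamma> \<in> ends (ed p) \<and> slot p \<gamma> = 1" for \<gamma>
  proof (cases "\<gamma> \<in> G")
    case True
    then obtain e f where ef: "e \<in> I" "f \<in> I" "e \<noteq> f" "\<gamma> \<in> ends e" "\<gamma> \<in> ends f" using two by blast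
    then obtain p q where pq: "p \<in> R" "q \<in> R" "ed p = e" "ed q = f" using ed_I by blast
    then have "slot p \<gamma> \<noteq> slot q \<gamma>" using slot_inj[of p q \<gamma>] ef by auto
    then have "slot p \<gamma> = 1 \<or> slot q \<gamma> = 1" using slot_cases[of p \<gamma>] slot_cases[of q \<gamma>] by auto
    then show ?thesis using pq ef by blast
  qed simp
  then obtain h where h: "\<And>\<gamma>. \<gamma> \<in> G \<Longrightarrow> h \<gamma> \<in> R \<and> \<gamma> \<in> ends (ed (h \<gamma>)) \<and> slot (h \<gamma>) \<gamma> = 1" by metis
  have h_I: "ed (h \<gamma>) \<in> I" if "\<gamma> \<in> G" for \<gamma> using h[OF that] ed_I by blast
  \<comment> \<open>On a rank-1 edge the common line is the kernel, so an entry in slot 1 would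
    vanish.\<close>
  have h_rank: "rank_edge A 2 (ed (h \<gamma>))" if \<gamma>: "\<gamma> \<in> G" for \<gamma>
  proof (rule ccontr)
    assume "\<not> rank_edge A 2 (ed (h \<gamma>))"
    then have r1: "rank_edge A 1 (ed (h \<gamma>))" using edge_rank_cases sub h_I[OF \<gamma>] by blast
    have "X \<gamma> = kern A (ed (h \<gamma>)) \<gamma>"
      using forced_rank1[OF c X[OF \<gamma>] h_I[OF \<gamma>] _ r1] h[OF \<gamma>] by blast
    then have "b \<gamma> (slot (h \<gamma>) \<gamma>) \<in> kern A (ed (h \<gamma>)) \<gamma>" using b12(2)[OF \<gamma>] h[OF \<gamma>] by (simp add: b_def)
    then show False using nz[of "h \<gamma>" \<gamma>] h[OF \<gamma>] by (simp add: kern_def)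
  qed
  \<comment> \<open>Slot 1 at both ends would evaluate the form on two lines that annihilate each
    other.\<close>
  have h_other: "slot (h \<gamma>) (other (ed (h \<gamma>)) \<gamma>) \<noteq> 1" if \<gamma>: "\<gamma> \<in> G" for \<gamma>
  proof
    let ?\<delta> = "other (ed (h \<gamma>)) \<gamma>"
    assume s: "slot (h \<gamma>) ?\<delta> = 1"
    have cl: "?\<delta> \<in> G" "X \<gamma> = perp A (ed (h \<gamma>)) ?\<delta> (X ?\<delta>)"
      using closed[OF h_I[OF \<gamma>] _ h_rank[OF \<gamma>] \<gamma>] h[OF \<gamma>] by blast+
    have "b1 \<gamma> \<in> X \<gamma>" "b1 ?\<delta> \<in> X ?\<delta>" using b12(2) \<gamma> cl(1) by blast+
    then have "form_at A (ed (h \<gamma>)) \<gamma> (b1 \<gamma>) (b1 ?\<delta>) = 0" unfolding cl(2) by (simp add: perp_def)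
    then show False using nz[of "h \<gamma>" \<gamma>] h[OF \<gamma>] s by (simp add: b_def)
  qed
  define F where "F = {e \<in> I. rank_edge A 2 e \<and> ends e \<subseteq> G}"
  \<comment> \<open>An edge serves slot 1 for at most one of its ends, so each node of
    \<open>G\<close> claims a rank-2 edge of its own.\<close>
  have "inj_on (\<lambda>\<gamma>. ed (h \<gamma>)) G"
  proof (rule inj_onI, rule ccontr)
    fix \<gamma> \<delta> assume g: "\<gamma> \<in> G" "\<delta> \<in> G" "ed (h \<gamma>) = ed (h \<delta>)" "\<gamma> \<noteq> \<delta>"
    then have eq: "h \<gamma> = h \<delta>" using ed_inj h by metis
    then have "\<delta> \<in> ends (ed (h \<gamma>))" using h[OF g(2)] by simp
    then have "\<delta> = other (ed (h \<gamma>)) \<gamma>" using ends_eq[of \<gamma> "ed (h \<gamma>)"] h[OF g(1)] g(4) by auto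
    then show False using h_other[OF g(1)] h[OF g(2)] eq by simp
  qed
  moreover have "(\<lambda>\<gamma>. ed (h \<gamma>)) ` G \<subseteq> F"
  proof
    fix e assume "e \<in> (\<lambda>\<gamma>. ed (h \<gamma>)) ` G"
    then obtain \<gamma> where \<gamma>: "\<gamma> \<in> G" "e = ed (h \<gamma>)" by blast
    have "other e \<gamma> \<in> G" using closed[OF h_I[OF \<gamma>(1)] _ h_rank[OF \<gamma>(1)] \<gamma>(1)] h[OF \<gamma>(1)] \<gamma>(2) by blast
    moreover have "ends e = {\<gamma>, other e \<gamma>}" using ends_eq h[OF \<gamma>(1)] \<gamma>(2) by blast
    ultimately show "e \<in> F" using h_I h_rank \<gamma> by (simp add: F_def)
  qed
  ultimately have "card G \<le> card F" by (metis card_inj_on_le finite)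
  \<comment> \<open>Counting incidences: the degrees in \<open>F\<close> sum to at least twice
    \<open>card G\<close>, while (Deg) allows at most 2 at each node. Equality leaves no edge at
    \<open>G\<close> outside \<open>F\<close>, so rank-1 edges avoid \<open>G\<close>.\<close>
  have "(\<Sum>\<gamma>\<in>G. card {e \<in> F. \<gamma> \<in> ends e}) = (\<Sum>e\<in>F. 2)"
  proof (rule sum_multicount_gen)
    show "\<forall>e\<in>F. card {\<gamma> \<in> G. \<gamma> \<in> ends e} = 2"
    proof
      fix e assume "e \<in> F"
      then have "{\<gamma> \<in> G. \<gamma> \<in> ends e} = ends e" by (auto simp: F_def)
      then show "card {\<gamma> \<in> G. \<gamma> \<in> ends e} = 2" by (simp add: ends_def)
    qed
  qed simp_all
  then have "(\<Sum>\<gamma>\<in>G. card {e \<in> F. \<gamma> \<in> ends e}) \<ge> (\<Sum>\<gamma>\<in>G. 2)" using \<open>card G \<le> card F\<close> by simp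
  have le: "{e \<in> F. \<gamma> \<in> ends e} \<subseteq> {e \<in> I. \<gamma> \<in> ends e}" for \<gamma> by (auto simp: F_def)
  have deg2: "card {e \<in> I. \<gamma> \<in> ends e} \<le> 2" for \<gamma> using Deg by (simp add: cond_Deg_def deg_def)
  have no_rank1: "\<not> rank_edge A 1 e" if e: "e \<in> I" "\<gamma> \<in> ends e" and \<gamma>: "\<gamma> \<in> G" for e \<gamma>
  proof
    assume "rank_edge A 1 e"
    then have "e \<notin> F" using rank_edge_exclusive unfolding F_def by blast
    then have "{e \<in> F. \<gamma> \<in> ends e} \<subset> {e \<in> I. \<gamma> \<in> ends e}" using e le[of \<gamma>] by blast
    then have "card {e \<in> F. \<gamma> \<in> ends e} < card {e \<in> I. \<gamma> \<in> ends e}" by (intro psubset_card_mono) auto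
    then have "card {e \<in> F. \<gamma> \<in> ends e} < 2" using deg2[of \<gamma>] by linarith
    moreover have "card {e \<in> F. \<delta> \<in> ends e} \<le> 2" for \<delta>
      using card_mono[OF _ le[of \<delta>]] deg2[of \<delta>] by (meson finite order_trans)
    ultimately have "(\<Sum>\<gamma>\<in>G. card {e \<in> F. \<gamma> \<in> ends e}) < (\<Sum>\<gamma>\<in>G. 2)"
      using \<gamma> by (intro sum_strict_mono_ex1) auto
    then show False using \<open>(\<Sum>\<gamma>\<in>G. card {e \<in> F. \<gamma> \<in> ends e}) \<ge> (\<Sum>\<gamma>\<in>G. 2)\<close> by simp
  qed
  \<comment> \<open>Every derivation starts at the kernel of a rank-1 edge, hence outside
    \<open>G\<close>; by \<open>closed\<close> it cannot enter \<open>G\<close> later.\<close>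
  have "\<gamma> \<notin> G" if "forced A c I \<gamma> s Y" for \<gamma> s Y
    using that
  proof (induction rule: forced.induct)
    case (kernel e \<gamma>)
    then show ?case using no_rank1 by blast
  next
    case (transport e \<gamma> X)
    then show ?case using closed by blast
  qed
  moreover have "\<gamma>0 \<in> G" using X0 by (auto simp: G_def)
  ultimately show False using X0(1) by blast
qed

text \<open>Forced lines are used wherever they exist, and \<open>forced_distinct\<close> separates
  them. Unforced signs at the remaining nodes are filled freely. Isolated rank-2 edges have no
  kernel to start from: they get the coordinate axes at the left end and their annihilators at the
  right end.\<close>

lemma tight_VL:
  fixes A :: "'m::{finite,linorder} \<Rightarrow> 'n::{finite,linorder} \<Rightarrow> 'f::field^2^2"
  assumes sub: "I \<subseteq> edges A" and tight: "tight A I" and c: "proper_coloring I c"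
  shows "cond_VL A c I"
proof -
  define std :: "polarity \<Rightarrow> ('f^2) set" where
    "std s = line (case s of Plus \<Rightarrow> vector [1, 0] | Minus \<Rightarrow> vector [0, 1])" for s
  have std_line: "is_line (std s)" for s
  proof -
    have "(case s of Plus \<Rightarrow> vector [1, 0] | Minus \<Rightarrow> vector [0, 1]) \<noteq> (0 :: 'f^2)"
      by (cases s) (auto simp: vec2_eq_iff)
    then show ?thesis unfolding std_def is_line_def by blast
  qed
  have std_neq: "std Plus \<noteq> std Minus"
    unfolding std_def by (simp add: line_neq_iff_indep2 vec2_eq_iff indep2_def)
  have other_line: "\<exists>Y. is_line Y \<and> Y \<noteq> X" for X :: "('f^2) set" using std_line std_neq by metis
  define iso2 where "iso2 \<gamma> e \<longleftrightarrow> isolated I e \<and> rank_edge A 2 e \<and> \<gamma> \<in> ends e" for \<gamma> e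
  \<comment> \<open>At a right end the line of sign \<open>s\<close> must annihilate the left line
    of sign \<open>opp s\<close>, hence the \<open>opp\<close>.\<close>
  define good where "good \<gamma> M \<longleftrightarrow> (\<forall>s. is_line (M s)) \<and> M Plus \<noteq> M Minus \<and>
      (\<forall>e. iso2 \<gamma> e \<longrightarrow> M = (\<lambda>s. case \<gamma> of Inl _ \<Rightarrow> std s | Inr _ \<Rightarrow> perp A e (Inl (fst e)) (std (opp s)))) \<and>
      ((\<nexists>e. iso2 \<gamma> e) \<longrightarrow> (\<forall>s X. forced A c I \<gamma> s X \<longrightarrow> M s = X))" for \<gamma> M
  have "\<exists>M. good \<gamma> M" for \<gamma>
  proof (cases "\<exists>e. iso2 \<gamma> e")
    case True
    then obtain e where e: "iso2 \<gamma> e" by blast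
    have uniq: "f = e" if "iso2 \<gamma> f" for f
      using that e unfolding iso2_def isolated_iff by blast
    define M where "M = (\<lambda>s. case \<gamma> of Inl _ \<Rightarrow> std s | Inr _ \<Rightarrow> perp A e (Inl (fst e)) (std (opp s)))"
    have r: "rank_edge A 2 e" using e by (simp add: iso2_def)
    have pp: "perp A e (other e (Inl (fst e))) (perp A e (Inl (fst e)) (std s)) = std s" for s
      by (rule perp_perp[OF r std_line]) simp
    have "is_line (M s)" for s
      using std_line is_line_perp[OF r std_line] by (cases \<gamma>) (auto simp: M_def)
    moreover have "M Plus \<noteq> M Minus"
    proof (cases \<gamma>)
      case (Inl \<alpha>)
      then show ?thesis using std_neq by (simp add: M_def)
    next
      case (Inr \<beta>)
      then show ?thesis using std_neq pp[of Plus] pp[of Minus] by (auto simp: M_def)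
    qed
    moreover have "\<forall>f. iso2 \<gamma> f \<longrightarrow>
        M = (\<lambda>s. case \<gamma> of Inl _ \<Rightarrow> std s | Inr _ \<Rightarrow> perp A f (Inl (fst f)) (std (opp s)))"
      using uniq M_def by blast
    ultimately have "good \<gamma> M" using True unfolding good_def by blast
    then show ?thesis by blast
  next
    case False
    consider (both) X Y where "forced A c I \<gamma> Plus X" "forced A c I \<gamma> Minus Y"
      | (one) s X where "forced A c I \<gamma> s X" "\<nexists>Y. forced A c I \<gamma> (opp s) Y"
      | (none) "\<nexists>s X. forced A c I \<gamma> s X"
    proof (cases "\<exists>X. forced A c I \<gamma> Plus X")
      case True
      then obtain X where X: "forced A c I \<gamma> Plus X" by blast
      show ?thesis
      proof (cases "\<exists>Y. forced A c I \<gamma> Minus Y")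
        case True then show ?thesis using that(1) X by blast
      next
        case False then show ?thesis using that(2)[OF X] by simp
      qed
    next
      case no_plus: False
      show ?thesis
      proof (cases "\<exists>Y. forced A c I \<gamma> Minus Y")
        case True
        then obtain Y where "forced A c I \<gamma> Minus Y" by blast
        then show ?thesis using that(2)[of Minus Y] no_plus by simp
      next
        case False
        then have "\<not> forced A c I \<gamma> s X" for s X using no_plus by (cases s) auto
        then show ?thesis using that(3) by blast
      qed
    qed
    then have "\<exists>M. (\<forall>s. is_line (M s)) \<and> M Plus \<noteq> M Minus \<and> (\<forall>s X. forced A c I \<gamma> s X \<longrightarrow> M s = X)"
    proof cases
      case both
      define M where "M = (\<lambda>s. case s of Plus \<Rightarrow> X | Minus \<Rightarrow> Y)"
      have M: "forced A c I \<gamma> s (M s)" for s using both by (cases s) (auto simp: M_def)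
      have "M Plus \<noteq> M Minus" using forced_distinct[OF sub tight c] M by metis
      then show ?thesis using M forced_is_line forced_unique[OF c] by blast
    next
      case one
      obtain Y where Y: "is_line Y" "Y \<noteq> X" using other_line by blast
      define M where "M = (\<lambda>t. if t = s then X else Y)"
      have "is_line (M t)" for t using forced_is_line[OF one(1)] Y(1) by (simp add: M_def)
      moreover have "M Plus \<noteq> M Minus" using Y(2) by (cases s) (auto simp: M_def)
      moreover have "M t = Z" if "forced A c I \<gamma> t Z" for t Z
        using that one forced_unique[OF c one(1)] by (cases "t = s") (auto simp: M_def neq_iff_opp)
      ultimately show ?thesis by blast
    next
      case none
      then show ?thesis using std_line std_neq by (intro exI[of _ std]) blast
    qed
    then show ?thesis using False unfolding good_def by blast
  qed
  then obtain L where good: "\<And>\<gamma>. good \<gamma> (L \<gamma>)" by metis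
  have L: "\<And>\<gamma> s. is_line (L \<gamma> s)" "\<And>\<gamma>. L \<gamma> Plus \<noteq> L \<gamma> Minus"
    "\<And>\<gamma> e. iso2 \<gamma> e \<Longrightarrow> L \<gamma> = (\<lambda>s. case \<gamma> of Inl _ \<Rightarrow> std s | Inr _ \<Rightarrow> perp A e (Inl (fst e)) (std (opp s)))"
    "\<And>\<gamma> s X. (\<nexists>e. iso2 \<gamma> e) \<Longrightarrow> forced A c I \<gamma> s X \<Longrightarrow> L \<gamma> s = X"
    using good unfolding good_def by blast+
  have iso2_edge: "isolated I e \<and> rank_edge A 2 e" if "e \<in> I" "\<gamma> \<in> ends e" "iso2 \<gamma> f" for e f \<gamma>
  proof -
    have "e = f" using that unfolding iso2_def isolated_iff by blast
    then show ?thesis using that(3) by (simp add: iso2_def)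
  qed
  have rank1: "L \<gamma> (c e) = kern A e \<gamma>" if e: "e \<in> I" "\<gamma> \<in> ends e" "rank_edge A 1 e" for e \<gamma>
  proof (rule L(4))
    show "\<nexists>f. iso2 \<gamma> f" using iso2_edge[OF e(1,2)] rank_edge_exclusive[OF e(3)] by blast
    show "forced A c I \<gamma> (c e) (kern A e \<gamma>)" using e by (intro forced.kernel)
  qed
  have orth: "form_at A e \<gamma> u v = 0"
    if e: "e \<in> I" "\<gamma> \<in> ends e" and uv: "u \<in> L \<gamma> (c e)" "v \<in> L (other e \<gamma>) (opp (c e))" for e \<gamma> u v
  proof -
    consider "rank_edge A 1 e" | "rank_edge A 2 e" "isolated I e" | "rank_edge A 2 e" "\<not> isolated I e"
      using edge_rank_cases e(1) sub by blast
    then show ?thesis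
    proof cases
      case 1
      then show ?thesis using rank1[OF e 1] uv(1) by (simp add: kern_def)
    next
      case 2
      then have iso: "iso2 \<gamma> e" "iso2 (other e \<gamma>) e" using e by (auto simp: iso2_def)
      show ?thesis
      proof (cases \<gamma>)
        case (Inl \<alpha>)
        then have "u \<in> std (c e)" "v \<in> perp A e \<gamma> (std (c e))"
          using uv e(2) unfolding L(3)[OF iso(1)] L(3)[OF iso(2)] by auto
        then show ?thesis by (simp add: perp_def)
      next
        case (Inr \<beta>)
        then have "v \<in> std (opp (c e))" "u \<in> perp A e (other e \<gamma>) (std (opp (c e)))"
          using uv e(2) unfolding L(3)[OF iso(1)] L(3)[OF iso(2)] by auto
        then have "form_at A e (other e \<gamma>) v u = 0" by (simp add: perp_def)
        then show ?thesis by simp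
      qed
    next
      \<comment> \<open>\<open>forced_exists\<close> provides the line of sign \<open>c e\<close> at
        one end; inverting its derivation yields the line of opposite sign at the other.\<close>
      case 3
      have no: "\<nexists>f. iso2 \<delta> f" if "\<delta> \<in> ends e" for \<delta> using iso2_edge[OF e(1) that] 3 by blast
      obtain X where X: "forced A c I \<gamma> (c e) X" using forced_exists[OF sub tight c e] 3 by blast
      obtain Y where Y: "forced A c I (other e \<gamma>) (opp (c e)) Y" "X = perp A e (other e \<gamma>) Y"
        using forced_rank2[OF c X e 3(1)] by blast
      have "u \<in> X" "v \<in> Y" using uv L(4)[OF no X] L(4)[OF no Y(1)] e(2) by auto
      then have "form_at A e (other e \<gamma>) v u = 0" using Y(2) by (simp add: perp_def)
      then show ?thesis by simp
    qed
  qed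
  \<comment> \<open>In a pair of opposite signs one end has the sign
    \<open>c (\<alpha>, \<beta>)\<close>; \<open>orth\<close> is applied from that end.\<close>
  have bil0: "bil (A \<alpha> \<beta>) u v = 0"
    if e: "(\<alpha>, \<beta>) \<in> I" and uv: "u \<in> L (Inl \<alpha>) s" "v \<in> L (Inr \<beta>) (opp s)" for \<alpha> \<beta> s u v
  proof (cases "s = c (\<alpha>, \<beta>)")
    case True
    then show ?thesis using orth[OF e, of "Inl \<alpha>" u v] uv by (simp add: form_at_def)
  next
    case False
    then have "s = opp (c (\<alpha>, \<beta>))" by (simp add: neq_iff_opp)
    then show ?thesis using orth[OF e, of "Inr \<beta>" v u] uv by (auto simp: form_at_def)
  qed
  have zero: "0 \<in> L \<gamma> s" for \<gamma> s
  proof -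
    obtain u where "L \<gamma> s = line u" using L(1)[of \<gamma> s] unfolding is_line_def by blast
    then show ?thesis by simp
  qed
  have img: "bil_image (A \<alpha> \<beta>) (L (Inl \<alpha>) s) (L (Inr \<beta>) (opp s)) = {0}" if "(\<alpha>, \<beta>) \<in> I" for \<alpha> \<beta> s
  proof -
    have "bil (A \<alpha> \<beta>) 0 0 = 0" by (simp add: bil_expand)
    then have "0 \<in> bil_image (A \<alpha> \<beta>) (L (Inl \<alpha>) s) (L (Inr \<beta>) (opp s))"
      using zero unfolding bil_image_def by (metis (mono_tags, lifting) mem_Collect_eq)
    moreover have "bil_image (A \<alpha> \<beta>) (L (Inl \<alpha>) s) (L (Inr \<beta>) (opp s)) \<subseteq> {0}"
      using bil0[OF that] by (auto simp: bil_image_def)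
    ultimately show ?thesis by blast
  qed
  have "valid_labeling A c I L"
    unfolding valid_labeling_def
  proof (intro conjI allI ballI)
    fix \<gamma> s show "vec.subspace (L \<gamma> s)" "vec.dim (L \<gamma> s) = 1" using L(1) is_line_iff by blast+
  next
    fix \<gamma> show "L \<gamma> Plus \<noteq> L \<gamma> Minus" by (rule L(2))
  next
    fix e assume e: "e \<in> I"
    obtain \<alpha> \<beta> where ab: "e = (\<alpha>, \<beta>)" by (cases e)
    have "ker_L (A \<alpha> \<beta>) = L (Inl \<alpha>) (c (\<alpha>, \<beta>)) \<and> ker_R (A \<alpha> \<beta>) = L (Inr \<beta>) (c (\<alpha>, \<beta>))"
      if r: "rank_edge A 1 (\<alpha>, \<beta>)"
      using rank1[of "(\<alpha>, \<beta>)" "Inl \<alpha>"] rank1[of "(\<alpha>, \<beta>)" "Inr \<beta>"] e r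
      unfolding ab kern_eq_ker by simp
    moreover have "bil_image (A \<alpha> \<beta>) (L (Inl \<alpha>) Plus) (L (Inr \<beta>) Minus) = {0}"
      "bil_image (A \<alpha> \<beta>) (L (Inl \<alpha>) Minus) (L (Inr \<beta>) Plus) = {0}"
      using img[of \<alpha> \<beta> Plus] img[of \<alpha> \<beta> Minus] e ab by simp_all
    ultimately show "case e of (\<alpha>, \<beta>) \<Rightarrow>
        bil_image (A \<alpha> \<beta>) (L (Inl \<alpha>) Plus) (L (Inr \<beta>) Minus) = {0} \<and>
        bil_image (A \<alpha> \<beta>) (L (Inl \<alpha>) Minus) (L (Inr \<beta>) Plus) = {0} \<and>
        (rank_edge A 1 (\<alpha>, \<beta>) \<longrightarrow>
           (ker_L (A \<alpha> \<beta>), ker_R (A \<alpha> \<beta>)) = (L (Inl \<alpha>) (c (\<alpha>, \<beta>)), L (Inr \<beta>) (c (\<alpha>, \<beta>))))"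
      by (simp add: ab)
  qed
  then show ?thesis unfolding cond_VL_def by blast
qed

section \<open>Components of graphs of maximum degree two\<close>

lemma adjacency_irrefl: "(\<gamma>, \<gamma>) \<notin> adjacency I"
  using other_neq by (metis adjacency_iff)

lemma adjacency_sym: "(\<gamma>, \<delta>) \<in> adjacency I \<Longrightarrow> (\<delta>, \<gamma>) \<in> adjacency I"
  using sym_adjacency by (rule symD)

lemma card_neighbours: "card (adjacency I `` {\<gamma>}) = deg I \<gamma>"
proof -
  have "adjacency I `` {\<gamma>} = (\<lambda>e. other e \<gamma>) ` {e \<in> I. \<gamma> \<in> ends e}"
    unfolding Image_singleton adjacency_iff by blast
  moreover have "inj_on (\<lambda>e. other e \<gamma>) {e \<in> I. \<gamma> \<in> ends e}"
  proof (rule inj_onI)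
    fix e f assume "e \<in> {e \<in> I. \<gamma> \<in> ends e}" "f \<in> {e \<in> I. \<gamma> \<in> ends e}" "other e \<gamma> = other f \<gamma>"
    then have "ends e = ends f" using ends_eq[of \<gamma> e] ends_eq[of \<gamma> f] by simp
    then show "e = f" by (rule ends_inject)
  qed
  ultimately show ?thesis by (simp add: deg_def card_image)
qed

lemma ends_component_edges:
  assumes "K \<in> components I"
  shows "ends ` component_edges I K = {{\<gamma>, \<delta>} | \<gamma> \<delta>. \<gamma> \<in> K \<and> (\<gamma>, \<delta>) \<in> adjacency I}"
proof (intro set_eqI iffI)
  fix x assume "x \<in> ends ` component_edges I K"
  then obtain e where e: "e \<in> I" "ends e \<subseteq> K" "x = ends e" by (auto simp: component_edges_def)
  have "Inl (fst e) \<in> K" using e(2) by (simp add: ends_def)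
  moreover have "(Inl (fst e), Inr (snd e)) \<in> adjacency I" using e(1) by (auto simp: adjacency_def ends_def)
  ultimately show "x \<in> {{\<gamma>, \<delta>} | \<gamma> \<delta>. \<gamma> \<in> K \<and> (\<gamma>, \<delta>) \<in> adjacency I}"
    unfolding e(3) ends_def by blast
next
  fix x assume "x \<in> {{\<gamma>, \<delta>} | \<gamma> \<delta>. \<gamma> \<in> K \<and> (\<gamma>, \<delta>) \<in> adjacency I}"
  then obtain \<gamma> \<delta> where x: "x = {\<gamma>, \<delta>}" "\<gamma> \<in> K" "(\<gamma>, \<delta>) \<in> adjacency I" by blast
  then obtain e where e: "e \<in> I" "\<gamma> \<in> ends e" "\<delta> = other e \<gamma>" by (auto simp: adjacency_iff)
  then have "ends e \<subseteq> K" using component_closed[OF assms] x(2) by blast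
  then show "x \<in> ends ` component_edges I K"
    using e x(1) ends_eq[OF e(2)] by (intro image_eqI[of _ _ e]) (simp_all add: component_edges_def)
qed

definition simple_walk :: "('m \<times> 'n) set \<Rightarrow> ('m + 'n) list \<Rightarrow> bool" where
  "simple_walk I vs \<longleftrightarrow> vs \<noteq> [] \<and> distinct vs \<and> (\<forall>i. Suc i < length vs \<longrightarrow> (vs ! i, vs ! Suc i) \<in> adjacency I)"

text \<open>A longest simple walk from \<open>\<gamma>\<close>: a neighbor of its last node outside
  the walk would extend it.\<close>

lemma maximal_simple_walk:
  fixes I :: "('m::finite \<times> 'n::finite) set"
  obtains vs where "simple_walk I vs" "hd vs = \<gamma>" "\<And>\<delta>. (last vs, \<delta>) \<in> adjacency I \<Longrightarrow> \<delta> \<in> set vs"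
proof -
  let ?P = "\<lambda>vs. simple_walk I vs \<and> hd vs = \<gamma>"
  have "?P [\<gamma>]" by (simp add: simple_walk_def)
  moreover have "\<forall>vs. ?P vs \<longrightarrow> length vs < Suc (card (UNIV :: ('m + 'n) set))"
    unfolding simple_walk_def by (metis card_mono distinct_card finite le_imp_less_Suc subset_UNIV)
  ultimately obtain vs where vs: "?P vs" "\<And>ws. ?P ws \<Longrightarrow> length ws \<le> length vs"
    using ex_has_greatest_nat[of ?P "[\<gamma>]" length] by blast
  have "\<delta> \<in> set vs" if d: "(last vs, \<delta>) \<in> adjacency I" for \<delta>
  proof (rule ccontr)
    assume n: "\<delta> \<notin> set vs"
    have "((vs @ [\<delta>]) ! i, (vs @ [\<delta>]) ! Suc i) \<in> adjacency I" if i: "Suc i < length (vs @ [\<delta>])" for i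
    proof (cases "Suc i < length vs")
      case True
      then show ?thesis using vs(1) by (simp add: simple_walk_def nth_append)
    next
      case False
      then have "Suc i = length vs" using i by simp
      moreover have "vs \<noteq> []" using vs(1) by (simp add: simple_walk_def)
      ultimately have "last vs = vs ! i" by (metis diff_Suc_1 last_conv_nth)
      then show ?thesis using d \<open>Suc i = length vs\<close> by (simp add: nth_append)
    qed
    then have "?P (vs @ [\<delta>])" using vs(1) n by (simp add: simple_walk_def)
    then show False using vs(2) by fastforce
  qed
  then show ?thesis using that vs(1) by blast
qed

lemma simple_walk_subset_component:
  assumes "simple_walk I vs"
  shows "set vs \<subseteq> (adjacency I)\<^sup>* `` {hd vs}"
proof -
  have "(vs ! 0, vs ! i) \<in> (adjacency I)\<^sup>*" if "i < length vs" for i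
    using that
  proof (induction i)
    case (Suc i)
    then have "(vs ! 0, vs ! i) \<in> (adjacency I)\<^sup>*" "(vs ! i, vs ! Suc i) \<in> adjacency I"
      using assms by (auto simp: simple_walk_def)
    then show ?case by (rule rtrancl_into_rtrancl)
  qed simp
  moreover have "hd vs = vs ! 0" using assms by (simp add: simple_walk_def hd_conv_nth)
  ultimately show ?thesis by (auto simp: in_set_conv_nth)
qed

lemma simple_walk_inner_neighbours:
  fixes I :: "('m::finite \<times> 'n::finite) set"
  assumes "simple_walk I vs" "cond_Deg I" "0 < i" "Suc i < length vs"
  shows "adjacency I `` {vs ! i} = {vs ! (i - 1), vs ! Suc i}"
proof (rule card_seteq[symmetric])
  have "(vs ! (i - 1), vs ! i) \<in> adjacency I"
    using assms(1,3,4) unfolding simple_walk_def by (metis Suc_diff_1 Suc_lessD)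
  moreover have "(vs ! i, vs ! Suc i) \<in> adjacency I" using assms by (simp add: simple_walk_def)
  ultimately show "{vs ! (i - 1), vs ! Suc i} \<subseteq> adjacency I `` {vs ! i}"
    using assms(3) adjacency_sym by auto
  have "vs ! (i - 1) \<noteq> vs ! Suc i" using assms by (simp add: simple_walk_def nth_eq_iff_index_eq)
  then have "card {vs ! (i - 1), vs ! Suc i} = 2" by simp
  then show "card (adjacency I `` {vs ! i}) \<le> card {vs ! (i - 1), vs ! Suc i}"
    using assms(2) by (simp add: card_neighbours cond_Deg_def)
qed simp

lemma component_of_node: "(adjacency I)\<^sup>* `` {\<gamma>} \<in> components I"
  by (auto simp: components_def intro: quotientI)

lemma component_eq_walk:
  assumes "simple_walk I vs" "\<And>i \<delta>. i < length vs \<Longrightarrow> (vs ! i, \<delta>) \<in> adjacency I \<Longrightarrow> \<delta> \<in> set vs"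
  shows "(adjacency I)\<^sup>* `` {hd vs} = set vs"
proof (rule antisym[OF _ simple_walk_subset_component[OF assms(1)]])
  show "(adjacency I)\<^sup>* `` {hd vs} \<subseteq> set vs"
  proof (rule component_subset)
    show "hd vs \<in> set vs" using assms(1) by (simp add: simple_walk_def)
    fix e \<delta> assume e: "e \<in> I" "\<delta> \<in> ends e" "\<delta> \<in> set vs"
    then obtain i where "i < length vs" "\<delta> = vs ! i" by (metis in_set_conv_nth)
    moreover have "(\<delta>, other e \<delta>) \<in> adjacency I" using e by (auto simp: adjacency_iff)
    ultimately show "other e \<delta> \<in> set vs" using assms(2) by blast
  qed
qed

text \<open>Along a maximal walk from a leaf all neighbors stay on the walk: the start has only one,
  inner nodes are saturated by degree 2, and the last node by maximality. Hence the walk exhausts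
  the component.\<close>

lemma path_component_of_leaf:
  fixes I :: "('m::finite \<times> 'n::finite) set"
  assumes Deg: "cond_Deg I" and leaf: "deg I \<gamma> = 1"
  shows "path_component I ((adjacency I)\<^sup>* `` {\<gamma>})"
proof -
  obtain vs where vs: "simple_walk I vs" "hd vs = \<gamma>" "\<And>\<delta>. (last vs, \<delta>) \<in> adjacency I \<Longrightarrow> \<delta> \<in> set vs"
    by (rule maximal_simple_walk[of I \<gamma>]) blast
  let ?n = "length vs"
  have ne: "vs \<noteq> []" and dist: "distinct vs" using vs(1) by (auto simp: simple_walk_def)
  have step: "(vs ! i, vs ! Suc i) \<in> adjacency I" if "Suc i < ?n" for i
    using vs(1) that by (simp add: simple_walk_def)
  have v0: "vs ! 0 = \<gamma>" using vs(2) ne by (simp add: hd_conv_nth)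
  have idx: "i = j" if "vs ! i = vs ! j" "i < ?n" "j < ?n" for i j
    using that dist by (simp add: nth_eq_iff_index_eq)
  have nb0: "\<delta> = vs ! 1" if "(vs ! 0, \<delta>) \<in> adjacency I" "?n > 1" for \<delta>
  proof -
    obtain x where x: "adjacency I `` {\<gamma>} = {x}"
      using leaf card_neighbours[of I \<gamma>] by (metis card_1_singletonE)
    have "\<delta> \<in> adjacency I `` {\<gamma>}" "vs ! 1 \<in> adjacency I `` {\<gamma>}" using that step[of 0] v0 by auto
    then show ?thesis unfolding x by simp
  qed
  have nb: "j = Suc i \<or> i = Suc j" if a: "(vs ! i, vs ! j) \<in> adjacency I" and i: "i < ?n" "j < ?n" "i < j" for i j
  proof (cases "i = 0")
    case True
    then have "vs ! j = vs ! 1" using nb0 a i by simp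
    then show ?thesis using idx[of j 1] i True by simp
  next
    case False
    then have "vs ! j \<in> {vs ! (i - 1), vs ! Suc i}"
      using simple_walk_inner_neighbours[OF vs(1) Deg, of i] a i by auto
    moreover have "vs ! j \<noteq> vs ! (i - 1)" using idx[of j "i - 1"] i by force
    ultimately show ?thesis using idx[of j "Suc i"] i by auto
  qed
  have nb': "j = Suc i \<or> i = Suc j" if a: "(vs ! i, vs ! j) \<in> adjacency I" and i: "i < ?n" "j < ?n" for i j
  proof -
    consider "i < j" | "i = j" | "j < i" by linarith
    then show ?thesis using nb[OF a i] nb[OF adjacency_sym[OF a] i(2,1)] a adjacency_irrefl by cases auto
  qed
  have closed: "\<delta> \<in> set vs" if i: "i < ?n" and a: "(vs ! i, \<delta>) \<in> adjacency I" for i \<delta>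
  proof -
    consider "Suc i = ?n" | "Suc i < ?n" "i = 0" | "Suc i < ?n" "0 < i" using i by linarith
    then show ?thesis
    proof cases
      case 1
      then have "vs ! i = last vs" using ne by (metis diff_Suc_1 last_conv_nth)
      then show ?thesis using vs(3) a by simp
    next
      case 2
      then have "\<delta> = vs ! 1" using nb0 a by simp
      then show ?thesis using 2 by simp
    next
      case 3
      then have "\<delta> \<in> {vs ! (i - 1), vs ! Suc i}"
        using simple_walk_inner_neighbours[OF vs(1) Deg, of i] a by blast
      then show ?thesis using 3 by auto
    qed
  qed
  let ?K = "(adjacency I)\<^sup>* `` {\<gamma>}"
  have K: "?K = set vs" using component_eq_walk[OF vs(1) closed] vs(2) by simp
  have "ends ` component_edges I ?K = {{vs ! i, vs ! Suc i} | i. Suc i < ?n}"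
    unfolding ends_component_edges[OF component_of_node]
  proof (intro set_eqI iffI)
    fix x assume "x \<in> {{\<gamma>', \<delta>} | \<gamma>' \<delta>. \<gamma>' \<in> ?K \<and> (\<gamma>', \<delta>) \<in> adjacency I}"
    then obtain \<gamma>' \<delta> where x: "x = {\<gamma>', \<delta>}" "\<gamma>' \<in> set vs" "(\<gamma>', \<delta>) \<in> adjacency I" unfolding K by blast
    then obtain i where i: "i < ?n" "\<gamma>' = vs ! i" by (metis in_set_conv_nth)
    then have "\<delta> \<in> set vs" using closed x by blast
    then obtain j where j: "j < ?n" "\<delta> = vs ! j" by (metis in_set_conv_nth)
    have "j = Suc i \<or> i = Suc j" using nb' x i j by blast
    then show "x \<in> {{vs ! i, vs ! Suc i} | i. Suc i < ?n}"
    proof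
      assume "j = Suc i" then show ?thesis using x i j by blast
    next
      assume "i = Suc j"
      then have "x = {vs ! j, vs ! Suc j}" "Suc j < ?n" using x i j by auto
      then show ?thesis by blast
    qed
  next
    fix x assume "x \<in> {{vs ! i, vs ! Suc i} | i. Suc i < ?n}"
    then obtain i where i: "x = {vs ! i, vs ! Suc i}" "Suc i < ?n" by blast
    then have "vs ! i \<in> ?K" unfolding K by simp
    then show "x \<in> {{\<gamma>', \<delta>} | \<gamma>' \<delta>. \<gamma>' \<in> ?K \<and> (\<gamma>', \<delta>) \<in> adjacency I}"
      using i step[OF i(2)] by blast
  qed
  then show ?thesis unfolding path_component_def
    using ne dist K component_of_node[of I \<gamma>] by (intro conjI exI[of _ vs]) simp_all
qed

text \<open>The last node of a maximal walk has a second neighbor, necessarily on the walk; as inner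
  nodes are saturated, it is the start and the walk closes up.\<close>

lemma cycle_component_of_regular:
  fixes I :: "('m::finite \<times> 'n::finite) set"
  assumes Deg: "cond_Deg I" and reg: "\<And>\<delta>. \<delta> \<in> (adjacency I)\<^sup>* `` {\<gamma>} \<Longrightarrow> deg I \<delta> = 2"
  shows "cycle_component I ((adjacency I)\<^sup>* `` {\<gamma>})"
proof -
  obtain vs where vs: "simple_walk I vs" "hd vs = \<gamma>" "\<And>\<delta>. (last vs, \<delta>) \<in> adjacency I \<Longrightarrow> \<delta> \<in> set vs"
    by (rule maximal_simple_walk[of I \<gamma>]) blast
  let ?n = "length vs"
  have ne: "vs \<noteq> []" and dist: "distinct vs" using vs(1) by (auto simp: simple_walk_def)
  have step: "(vs ! i, vs ! Suc i) \<in> adjacency I" if "Suc i < ?n" for i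
    using vs(1) that by (simp add: simple_walk_def)
  have n0: "0 < ?n" using ne by simp
  have lst: "last vs = vs ! (?n - 1)" using ne by (simp add: last_conv_nth)
  have idx: "i = j" if "vs ! i = vs ! j" "i < ?n" "j < ?n" for i j
    using that dist by (simp add: nth_eq_iff_index_eq)
  have card2: "card (adjacency I `` {vs ! i}) = 2" if "i < ?n" for i
  proof -
    have "vs ! i \<in> (adjacency I)\<^sup>* `` {\<gamma>}"
      using simple_walk_subset_component[OF vs(1)] vs(2) nth_mem[OF that] by blast
    then show ?thesis using reg card_neighbours[of I "vs ! i"] by simp
  qed
  have nb_last: "j = 0 \<or> Suc (Suc j) = ?n" if a: "(last vs, vs ! j) \<in> adjacency I" and j: "j < ?n" for j
  proof (rule ccontr)
    assume h: "\<not> (j = 0 \<or> Suc (Suc j) = ?n)"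
    have "j \<noteq> ?n - 1" using a adjacency_irrefl lst by metis
    then have j': "0 < j" "Suc j < ?n" using h j by auto
    have "vs ! (?n - 1) \<in> adjacency I `` {vs ! j}" using adjacency_sym[OF a] lst by simp
    then have "vs ! (?n - 1) \<in> {vs ! (j - 1), vs ! Suc j}"
      using simple_walk_inner_neighbours[OF vs(1) Deg j'] by simp
    moreover have "vs ! (?n - 1) \<noteq> vs ! (j - 1)" using idx[of "?n - 1" "j - 1"] j' by force
    moreover have "vs ! (?n - 1) \<noteq> vs ! Suc j" using idx[of "?n - 1" "Suc j"] j' h by force
    ultimately show False by blast
  qed
  have sub: "adjacency I `` {last vs} \<subseteq> {vs ! 0, vs ! (?n - 2)}"
  proof
    fix \<delta> assume "\<delta> \<in> adjacency I `` {last vs}"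
    then have a: "(last vs, \<delta>) \<in> adjacency I" by simp
    then obtain j where j: "j < ?n" "\<delta> = vs ! j" using vs(3) by (metis in_set_conv_nth)
    then have "j = 0 \<or> Suc (Suc j) = ?n" using nb_last a by blast
    then have "j = 0 \<or> j = ?n - 2" by linarith
    then show "\<delta> \<in> {vs ! 0, vs ! (?n - 2)}" using j by auto
  qed
  have cl: "card (adjacency I `` {last vs}) = 2" using card2[of "?n - 1"] n0 lst by simp
  have eq_last: "adjacency I `` {last vs} = {vs ! 0, vs ! (?n - 2)}"
    using cl by (intro card_seteq[OF _ sub]) (simp_all add: card_insert_if)
  then have "vs ! 0 \<noteq> vs ! (?n - 2)" using cl by auto
  \<comment> \<open>With at most two nodes truncated subtraction makes both positions 0, contrary to
    their difference.\<close>
  then have n2: "?n > 2" by (cases "?n > 2") auto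
  have closing: "(last vs, vs ! 0) \<in> adjacency I" using eq_last by blast
  have cstep: "(vs ! i, vs ! (Suc i mod ?n)) \<in> adjacency I" if "i < ?n" for i
  proof (cases "Suc i = ?n")
    case True
    then have "i = ?n - 1" by simp
    then show ?thesis using closing lst True by simp
  next
    case False
    then show ?thesis using step[of i] that by simp
  qed
  have nb: "\<delta> = vs ! (Suc i mod ?n) \<or> (\<exists>j<?n. \<delta> = vs ! j \<and> Suc j mod ?n = i)"
    if i: "i < ?n" and a: "(vs ! i, \<delta>) \<in> adjacency I" for i \<delta>
  proof -
    define k where "k = (if i = 0 then ?n - 1 else i - 1)"
    have k: "k < ?n" "Suc k mod ?n = i" "k \<noteq> Suc i mod ?n"
      using i n2 by (auto simp: k_def mod_Suc)
    have m: "Suc i mod ?n < ?n" using n0 by simp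
    have "{vs ! (Suc i mod ?n), vs ! k} \<subseteq> adjacency I `` {vs ! i}"
      using cstep[OF i] adjacency_sym[OF cstep[OF k(1)]] k(2) by auto
    moreover have "vs ! (Suc i mod ?n) \<noteq> vs ! k" using idx[OF _ m k(1)] k(3) by metis
    ultimately have "adjacency I `` {vs ! i} = {vs ! (Suc i mod ?n), vs ! k}"
      using card2[OF i] by (intro card_seteq[symmetric]) auto
    then have "\<delta> \<in> {vs ! (Suc i mod ?n), vs ! k}" using a by blast
    then show ?thesis using k by auto
  qed
  have closed: "\<delta> \<in> set vs" if i: "i < ?n" and a: "(vs ! i, \<delta>) \<in> adjacency I" for i \<delta>
    using nb[OF i a] n0 by (metis mod_less_divisor nth_mem)
  let ?K = "(adjacency I)\<^sup>* `` {\<gamma>}"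
  have K: "?K = set vs" using component_eq_walk[OF vs(1) closed] vs(2) by simp
  have "ends ` component_edges I ?K = {{vs ! i, vs ! (Suc i mod ?n)} | i. i < ?n}"
    unfolding ends_component_edges[OF component_of_node]
  proof (intro set_eqI iffI)
    fix x assume "x \<in> {{\<gamma>', \<delta>} | \<gamma>' \<delta>. \<gamma>' \<in> ?K \<and> (\<gamma>', \<delta>) \<in> adjacency I}"
    then obtain \<gamma>' \<delta> where x: "x = {\<gamma>', \<delta>}" "\<gamma>' \<in> set vs" "(\<gamma>', \<delta>) \<in> adjacency I" unfolding K by blast
    then obtain i where i: "i < ?n" "\<gamma>' = vs ! i" by (metis in_set_conv_nth)
    have "\<delta> = vs ! (Suc i mod ?n) \<or> (\<exists>j<?n. \<delta> = vs ! j \<and> Suc j mod ?n = i)" using nb x i by blast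
    then show "x \<in> {{vs ! i, vs ! (Suc i mod ?n)} | i. i < ?n}"
    proof
      assume "\<delta> = vs ! (Suc i mod ?n)" then show ?thesis using x i by blast
    next
      assume "\<exists>j<?n. \<delta> = vs ! j \<and> Suc j mod ?n = i"
      then obtain j where j: "j < ?n" "\<delta> = vs ! j" "Suc j mod ?n = i" by blast
      then have "x = {vs ! j, vs ! (Suc j mod ?n)}" using x i by auto
      then show ?thesis using j(1) by blast
    qed
  next
    fix x assume "x \<in> {{vs ! i, vs ! (Suc i mod ?n)} | i. i < ?n}"
    then obtain i where i: "x = {vs ! i, vs ! (Suc i mod ?n)}" "i < ?n" by blast
    then have "vs ! i \<in> ?K" unfolding K by simp
    then show "x \<in> {{\<gamma>', \<delta>} | \<gamma>' \<delta>. \<gamma>' \<in> ?K \<and> (\<gamma>', \<delta>) \<in> adjacency I}"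
      using i cstep[OF i(2)] by blast
  qed
  then show ?thesis unfolding cycle_component_def
    using n2 dist K component_of_node[of I \<gamma>] by (intro conjI exI[of _ vs]) simp_all
qed

section \<open>Sufficiency of the conditions\<close>

lemma bil_in_ker_L:
  assumes "indep2 v w" "bil B u v = 0" "bil B u w = 0"
  shows "u \<in> ker_L B"
proof -
  define p where "p = u $ 1 * B $ 1 $ 1 + u $ 2 * B $ 2 $ 1"
  define q where "q = u $ 1 * B $ 1 $ 2 + u $ 2 * B $ 2 $ 2"
  have bil: "bil B u x = p * x $ 1 + q * x $ 2" for x
    by (simp add: bil_expand p_def q_def algebra_simps)
  define d where "d = v $ 1 * w $ 2 - v $ 2 * w $ 1"
  have "p * d = (p * v $ 1 + q * v $ 2) * w $ 2 - (p * w $ 1 + q * w $ 2) * v $ 2"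
    "q * d = (p * w $ 1 + q * w $ 2) * v $ 1 - (p * v $ 1 + q * v $ 2) * w $ 1"
    by (simp_all add: d_def algebra_simps)
  then have "p * d = 0" "q * d = 0" using assms(2,3) by (simp_all add: bil)
  moreover have "d \<noteq> 0" using assms(1) by (simp add: d_def indep2_def)
  ultimately have "p = 0" "q = 0" by simp_all
  then show ?thesis by (simp add: ker_L_def bil)
qed

lemma ker_L_rank2:
  assumes "rank B = 2" "u \<in> ker_L B" shows "u = 0"
proof -
  have "bil B u (vector [1, 0]) = 0" "bil B u (vector [0, 1]) = 0" using assms(2) by (simp_all add: ker_L_def)
  then have pq: "u $ 1 * B $ 1 $ 1 + u $ 2 * B $ 2 $ 1 = 0" "u $ 1 * B $ 1 $ 2 + u $ 2 * B $ 2 $ 2 = 0"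
    by (simp_all add: bil_expand)
  have "u $ 1 * det B = B $ 2 $ 2 * (u $ 1 * B $ 1 $ 1 + u $ 2 * B $ 2 $ 1) - B $ 2 $ 1 * (u $ 1 * B $ 1 $ 2 + u $ 2 * B $ 2 $ 2)"
    "u $ 2 * det B = B $ 1 $ 1 * (u $ 1 * B $ 1 $ 2 + u $ 2 * B $ 2 $ 2) - B $ 1 $ 2 * (u $ 1 * B $ 1 $ 1 + u $ 2 * B $ 2 $ 1)"
    by (simp_all add: det_2 algebra_simps)
  then have "u $ 1 * det B = 0" "u $ 2 * det B = 0" unfolding pq by simp_all
  then show ?thesis using assms(1) by (simp add: rank2_iff vec2_eq_iff)
qed

text \<open>(Cycle) is kept apart and assumed where an edge is deleted.\<close>

locale labeled_graph =
  fixes A :: "'m::{finite,linorder} \<Rightarrow> 'n::{finite,linorder} \<Rightarrow> 'f::field^2^2"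
    and I :: "('m \<times> 'n) set" and c :: "'m \<times> 'n \<Rightarrow> polarity" and L :: "'m + 'n \<Rightarrow> polarity \<Rightarrow> ('f^2) set"
  assumes sub: "I \<subseteq> edges A" and Deg: "cond_Deg I" and proper: "proper_coloring I c"
    and Path: "cond_Path A I" and VL: "valid_labeling A c I L"
begin

text \<open>The component of a leaf is a path, so (Path) admits a rank-2 edge at the leaf only as an
  isolated edge.\<close>

lemma leaf_isolated:
  assumes e: "e \<in> I" "rank_edge A 2 e" "\<gamma> \<in> ends e" "deg I \<gamma> = 1"
  shows "isolated I e"
proof -
  let ?K = "(adjacency I)\<^sup>* `` {\<gamma>}"
  have K: "path_component I ?K" by (rule path_component_of_leaf[OF Deg e(4)])
  have "ends e \<subseteq> ?K" using component_closed[OF component_of_node e(1,3)] by blast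
  then have eK: "e \<in> component_edges I ?K" using e(1) by (simp add: component_edges_def)
  show ?thesis
  proof (cases "\<exists>f. isolated I f \<and> component_edges I ?K = {f}")
    case True
    then show ?thesis using eK by auto
  next
    case False
    have "deg I (Inl (fst e)) = 1 \<or> deg I (Inr (snd e)) = 1" using e(3,4) by (auto simp: ends_def)
    then have "end_edge I ?K e" using eK by (simp add: end_edge_def)
    then have "rank_edge A 1 e" using Path K False unfolding cond_Path_def by blast
    then show ?thesis using rank_edge_exclusive e(2) by blast
  qed
qed

lemma rank2_other_edge:
  assumes e: "e \<in> I" "rank_edge A 2 e" "\<not> isolated I e" "\<gamma> \<in> ends e"
  shows "\<exists>f\<in>I. \<gamma> \<in> ends f \<and> c f = opp (c e)"
proof -
  have "deg I \<gamma> \<noteq> 1" using leaf_isolated e by blast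
  then obtain f where f: "f \<in> I" "\<gamma> \<in> ends f" "f \<noteq> e" using deg_eq_1I[OF e(1,4)] by blast
  then have "c f \<noteq> c e" using color_unique[OF proper f(1) e(1) f(2) e(4)] by blast
  then show ?thesis using f by (auto simp: neq_iff_opp)
qed

section \<open>Diagonalization by a valid labeling\<close>

definition idx :: "polarity \<Rightarrow> 2" where
  "idx s = (case s of Plus \<Rightarrow> 1 | Minus \<Rightarrow> 2)"

lemma idx_cases: "i = idx Plus \<or> i = idx Minus"
  using exhaust_2[of i] by (auto simp: idx_def)

lemma idx_inject [simp]: "idx s = idx t \<longleftrightarrow> s = t"
  by (cases s; cases t) (auto simp: idx_def)

lemma L_line: "is_line (L \<gamma> s)"
  using VL unfolding valid_labeling_def is_line_iff by blast

lemma labeled: "\<forall>(\<alpha>, \<beta>)\<in>I.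
    bil_image (A \<alpha> \<beta>) (L (Inl \<alpha>) Plus) (L (Inr \<beta>) Minus) = {0} \<and>
    bil_image (A \<alpha> \<beta>) (L (Inl \<alpha>) Minus) (L (Inr \<beta>) Plus) = {0} \<and>
    (rank_edge A 1 (\<alpha>, \<beta>) \<longrightarrow>
       (ker_L (A \<alpha> \<beta>), ker_R (A \<alpha> \<beta>)) = (L (Inl \<alpha>) (c (\<alpha>, \<beta>)), L (Inr \<beta>) (c (\<alpha>, \<beta>))))"
  using VL unfolding valid_labeling_def by (rule conjunct2)

lemma L_kern:
  assumes "e \<in> I" "rank_edge A 1 e" shows "ker_L (A (fst e) (snd e)) = L (Inl (fst e)) (c e)"
proof -
  have "case e of (\<alpha>, \<beta>) \<Rightarrow> rank_edge A 1 (\<alpha>, \<beta>) \<longrightarrow>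
     (ker_L (A \<alpha> \<beta>), ker_R (A \<alpha> \<beta>)) = (L (Inl \<alpha>) (c (\<alpha>, \<beta>)), L (Inr \<beta>) (c (\<alpha>, \<beta>)))"
    using bspec[OF labeled assms(1)] by (cases e) simp
  then show ?thesis using assms(2) by (cases e) simp
qed

lemma L_bil:
  assumes "e \<in> I" "u \<in> L (Inl (fst e)) s" "v \<in> L (Inr (snd e)) (opp s)"
  shows "bil (A (fst e) (snd e)) u v = 0"
proof -
  have "case e of (\<alpha>, \<beta>) \<Rightarrow>
      bil_image (A \<alpha> \<beta>) (L (Inl \<alpha>) Plus) (L (Inr \<beta>) Minus) = {0} \<and>
      bil_image (A \<alpha> \<beta>) (L (Inl \<alpha>) Minus) (L (Inr \<beta>) Plus) = {0}"
    using bspec[OF labeled assms(1)] by (cases e) simp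
  then have "bil_image (A (fst e) (snd e)) (L (Inl (fst e)) s) (L (Inr (snd e)) (opp s)) = {0}"
    by (cases e; cases s) simp_all
  moreover have "bil (A (fst e) (snd e)) u v \<in> bil_image (A (fst e) (snd e)) (L (Inl (fst e)) s) (L (Inr (snd e)) (opp s))"
    using assms(2,3) unfolding bil_image_def by blast
  ultimately show ?thesis by blast
qed

definition gen :: "'m + 'n \<Rightarrow> polarity \<Rightarrow> 'f^2" where
  "gen \<gamma> s = (SOME u. u \<noteq> 0 \<and> L \<gamma> s = line u)"

lemma gen: "gen \<gamma> s \<noteq> 0" "L \<gamma> s = line (gen \<gamma> s)"
proof -
  have "\<exists>u. u \<noteq> 0 \<and> L \<gamma> s = line u" using L_line unfolding is_line_def .
  then have "gen \<gamma> s \<noteq> 0 \<and> L \<gamma> s = line (gen \<gamma> s)" unfolding gen_def by (rule someI_ex)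
  then show "gen \<gamma> s \<noteq> 0" "L \<gamma> s = line (gen \<gamma> s)" by blast+
qed

lemma gen_in_L: "gen \<gamma> s \<in> L \<gamma> s"
  by (simp add: gen(2))

lemma gen_indep: "indep2 (gen \<gamma> s) (gen \<gamma> (opp s))"
proof -
  have "L \<gamma> Plus \<noteq> L \<gamma> Minus" using VL unfolding valid_labeling_def by blast
  then have "L \<gamma> s \<noteq> L \<gamma> (opp s)" by (cases s) auto
  then show ?thesis using line_neq_iff_indep2[OF gen(1) gen(1)] gen(2) by metis
qed

definition basis :: "'m + 'n \<Rightarrow> 2 \<Rightarrow> 'f^2" where
  "basis \<gamma> i = (if i = 1 then gen \<gamma> Plus else gen \<gamma> Minus)"

lemma basis_idx [simp]: "basis \<gamma> (idx s) = gen \<gamma> s"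
  by (cases s) (auto simp: basis_def idx_def)

definition A' :: "'m \<Rightarrow> 'n \<Rightarrow> 'f^2^2" where
  "A' = in_basis basis A"

definition part :: "polarity \<Rightarrow> ('m \<times> 'n) set \<Rightarrow> 'm \<times> 2 \<Rightarrow> 'n \<times> 2 \<Rightarrow> 'f" where
  "part s J p q = (if snd p = idx s \<and> snd q = idx s then keep_blocks J (entry A') p q else 0)"

lemma rank_on_A': "rank_on A' J = rank_on A J"
  unfolding A'_def using gen_indep[of _ Plus] by (intro rank_on_in_basis) (simp add: basis_def)

lemma A'_entry: "A' \<alpha> \<beta> $ idx s $ idx t = bil (A \<alpha> \<beta>) (gen (Inl \<alpha>) s) (gen (Inr \<beta>) t)"
  by (simp add: A'_def in_basis_def)

lemma A'_off_diagonal: "e \<in> I \<Longrightarrow> A' (fst e) (snd e) $ idx s $ idx (opp s) = 0"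
  unfolding A'_entry by (rule L_bil[OF _ gen_in_L gen_in_L])

text \<open>The off-diagonal position vanishes anyway and the generators at the right end form a
  basis, so a zero here puts the left generator of sign \<open>s\<close> into the left kernel. This
  excludes rank 2, and for rank 1 the kernel is the line of sign \<open>c e\<close>.\<close>

lemma A'_diagonal:
  assumes e: "e \<in> I"
  shows "A' (fst e) (snd e) $ idx s $ idx s = 0 \<longleftrightarrow> rank_edge A 1 e \<and> c e = s"
proof
  assume "rank_edge A 1 e \<and> c e = s"
  then have "gen (Inl (fst e)) s \<in> ker_L (A (fst e) (snd e))" using L_kern e gen_in_L by metis
  then show "A' (fst e) (snd e) $ idx s $ idx s = 0" unfolding A'_entry ker_L_def by blast
next
  let ?u = "gen (Inl (fst e)) s"
  assume "A' (fst e) (snd e) $ idx s $ idx s = 0"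
  then have "?u \<in> ker_L (A (fst e) (snd e))"
    using A'_off_diagonal[OF e, of s] bil_in_ker_L[OF gen_indep] unfolding A'_entry by blast
  moreover have "?u \<noteq> 0" by (rule gen)
  ultimately have "\<not> rank_edge A 2 e" using ker_L_rank2 unfolding rank_edge_def by blast
  then have r: "rank_edge A 1 e" using edge_rank_cases sub e by blast
  have "c e = s"
  proof (rule ccontr)
    assume "c e \<noteq> s"
    then have "c e = opp s" by (simp add: neq_iff_opp)
    then have "?u \<in> line (gen (Inl (fst e)) (opp s))"
      using \<open>?u \<in> ker_L _\<close> L_kern[OF e r] gen(2) by metis
    then have "line ?u = line (gen (Inl (fst e)) (opp s))"
      using line_subset_eq line_mono gen(1) unfolding is_line_def by metis
    then show False using line_neq_iff_indep2[OF gen(1) gen(1)] gen_indep by metis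
  qed
  then show "rank_edge A 1 e \<and> c e = s" using r by blast
qed

lemma rank_on_parts:
  assumes "J \<subseteq> I"
  shows "rank_on A J = rank (gmat (part s J)) + rank (gmat (part (opp s) J))"
proof -
  have "part s J p q + part (opp s) J p q = keep_blocks J (entry A') p q" for p q
  proof (cases "(fst p, fst q) \<in> J")
    case True
    then have "(fst p, fst q) \<in> I" using assms by blast
    from A'_off_diagonal[OF this, of s] A'_off_diagonal[OF this, of "opp s"]
    have off: "entry A' p q = 0" if "snd p = idx t" "snd q = idx (opp t)" for t
      using that by (cases "t = s") (auto simp: entry_def neq_iff_opp)
    obtain t t' where t: "snd p = idx t" "snd q = idx t'" using idx_cases by metis
    show ?thesis
    proof (cases "t = t'")
      case True
      then show ?thesis using t by (cases "t = s") (auto simp: part_def neq_iff_opp)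
    next
      case False
      then have "t' = opp t" by (metis neq_iff_opp)
      then show ?thesis using off t False by (auto simp: part_def keep_blocks_def)
    qed
  next
    case False
    then show ?thesis by (simp add: part_def keep_blocks_def)
  qed
  then have "(\<lambda>p q. part s J p q + part (opp s) J p q) = keep_blocks J (entry A')" by (intro ext)
  then have eq: "gmat (keep_blocks J (entry A')) = gmat (part s J) + gmat (part (opp s) J)"
    by (simp only: gmat_add[symmetric])
  have "rank (gmat (part s J)) + rank (gmat (part (opp s) J)) \<le> rank (gmat (part s J) + gmat (part (opp s) J))"
  proof (rule rank_direct_sum_ge[where P = "{p. snd p = idx s}" and Q = "{q. snd q = idx s}"])
    fix p q assume "gmat (part s J) $ p $ q \<noteq> 0"
    then have "part s J p q \<noteq> 0" by (rule gmat_nonzeroD)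
    then show "p \<in> {p. snd p = idx s} \<and> q \<in> {q. snd q = idx s}" by (simp add: part_def split: if_splits)
  next
    fix p q assume "gmat (part (opp s) J) $ p $ q \<noteq> 0"
    then have "part (opp s) J p q \<noteq> 0" by (rule gmat_nonzeroD)
    then show "p \<notin> {p. snd p = idx s} \<and> q \<notin> {q. snd q = idx s}" by (simp add: part_def split: if_splits)
  qed
  then have "rank (gmat (keep_blocks J (entry A'))) = rank (gmat (part s J)) + rank (gmat (part (opp s) J))"
    unfolding eq by (rule antisym[OF rank_add_le])
  then show ?thesis using rank_on_A'[of J] unfolding rank_on_gmat by simp
qed

text \<open>
  The rank-1 edges of sign \<open>s\<close> vanish in part \<open>s\<close>, so the edges of the opposite sign, together with
  the isolated rank-2 edges of sign \<open>s\<close>, form a maximum matching there.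
\<close>

definition D :: "polarity \<Rightarrow> ('m \<times> 'n) set" where
  "D s = {e \<in> I. c e = opp s \<or> isolated I e \<and> rank_edge A 2 e}"

lemma D_inj: "inj_on fst (D s)" "inj_on snd (D s)"
proof -
  have *: "e = f" if "e \<in> D s" "f \<in> D s" "\<gamma> \<in> ends e" "\<gamma> \<in> ends f" for e f \<gamma>
  proof (cases "isolated I e \<or> isolated I f")
    case True
    then show ?thesis using that unfolding isolated_iff D_def by blast
  next
    case False
    then have "c e = c f" using that by (auto simp: D_def)
    then show ?thesis using color_unique[OF proper _ _ that(3,4)] that(1,2) by (auto simp: D_def)
  qed
  show "inj_on fst (D s)"
  proof (rule inj_onI)
    fix e f assume "e \<in> D s" "f \<in> D s" "fst e = fst f"
    then show "e = f" using *[of e f "Inl (fst e)"] by simp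
  qed
  show "inj_on snd (D s)"
  proof (rule inj_onI)
    fix e f assume "e \<in> D s" "f \<in> D s" "snd e = snd f"
    then show "e = f" using *[of e f "Inr (snd e)"] by simp
  qed
qed

text \<open>Every edge lies in the set \<open>D\<close> of the sign opposite to its color; isolated
  rank-2 edges also lie in the other one, which is their second count in
  \<open>r_val\<close>.\<close>

lemma r_val_D: "r_val A I = card (D s) + card (D (opp s))"
proof -
  let ?iso = "\<lambda>t. {e \<in> I. c e = t \<and> isolated I e \<and> rank_edge A 2 e}"
  have D: "card (D t) = card {e \<in> I. c e = opp t} + card (?iso t)" for t
  proof -
    have "D t = {e \<in> I. c e = opp t} \<union> ?iso t"
      using neq_iff_opp[of _ t] by (auto simp: D_def)
    moreover have "{e \<in> I. c e = opp t} \<inter> ?iso t = {}" by auto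
    ultimately show ?thesis by (simp add: card_Un_disjoint)
  qed
  have "I = {e \<in> I. c e = s} \<union> {e \<in> I. c e = opp s}" using neq_iff_opp[of _ s] by auto
  then have "card I = card {e \<in> I. c e = s} + card {e \<in> I. c e = opp s}"
    by (subst card_Un_disjoint[symmetric]) auto
  moreover have "{e. isolated I e \<and> rank_edge A 2 e} = ?iso s \<union> ?iso (opp s)"
    using neq_iff_opp[of _ s] by (auto simp: isolated_def)
  then have "card {e. isolated I e \<and> rank_edge A 2 e} = card (?iso s) + card (?iso (opp s))"
    by (simp add: card_Un_disjoint disjoint_iff)
  ultimately show ?thesis by (simp add: r_val_def D)
qed

lemma part_D_nonzero: "e \<in> D s \<Longrightarrow> part s I (fst e, idx s) (snd e, idx s) \<noteq> 0"
proof -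
  assume e: "e \<in> D s"
  then have eI: "e \<in> I" by (simp add: D_def)
  have "\<not> (rank_edge A 1 e \<and> c e = s)" using e rank_edge_exclusive[of A e] by (auto simp: D_def)
  then have "A' (fst e) (snd e) $ idx s $ idx s \<noteq> 0" using A'_diagonal[OF eI] by blast
  then show ?thesis using eI by (simp add: part_def keep_blocks_def entry_def)
qed

lemma rank_on_ge: "r_val A I \<le> rank_on A I"
proof -
  have "card (D t) \<le> rank (gmat (part t I))" for t
    using D_inj part_D_nonzero by (intro rank_gmat_ge_edges[where k = "idx t"]) auto
  from this[of Plus] this[of "opp Plus"] show ?thesis
    using r_val_D[of Plus] rank_on_parts[of I Plus] by simp
qed

lemma part_nonzeroD:
  assumes "gmat (part s J) $ p $ q \<noteq> 0" "J \<subseteq> I"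
  obtains g where "g \<in> J" "p = (fst g, idx s)" "q = (snd g, idx s)"
    "g \<in> D s \<or> c g = s \<and> rank_edge A 2 g \<and> \<not> isolated I g"
proof -
  define g where "g = (fst p, fst q)"
  have nz: "part s J p q \<noteq> 0" using assms(1) by (rule gmat_nonzeroD)
  then have g: "g \<in> J" "snd p = idx s" "snd q = idx s" "A' (fst g) (snd g) $ idx s $ idx s \<noteq> 0"
    by (auto simp: part_def keep_blocks_def g_def entry_def split: if_splits)
  have gI: "g \<in> I" using g(1) assms(2) by blast
  have "\<not> (rank_edge A 1 g \<and> c g = s)" using A'_diagonal[OF gI] g(4) by blast
  then have "g \<in> D s \<or> c g = s \<and> rank_edge A 2 g \<and> \<not> isolated I g"
    using gI edge_rank_cases[of g A] sub neq_iff_opp[of "c g" s] unfolding D_def by blast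
  moreover have "p = (fst g, idx s)" "q = (snd g, idx s)" using g(2,3) by (simp_all add: g_def prod_eq_iff)
  ultimately show ?thesis using that[OF g(1)] by blast
qed

lemma other_end_in_D:
  assumes "g \<in> I" "c g = s" "rank_edge A 2 g" "\<not> isolated I g" "\<gamma> \<in> ends g"
  shows "\<exists>f\<in>D s. \<gamma> \<in> ends f \<and> c f = opp s"
  using rank2_other_edge[OF assms(1,3,4,5)] assms(2) by (auto simp: D_def)

text \<open>The left ends of \<open>D s\<close> cover all nonzero positions: a rank-2 edge outside
  \<open>D s\<close> shares its left end with an edge of the other color.\<close>

lemma rank_part_le:
  assumes "J \<subseteq> I"
  shows "rank (gmat (part s J)) \<le> card (D s)"
proof -
  have "rank (gmat (part s J)) \<le> card ((\<lambda>e. (fst e, idx s)) ` D s)"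
  proof (rule rank_le_rows)
    fix p q assume "gmat (part s J) $ p $ q \<noteq> 0"
    then obtain g where g: "g \<in> J" "p = (fst g, idx s)"
      "g \<in> D s \<or> c g = s \<and> rank_edge A 2 g \<and> \<not> isolated I g"
      using part_nonzeroD assms by metis
    show "p \<in> (\<lambda>e. (fst e, idx s)) ` D s"
    proof (cases "g \<in> D s")
      case True
      then show ?thesis using g(2) by blast
    next
      case False
      then obtain f where "f \<in> D s" "Inl (fst g) \<in> ends f"
        using other_end_in_D[of g s "Inl (fst g)"] g(1,3) assms by (meson in_ends_iff(1) subset_iff)
      then show ?thesis unfolding g(2) by (intro image_eqI[of _ _ f]) simp_all
    qed
  qed
  also have "\<dots> \<le> card (D s)" by (simp add: card_image_le)
  finally show ?thesis .
qed

lemma rank_on_eq: "rank_on A I = r_val A I"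
  using rank_on_ge rank_on_parts[of I Plus] rank_part_le[of I Plus] rank_part_le[of I "opp Plus"]
    r_val_D[of Plus] by simp

text \<open>Alternating steps relative to the matching \<open>D s\<close>: from the left end of
  \<open>f\<close> along a nonmatching rank-2 edge to the right end of \<open>f'\<close>.\<close>

definition nxt :: "polarity \<Rightarrow> (('m \<times> 'n) \<times> ('m \<times> 'n)) set" where
  "nxt s = {(f, f'). f \<in> I \<and> f' \<in> I \<and> c f = opp s \<and> c f' = opp s \<and>
     (\<exists>g\<in>I. c g = s \<and> rank_edge A 2 g \<and> fst g = fst f \<and> snd g = snd f')}"

lemma nxt_functional: "(f, f') \<in> nxt s \<Longrightarrow> (f, f'') \<in> nxt s \<Longrightarrow> f' = f''"
proof -
  assume "(f, f') \<in> nxt s" "(f, f'') \<in> nxt s"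
  then obtain g h where gh: "f' \<in> I" "f'' \<in> I" "c f' = opp s" "c f'' = opp s"
    "g \<in> I" "c g = s" "fst g = fst f" "snd g = snd f'"
    "h \<in> I" "c h = s" "fst h = fst f" "snd h = snd f''"
    unfolding nxt_def by blast
  then have "g = h" using color_unique[OF proper, of g h "Inl (fst f)"] by simp
  then show "f' = f''" using gh color_unique[OF proper, of f' f'' "Inr (snd g)"] by simp
qed

text \<open>All nodes on a closed alternating walk carry a rank-2 edge of color \<open>s\<close> and
  an edge of the other color. They contain a whole cycle component without rank-1 edges of color
  \<open>s\<close>, contrary to (Cycle).\<close>

lemma nxt_acyclic:
  assumes Cycle: "cond_Cycle A c I"
  shows "(e, e) \<notin> (nxt s)\<^sup>+"
proof
  assume cyc: "(e, e) \<in> (nxt s)\<^sup>+"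
  define S where "S = (nxt s)\<^sup>* `` {e}"
  \<comment> \<open>As \<open>nxt\<close> is functional, everything reachable from \<open>e\<close>
    leads back to \<open>e\<close>; thus each member of \<open>S\<close> has a successor and a
    predecessor in \<open>S\<close>.\<close>
  have ret: "(f, e) \<in> (nxt s)\<^sup>+" if "(e, f) \<in> (nxt s)\<^sup>*" for f
    using that
  proof (induction rule: rtrancl_induct)
    case base
    then show ?case by (rule cyc)
  next
    case (step f f')
    obtain h where h: "(f, h) \<in> nxt s" "(h, e) \<in> (nxt s)\<^sup>*" using step.IH by (meson tranclD)
    then have "h = f'" using step.hyps(2) nxt_functional by blast
    then have "(f', e) \<in> (nxt s)\<^sup>*" using h by simp
    then show ?case using cyc by (rule rtrancl_trancl_trancl)
  qed
  have succ: "\<exists>f'\<in>S. (f, f') \<in> nxt s" if f: "f \<in> S" for f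
  proof -
    have ef: "(e, f) \<in> (nxt s)\<^sup>*" using f by (simp add: S_def)
    then obtain h where "(f, h) \<in> nxt s" using ret by (meson tranclD)
    then show ?thesis using ef by (auto simp: S_def intro: rtrancl_into_rtrancl)
  qed
  have pred: "\<exists>f'\<in>S. (f', f) \<in> nxt s" if f: "f \<in> S" for f
  proof -
    have "(e, f) \<in> (nxt s)\<^sup>+" using f cyc by (auto simp: S_def rtrancl_eq_or_trancl)
    then obtain h where "(e, h) \<in> (nxt s)\<^sup>*" "(h, f) \<in> nxt s" by (meson tranclD2)
    then show ?thesis by (auto simp: S_def)
  qed
  define K where "K = {\<gamma>. \<exists>f\<in>S. \<gamma> \<in> ends f}"
  have S_I: "f \<in> I \<and> c f = opp s" if "f \<in> S" for f using succ[OF that] by (auto simp: nxt_def)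
  have K_s: "\<exists>g\<in>I. \<gamma> \<in> ends g \<and> c g = s \<and> rank_edge A 2 g \<and> ends g \<subseteq> K" if \<gamma>: "\<gamma> \<in> K" for \<gamma>
  proof -
    obtain f where f: "f \<in> S" "\<gamma> \<in> ends f" using \<gamma> by (auto simp: K_def)
    have key: "\<exists>g\<in>I. c g = s \<and> rank_edge A 2 g \<and> fst g = fst h \<and> snd g = snd h' \<and> ends g \<subseteq> K"
      if h: "(h, h') \<in> nxt s" "h \<in> S" "h' \<in> S" for h h'
    proof -
      obtain g where g: "g \<in> I" "c g = s" "rank_edge A 2 g" "fst g = fst h" "snd g = snd h'"
        using h(1) unfolding nxt_def by blast
      have "Inl (fst g) \<in> ends h" "Inr (snd g) \<in> ends h'" using g by simp_all
      then have "ends g \<subseteq> K" using h(2,3) unfolding K_def ends_def[of g] by blast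
      then show ?thesis using g by blast
    qed
    show ?thesis
    proof (cases \<gamma>)
      case (Inl \<alpha>)
      obtain f' where "f' \<in> S" "(f, f') \<in> nxt s" using succ[OF f(1)] by blast
      then obtain g where "g \<in> I" "c g = s" "rank_edge A 2 g" "fst g = fst f" "ends g \<subseteq> K"
        using key f(1) by blast
      then show ?thesis using f(2) Inl by (intro bexI[of _ g]) simp_all
    next
      case (Inr \<beta>)
      obtain f' where "f' \<in> S" "(f', f) \<in> nxt s" using pred[OF f(1)] by blast
      then obtain g where "g \<in> I" "c g = s" "rank_edge A 2 g" "snd g = snd f" "ends g \<subseteq> K"
        using key f(1) by blast
      then show ?thesis using f(2) Inr by (intro bexI[of _ g]) simp_all
    qed
  qed
  have K_opp: "\<exists>g\<in>I. \<gamma> \<in> ends g \<and> c g = opp s \<and> ends g \<subseteq> K" if "\<gamma> \<in> K" for \<gamma>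
    using that S_I by (force simp: K_def)
  define C where "C = (adjacency I)\<^sup>* `` {Inl (fst e)}"
  have C: "C \<subseteq> K" unfolding C_def
  proof (rule component_subset)
    have "e \<in> S" by (simp add: S_def)
    then show "Inl (fst e) \<in> K" unfolding K_def by (intro CollectI bexI[of _ e]) simp_all
    fix f \<delta> assume f: "f \<in> I" "\<delta> \<in> ends f" "\<delta> \<in> K"
    obtain g where "g \<in> I" "\<delta> \<in> ends g" "c g = c f" "ends g \<subseteq> K"
      using K_s[OF f(3)] K_opp[OF f(3)] neq_iff_opp[of "c f" s] by metis
    then have "ends f \<subseteq> K" using color_unique[OF proper] f by metis
    then show "other f \<delta> \<in> K" using other_in_ends by blast
  qed
  have "deg I \<delta> = 2" if \<delta>: "\<delta> \<in> C" for \<delta>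
  proof (rule antisym)
    show "deg I \<delta> \<le> 2" using Deg by (simp add: cond_Deg_def)
    obtain g h where gh: "g \<in> I" "\<delta> \<in> ends g" "c g = s" "h \<in> I" "\<delta> \<in> ends h" "c h = opp s"
      using K_s K_opp \<delta> C by blast
    then have "g \<noteq> h" by auto
    then have "2 = card {g, h}" by simp
    also have "\<dots> \<le> deg I \<delta>" unfolding deg_def using gh by (intro card_mono) auto
    finally show "2 \<le> deg I \<delta>" .
  qed
  then have "cycle_component I C" unfolding C_def using Deg by (intro cycle_component_of_regular)
  then obtain g where g: "g \<in> component_edges I C" "c g = s" "rank_edge A 1 g"
    using Cycle unfolding cond_Cycle_def by blast
  then have "g \<in> I" "Inl (fst g) \<in> K" using C by (auto simp: component_edges_def ends_def)
  then obtain h where "h \<in> I" "Inl (fst g) \<in> ends h" "c h = s" "rank_edge A 2 h" using K_s by blast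
  then have "h = g" using color_unique[OF proper, of h g "Inl (fst g)"] g(2) \<open>g \<in> I\<close> by simp
  then show False using g(3) \<open>rank_edge A 2 h\<close> rank_edge_exclusive by blast
qed

text \<open>
  After the deletion of \<open>e\<close> one vertex fewer covers part \<open>s\<close>: beyond \<open>e\<close> the other ends of the
  edges in \<open>D s\<close> are chosen.
\<close>

lemma rank_part_delete_less:
  assumes Cycle: "cond_Cycle A c I" and e: "e \<in> I" "c e = opp s"
  shows "rank (gmat (part s (I - {e}))) < card (D s)"
proof -
  define S where "S = (nxt s)\<^sup>* `` {e}"
  have eS: "e \<in> S" by (simp add: S_def)
  have S_D: "S \<subseteq> D s"
  proof
    fix f assume "f \<in> S"
    then have "(e, f) \<in> (nxt s)\<^sup>*" by (simp add: S_def)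
    then show "f \<in> D s" using e by (cases rule: rtranclE) (auto simp: D_def nxt_def)
  qed
  have "rank (gmat (part s (I - {e}))) \<le>
    card ((\<lambda>f. (fst f, idx s)) ` (D s - S)) + card ((\<lambda>f. (snd f, idx s)) ` (S - {e}))"
  proof (rule rank_le_cover)
    fix p q assume "gmat (part s (I - {e})) $ p $ q \<noteq> 0"
    then obtain g where g: "g \<in> I - {e}" "p = (fst g, idx s)" "q = (snd g, idx s)"
      "g \<in> D s \<or> c g = s \<and> rank_edge A 2 g \<and> \<not> isolated I g"
      using part_nonzeroD[of s "I - {e}" p q] by blast
    show "p \<in> (\<lambda>f. (fst f, idx s)) ` (D s - S) \<or> q \<in> (\<lambda>f. (snd f, idx s)) ` (S - {e})"
    proof (cases "g \<in> D s")
      case True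
      then show ?thesis using g(1,2,3) by blast
    next
      case False
      then have g': "c g = s" "rank_edge A 2 g" "\<not> isolated I g" "g \<in> I" using g by auto
      obtain f where f: "f \<in> D s" "fst g = fst f" "c f = opp s"
        using other_end_in_D[OF g'(4,1,2,3), of "Inl (fst g)"] by auto
      obtain f' where f': "f' \<in> D s" "snd g = snd f'" "c f' = opp s"
        using other_end_in_D[OF g'(4,1,2,3), of "Inr (snd g)"] by auto
      show ?thesis
      proof (cases "f \<in> S")
        case True
        \<comment> \<open>A rank-2 edge at the left end of a member of \<open>S\<close> leads to the
          right end of another; acyclicity ensures that this is not the uncovered
          \<open>e\<close>.\<close>
        have N: "(f, f') \<in> nxt s" using f f' g' by (auto simp: nxt_def D_def)
        then have "f' \<in> S" using True by (auto simp: S_def intro: rtrancl_into_rtrancl)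
        moreover have "f' \<noteq> e"
        proof
          assume "f' = e"
          then have "(e, e) \<in> (nxt s)\<^sup>+" using True N by (auto simp: S_def intro: rtrancl_into_trancl1)
          then show False using nxt_acyclic[OF Cycle] by blast
        qed
        ultimately show ?thesis using g(3) f'(2) by auto
      next
        case False
        then show ?thesis using g(2) f by auto
      qed
    qed
  qed
  also have "\<dots> \<le> card (D s - S) + card (S - {e})"
    by (intro add_mono card_image_le) auto
  also have "\<dots> = card (D s) - card S + (card S - 1)"
    using S_D eS by (simp add: card_Diff_subset)
  also have "\<dots> < card (D s)"
  proof -
    have "card S \<le> card (D s)" using S_D by (simp add: card_mono)
    moreover have "card S > 0" using eS by (auto simp: card_gt_0_iff)
    ultimately show ?thesis by linarith
  qed
  finally show ?thesis .
qed

text \<open>With \<open>s\<close> opposite to the color of \<open>e\<close>, the edge belongs to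
  \<open>D s\<close>, so part \<open>s\<close> loses rank, while the other part stays bounded by its
  matching.\<close>

lemma tight:
  assumes "cond_Cycle A c I"
  shows "tight A I"
  unfolding tight_def
proof
  fix e assume e: "e \<in> I"
  define s where "s = opp (c e)"
  have "rank_on A (I - {e}) = rank (gmat (part s (I - {e}))) + rank (gmat (part (opp s) (I - {e})))"
    by (rule rank_on_parts) blast
  also have "\<dots> < card (D s) + card (D (opp s))"
    using rank_part_delete_less[OF assms e, of s] rank_part_le[of "I - {e}" "opp s"] by (simp add: s_def)
  also have "\<dots> = rank_on A I" using r_val_D rank_on_eq by simp
  finally show "rank_on A (I - {e}) < rank_on A I" .
qed

end

text \<open>
  A new edge \<open>e\<close> is colored after exchanging the colors along the alternating path that starts
  with the other edge at one of its ends; by bipartiteness this path avoids the other end of \<open>e\<close>.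
\<close>

lemma proper_coloring_exists:
  fixes I :: "('m::finite \<times> 'n::finite) set"
  assumes "cond_Deg I"
  shows "\<exists>c. proper_coloring I c"
proof -
  have "finite I" by simp
  then show ?thesis using assms
  proof (induction I rule: finite_induct)
    case empty
    then show ?case by (simp add: proper_coloring_def)
  next
    case (insert e J)
    have "deg J \<gamma> \<le> deg (insert e J) \<gamma>" for \<gamma> unfolding deg_def by (intro card_mono) auto
    then have "cond_Deg J" using insert.prems unfolding cond_Deg_def by (meson order_trans)
    then obtain c where c: "proper_coloring J c" using insert.IH by blast
    \<comment> \<open>If \<open>e\<close> meets only edges of one color, the opposite color is free
      for it; the rest of the proof arranges this situation.\<close>
    have extend: "\<exists>c. proper_coloring (insert e J) c"
      if d: "proper_coloring J d" "\<And>f. f \<in> J \<Longrightarrow> ends e \<inter> ends f \<noteq> {} \<Longrightarrow> d f = t" for d t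
    proof (intro exI)
      show "proper_coloring (insert e J) (d(e := opp t))"
        unfolding proper_coloring_def
      proof (intro ballI impI)
        fix f g assume fg: "f \<in> insert e J" "g \<in> insert e J" "f \<noteq> g \<and> ends f \<inter> ends g \<noteq> {}"
        consider "f = e" "g \<in> J" | "g = e" "f \<in> J" | "f \<noteq> e" "g \<noteq> e" "f \<in> J" "g \<in> J"
          using fg by blast
        then show "(d(e := opp t)) f \<noteq> (d(e := opp t)) g"
        proof cases
          case 1
          then show ?thesis using d(2)[of g] fg(3) by auto
        next
          case 2
          then show ?thesis using d(2)[of f] fg(3) by (auto simp: Int_commute)
        next
          case 3
          then show ?thesis using d(1) fg(3) unfolding proper_coloring_def by auto
        qed
      qed
    qed
    have uniq: "f = g" if "f \<in> J" "g \<in> J" "\<gamma> \<in> ends e" "\<gamma> \<in> ends f" "\<gamma> \<in> ends g" for f g \<gamma>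
      using deg_third_edge[OF insert.prems, of e f g \<gamma>] that insert.hyps(2) by auto
    show ?case
    proof (cases "\<exists>t. \<forall>f\<in>J. ends e \<inter> ends f \<noteq> {} \<longrightarrow> c f = t")
      case True
      then show ?thesis using extend[OF c] by blast
    next
      case False
      have touch: "fst f = fst e \<or> snd f = snd e" if "ends e \<inter> ends f \<noteq> {}" for f
        using that by (auto simp: ends_def)
      have "\<exists>p\<in>J. fst p = fst e"
      proof (rule ccontr)
        assume n: "\<not> (\<exists>p\<in>J. fst p = fst e)"
        have "f = g" if "f \<in> J" "g \<in> J" "ends e \<inter> ends f \<noteq> {}" "ends e \<inter> ends g \<noteq> {}" for f g
          using uniq[OF that(1,2), of "Inr (snd e)"] touch[OF that(3)] touch[OF that(4)] n that(1,2) by auto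
        then show False using False by metis
      qed
      then obtain p where p: "p \<in> J" "fst p = fst e" by blast
      define s where "s = c p"
      have "\<exists>q\<in>J. snd q = snd e \<and> c q \<noteq> s"
      proof (rule ccontr)
        assume n: "\<not> (\<exists>q\<in>J. snd q = snd e \<and> c q \<noteq> s)"
        have "c f = s" if "f \<in> J" "ends e \<inter> ends f \<noteq> {}" for f
          using touch[OF that(2)] uniq[OF that(1) p(1), of "Inl (fst e)"] p n that(1) by (auto simp: s_def)
        then show False using False by blast
      qed
      then obtain q where q: "q \<in> J" "snd q = snd e" "c q = opp s" by (auto simp: neq_iff_opp)
      \<comment> \<open>Edges of color \<open>s\<close> are left through their right end, the others
        through their left end, so the path starts at \<open>p\<close> on the side away from
        \<open>e\<close>.\<close>
      define N where "N = {(f, f'). f \<in> J \<and> f' \<in> J \<and> f \<noteq> f' \<and>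
        (c f = s \<and> snd f = snd f' \<or> c f = opp s \<and> fst f = fst f')}"
      define S where "S = N\<^sup>* `` {p}"
      have S_J: "f \<in> J" if "f \<in> S" for f
      proof -
        have "(p, f) \<in> N\<^sup>*" using that by (simp add: S_def)
        then show ?thesis using p(1) by (cases rule: rtranclE) (auto simp: N_def)
      qed
      have S_step: "f' \<in> S" if "f \<in> S" "(f, f') \<in> N" for f f'
        using that by (auto simp: S_def intro: rtrancl_into_rtrancl)
      have S_pred: "f = p \<or> (\<exists>g\<in>S. (g, f) \<in> N)" if "f \<in> S" for f
      proof -
        have "(p, f) \<in> N\<^sup>*" using that by (simp add: S_def)
        then show ?thesis by (cases rule: rtranclE) (auto simp: S_def)
      qed
      have N_color: "c g = opp (c f)" if "(f, g) \<in> N" for f g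
      proof -
        have "f \<in> J" "g \<in> J" "f \<noteq> g" "ends f \<inter> ends g \<noteq> {}" using that by (auto simp: N_def ends_def)
        then have "c g \<noteq> c f" using c unfolding proper_coloring_def by metis
        then show ?thesis by (simp add: neq_iff_opp)
      qed
      \<comment> \<open>The neighbor of an edge on the side where the path entered is its
        predecessor; hence \<open>S\<close> is closed under adjacency, and exchanging its colors
        keeps the coloring proper.\<close>
      have S_adj: "f' \<in> S" if f: "f \<in> S" "f' \<in> J" "f \<noteq> f'" "ends f \<inter> ends f' \<noteq> {}" for f f'
      proof (cases "(f, f') \<in> N")
        case True
        then show ?thesis using S_step f(1) by blast
      next
        case False
        have fJ: "f \<in> J" using S_J f(1) by blast
        have "fst f = fst f' \<or> snd f = snd f'" using f(4) by (auto simp: ends_def)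
        then have side: "c f = s \<and> fst f = fst f' \<or> c f = opp s \<and> snd f = snd f'"
          using False fJ f(2,3) neq_iff_opp[of "c f" s] by (auto simp: N_def)
        have "f \<noteq> p"
        proof
          assume "f = p"
          then have "fst f' = fst e" using side p(2) by (simp add: s_def)
          then have "f = f'" using uniq[OF fJ f(2), of "Inl (fst e)"] p(2) \<open>f = p\<close> by simp
          then show False using f(3) by simp
        qed
        then obtain g where g: "g \<in> S" "(g, f) \<in> N" using S_pred f(1) by blast
        have col: "c f = opp (c g)" by (rule N_color[OF g(2)])
        have "c f' \<noteq> c f" using c f fJ unfolding proper_coloring_def by metis
        then have col': "c f' = c g" using col neq_iff_opp[of "c f'" "c f"] by simp
        have gJ: "g \<in> J" using S_J g(1) by blast
        have "g = f'"
        proof (cases "c f = s")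
          case True
          then have "c g = opp s" using col by (metis opp_opp)
          then have "fst g = fst f" using g(2) by (auto simp: N_def)
          moreover have "fst f = fst f'" using side True by auto
          ultimately show ?thesis using color_unique[OF c gJ f(2), of "Inl (fst f)"] col' by simp
        next
          case no: False
          then have "c g = s" using col neq_iff_opp[of "c f" s] by simp
          then have "snd g = snd f" using g(2) by (auto simp: N_def)
          moreover have "snd f = snd f'" using side no by auto
          ultimately show ?thesis using color_unique[OF c gJ f(2), of "Inr (snd f)"] col' by simp
        qed
        then show ?thesis using g(1) by simp
      qed
      \<comment> \<open>Reaching \<open>q\<close> requires an edge of color \<open>s\<close> in
        \<open>J\<close> at its right end, but there (Deg) leaves room only for \<open>q\<close> and
        \<open>e\<close>.\<close>
      have qS: "q \<notin> S"
      proof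
        assume "q \<in> S"
        moreover have "q \<noteq> p" using q(3) by (auto simp: s_def)
        ultimately obtain g where g: "g \<in> S" "(g, q) \<in> N" using S_pred by blast
        then have "c g = s" using N_color[OF g(2)] q(3) by simp
        then have "snd g = snd e" "g \<noteq> q" using g(2) q(2) by (auto simp: N_def)
        then show False using uniq[OF S_J[OF g(1)] q(1), of "Inr (snd e)"] q(2) by simp
      qed
      define d where "d = (\<lambda>f. if f \<in> S then opp (c f) else c f)"
      have "proper_coloring J d"
        unfolding proper_coloring_def
      proof (intro ballI impI)
        fix f g assume fg: "f \<in> J" "g \<in> J" "f \<noteq> g \<and> ends f \<inter> ends g \<noteq> {}"
        have "f \<in> S \<longleftrightarrow> g \<in> S" using S_adj[of f g] S_adj[of g f] fg by (auto simp: Int_commute)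
        moreover have "c f \<noteq> c g" using c fg unfolding proper_coloring_def by blast
        ultimately show "d f \<noteq> d g" by (auto simp: d_def)
      qed
      moreover have "d f = opp s" if f: "f \<in> J" "ends e \<inter> ends f \<noteq> {}" for f
        using touch[OF f(2)]
      proof
        assume "fst f = fst e"
        then have "f = p" using uniq[OF f(1) p(1), of "Inl (fst e)"] p(2) by simp
        moreover have "p \<in> S" by (simp add: S_def)
        ultimately show ?thesis by (simp add: d_def s_def)
      next
        assume "snd f = snd e"
        then have "f = q" using uniq[OF f(1) q(1), of "Inr (snd e)"] q(2) by simp
        then show ?thesis using qS q(3) by (simp add: d_def)
      qed
      ultimately show ?thesis using extend by blast
    qed
  qed
qed

text \<open>The coloring is required to be proper only under (Deg), since otherwise none may exist;
  for a matching, (Deg) is derived before the coloring is used.\<close>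

theorem theorem2p1:
  fixes A :: "'m::{finite,linorder} \<Rightarrow> 'n::{finite,linorder} \<Rightarrow> 'f::field^2^2"
    and I :: "('m \<times> 'n) set"
  assumes "I \<subseteq> edges A"
  shows "(\<forall>c. (cond_Deg I \<longrightarrow> proper_coloring I c) \<longrightarrow>
            (is_matching A I \<longleftrightarrow>
               cond_Deg I \<and> cond_Path A I \<and> cond_Cycle A c I \<and> cond_VL A c I)) \<and>
         (is_matching A I \<longrightarrow> rank_on A I = r_val A I)"
proof -
  have matching_iff: "is_matching A I \<longleftrightarrow> tight A I"
    using assms by (simp add: is_matching_def tight_def)
  have "is_matching A I \<longleftrightarrow> cond_Deg I \<and> cond_Path A I \<and> cond_Cycle A c I \<and> cond_VL A c I"
    if c: "cond_Deg I \<longrightarrow> proper_coloring I c" for c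
  proof
    assume "is_matching A I"
    then have t: "tight A I" by (simp add: matching_iff)
    then have Deg: "cond_Deg I" by (rule tight_Deg)
    then have "proper_coloring I c" using c by blast
    then show "cond_Deg I \<and> cond_Path A I \<and> cond_Cycle A c I \<and> cond_VL A c I"
      using Deg tight_Path[OF assms t] tight_Cycle[OF assms t] tight_VL[OF assms t] by blast
  next
    assume h: "cond_Deg I \<and> cond_Path A I \<and> cond_Cycle A c I \<and> cond_VL A c I"
    then obtain L where "valid_labeling A c I L" by (auto simp: cond_VL_def)
    then interpret labeled_graph A I c L using h c assms by unfold_locales auto
    show "is_matching A I" using tight h by (simp add: matching_iff)
  qed
  moreover have "rank_on A I = r_val A I" if "is_matching A I"
  proof -
    have t: "tight A I" using that by (simp add: matching_iff)
    then have Deg: "cond_Deg I" by (rule tight_Deg)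
    \<comment> \<open>The rank formula mentions no coloring, so one has to be supplied.\<close>
    then obtain c where c: "proper_coloring I c" using proper_coloring_exists by blast
    obtain L where "valid_labeling A c I L" using tight_VL[OF assms t c] by (auto simp: cond_VL_def)
    then interpret labeled_graph A I c L
      using Deg c assms tight_Path[OF assms t] by unfold_locales auto
    show ?thesis by (rule rank_on_eq)
  qed
  ultimately show ?thesis by blast
qed

end
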